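(* Let $d\ge2$, $\mathcal{Y}=\{1,\dots,d\}$, $f:\mathcal{Y}\to(0,\infty)$, $\alpha_1,\dots,\alpha_d>0$ with $\sum_i\alpha_i=1$, and $T>0$. Put $\lambda_i=f^2(i)$ and assume that $(\lambda_i)_{1\le i\le d}$ satisfies Condition (C). If $f$ is not constant on $\mathcal{Y}$, then the solutions $(X_t)_{t\in[0,T]}$ to $$dX_t=\frac{f(Y)}{\sqrt{\mathbb{E}[f^2(Y)\mid X_t]}}\,dW_t,\qquad X_0=0,$$ where $Y$ is a random variable with $\mathbb{P}(Y=i)=\alpha_i$ for $i\in\mathcal Y$, independent of the Brownian motion $(W_t)$, are continuous fake Brownian motions.
   Context: Condition (C): there exists a symmetric positive definite real $d\times d$ matrix $\Gamma$ such that for every $1\le k\le d$ the $d\times d$ matrix $\Gamma^{(k)}$ with coefficients $\Gamma^{(k)}_{ij}=\frac{\lambda_i+\lambda_j}{2}\left(\Gamma_{ij}+\Gamma_{kk}-\Gamma_{ik}-\Gamma_{jk}\right)$ is positive definite on $e_k^\perp=\{y\in\mathbb{R}^d: y_k=0\}$. A continuous fake Brownian motion is a continuous martingale $(X_t)$ such that $X_t\sim\mathcal{N}(0,t)$ for every $t$, but whose law as a process differs from the law of Brownian motion. Solutions are weak solutions: a filtered probability space with a Brownian motion $W$, a random variable $Y$ measurable at time $0$, and a continuous adapted process $X$ satisfying the equation. *)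

theory Defs
  imports "HOL-Probability.Probability"
begin

section \<open>Condition (C)\<close>

definition positive_definite_on :: "(real ^ 'n::finite) set \<Rightarrow> real ^ 'n ^ 'n \<Rightarrow> bool" where
  "positive_definite_on S A \<longleftrightarrow> (\<forall>y\<in>S. y \<noteq> 0 \<longrightarrow> 0 < y \<bullet> (A *v y))"

definition Gamma_k :: "('n::finite \<Rightarrow> real) \<Rightarrow> real ^ 'n ^ 'n \<Rightarrow> 'n \<Rightarrow> real ^ 'n ^ 'n" where
  "Gamma_k l \<Gamma> k =
     (\<chi> i j. (l i + l j) / 2 * (\<Gamma> $ i $ j + \<Gamma> $ k $ k - \<Gamma> $ i $ k - \<Gamma> $ j $ k))"

definition condition_C :: "('n::finite \<Rightarrow> real) \<Rightarrow> bool" where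
  "condition_C l \<longleftrightarrow>
     (\<exists>\<Gamma> :: real ^ 'n ^ 'n. transpose \<Gamma> = \<Gamma> \<and> positive_definite_on UNIV \<Gamma> \<and>
        (\<forall>k. positive_definite_on {y. y $ k = 0} (Gamma_k l \<Gamma> k)))"

section \<open>Processes on the time interval from 0 to T\<close>

text \<open>Filtrations and processes are indexed by all reals, but apart from the requirement that
  \<open>F\<close> is a filtration only the times in \<open>{0..T}\<close> are ever used; a filtration indexed by
  \<open>{0..T}\<close> extends by constants. Neither completeness nor right-continuity is required.\<close>

definition filtered_prob_space :: "'a measure \<Rightarrow> (real \<Rightarrow> 'a measure) \<Rightarrow> bool" where
  "filtered_prob_space M F \<longleftrightarrow>
     prob_space M \<and> filtration (space M) F \<and> (\<forall>t. subalgebra M (F t))"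

definition continuous_adapted ::
  "'a measure \<Rightarrow> (real \<Rightarrow> 'a measure) \<Rightarrow> real \<Rightarrow> (real \<Rightarrow> 'a \<Rightarrow> real) \<Rightarrow> bool" where
  "continuous_adapted M F T X \<longleftrightarrow>
     (\<forall>t\<in>{0..T}. X t \<in> borel_measurable (F t)) \<and>
     (\<forall>\<omega>\<in>space M. continuous_on {0..T} (\<lambda>t. X t \<omega>))"

definition progressive ::
  "(real \<Rightarrow> 'a measure) \<Rightarrow> real \<Rightarrow> (real \<Rightarrow> 'a \<Rightarrow> real) \<Rightarrow> bool" where
  "progressive F T H \<longleftrightarrow>
     (\<forall>t\<in>{0..T}. (\<lambda>(s, \<omega>). H s \<omega>) \<in>
        borel_measurable (restrict_space borel {0..t} \<Otimes>\<^sub>M F t))"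

definition martingale_on ::
  "'a measure \<Rightarrow> (real \<Rightarrow> 'a measure) \<Rightarrow> real \<Rightarrow> (real \<Rightarrow> 'a \<Rightarrow> real) \<Rightarrow> bool" where
  "martingale_on M F T X \<longleftrightarrow>
     (\<forall>t\<in>{0..T}. X t \<in> borel_measurable (F t) \<and> integrable M (X t)) \<and>
     (\<forall>s\<in>{0..T}. \<forall>t\<in>{s..T}. AE \<omega> in M. real_cond_exp M (F s) (X t) \<omega> = X s \<omega>)"

definition brownian_motion ::
  "'a measure \<Rightarrow> (real \<Rightarrow> 'a measure) \<Rightarrow> real \<Rightarrow> (real \<Rightarrow> 'a \<Rightarrow> real) \<Rightarrow> bool" where
  "brownian_motion M F T W \<longleftrightarrow>
     filtered_prob_space M F \<and> continuous_adapted M F T W \<and>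
     (AE \<omega> in M. W 0 \<omega> = 0) \<and>
     (\<forall>s\<in>{0..T}. \<forall>t\<in>{s<..T}.
        distributed M lborel (\<lambda>\<omega>. W t \<omega> - W s \<omega>) (normal_density 0 (sqrt (t - s))) \<and>
        prob_space.indep_set M (sets (F s))
          {(\<lambda>\<omega>. W t \<omega> - W s \<omega>) -` B \<inter> space M | B. B \<in> sets borel})"

definition process_law ::
  "'a measure \<Rightarrow> real \<Rightarrow> (real \<Rightarrow> 'a \<Rightarrow> real) \<Rightarrow> (real \<Rightarrow> real) measure" where
  "process_law M T X = distr M (\<Pi>\<^sub>M t\<in>{0..T}. borel) (\<lambda>\<omega>. \<lambda>t\<in>{0..T}. X t \<omega>)"

text \<open>The degenerate law of \<open>X\<^sub>0\<close> is stated separately because \<open>normal_density 0 0\<close> is not a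
  density. All Brownian motions on \<open>{0..T}\<close> have the same law, whatever their probability space,
  and one exists on the type \<open>real \<Rightarrow> real\<close> of paths (the canonical space of continuous
  functions), so letting \<open>B\<close> range over Brownian motions on that type loses no generality.\<close>

definition continuous_fake_brownian_motion ::
  "'a measure \<Rightarrow> (real \<Rightarrow> 'a measure) \<Rightarrow> real \<Rightarrow> (real \<Rightarrow> 'a \<Rightarrow> real) \<Rightarrow> bool" where
  "continuous_fake_brownian_motion M F T X \<longleftrightarrow>
     filtered_prob_space M F \<and> continuous_adapted M F T X \<and> martingale_on M F T X \<and>
     (AE \<omega> in M. X 0 \<omega> = 0) \<and>
     (\<forall>t\<in>{0<..T}. distributed M lborel (X t) (normal_density 0 (sqrt t))) \<and>
     (\<forall>(N :: (real \<Rightarrow> real) measure) G B.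
        brownian_motion N G T B \<longrightarrow> process_law M T X \<noteq> process_law N T B)"

section \<open>The Ito integral\<close>

text \<open>A simple process is \<open>\<Sum>i<n. \<xi>\<^sub>i 1_{(p\<^sub>i, p\<^sub>i\<^sub>+\<^sub>1]}\<close> with \<open>\<xi>\<^sub>i\<close> bounded and measurable at time \<open>p\<^sub>i\<close>.\<close>

definition simple_data ::
  "'a measure \<Rightarrow> (real \<Rightarrow> 'a measure) \<Rightarrow> real \<Rightarrow> nat \<Rightarrow> (nat \<Rightarrow> real) \<Rightarrow> (nat \<Rightarrow> 'a \<Rightarrow> real) \<Rightarrow> bool"
where
  "simple_data M F T n p \<xi> \<longleftrightarrow>
     (\<forall>i\<le>n. p i \<in> {0..T}) \<and> (\<forall>i<n. p i \<le> p (Suc i)) \<and>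
     (\<forall>i<n. \<xi> i \<in> borel_measurable (F (p i)) \<and> (\<exists>c. \<forall>\<omega>\<in>space M. \<bar>\<xi> i \<omega>\<bar> \<le> c))"

definition simple_process ::
  "nat \<Rightarrow> (nat \<Rightarrow> real) \<Rightarrow> (nat \<Rightarrow> 'a \<Rightarrow> real) \<Rightarrow> real \<Rightarrow> 'a \<Rightarrow> real" where
  "simple_process n p \<xi> s \<omega> = (\<Sum>i<n. \<xi> i \<omega> * indicator {p i<..p (Suc i)} s)"

definition simple_ito_integral ::
  "(real \<Rightarrow> 'a \<Rightarrow> real) \<Rightarrow> nat \<Rightarrow> (nat \<Rightarrow> real) \<Rightarrow> (nat \<Rightarrow> 'a \<Rightarrow> real) \<Rightarrow> real \<Rightarrow> 'a \<Rightarrow> real" where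
  "simple_ito_integral W n p \<xi> t \<omega> =
     (\<Sum>i<n. \<xi> i \<omega> * (W (min t (p (Suc i))) \<omega> - W (min t (p i)) \<omega>))"

text \<open>\<open>has_ito_integral M F T W H I\<close>: \<open>H\<close> is progressively measurable and square integrable on
  \<open>{0..T} \<times> \<Omega>\<close>, and \<open>I\<close> is a continuous version of \<open>(\<integral>\<^sub>0\<^sup>t H\<^sub>s dW\<^sub>s)\<^sub>t\<close>, obtained as
  the limit in mean square of the integrals of simple processes converging to \<open>H\<close>.\<close>

definition has_ito_integral ::
  "'a measure \<Rightarrow> (real \<Rightarrow> 'a measure) \<Rightarrow> real \<Rightarrow> (real \<Rightarrow> 'a \<Rightarrow> real) \<Rightarrow>
   (real \<Rightarrow> 'a \<Rightarrow> real) \<Rightarrow> (real \<Rightarrow> 'a \<Rightarrow> real) \<Rightarrow> bool" where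
  "has_ito_integral M F T W H I \<longleftrightarrow>
     progressive F T H \<and>
     (\<integral>\<^sup>+\<omega>. (\<integral>\<^sup>+s\<in>{0..T}. ennreal ((H s \<omega>)\<^sup>2) \<partial>lborel) \<partial>M) < \<infinity> \<and>
     continuous_adapted M F T I \<and>
     (\<exists>n p \<xi>. (\<forall>m. simple_data M F T (n m) (p m) (\<xi> m)) \<and>
        (\<lambda>m. \<integral>\<^sup>+\<omega>. (\<integral>\<^sup>+s\<in>{0..T}.
            ennreal ((simple_process (n m) (p m) (\<xi> m) s \<omega> - H s \<omega>)\<^sup>2) \<partial>lborel) \<partial>M)
          \<longlonglongrightarrow> 0 \<and>
        (\<forall>t\<in>{0..T}.
          (\<lambda>m. \<integral>\<^sup>+\<omega>. ennreal ((simple_ito_integral W (n m) (p m) (\<xi> m) t \<omega> - I t \<omega>)\<^sup>2) \<partial>M)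
            \<longlonglongrightarrow> 0))"

section \<open>Weak solutions of the stochastic differential equation\<close>

text \<open>Conditional expectations are defined up to null sets separately for each \<open>t\<close>, so the
  integrand needs a progressively measurable process \<open>V\<close> with \<open>V\<^sub>t = E[f\<^sup>2(Y) | X\<^sub>t]\<close> almost surely
  for each \<open>t\<close>. By Fubini two choices of \<open>V\<close> agree almost everywhere on \<open>{0..T} \<times> \<Omega>\<close>, so the
  integral does not depend on the choice. The integrand is bounded almost everywhere, hence
  square integrable. The independence of \<open>Y\<close> and \<open>W\<close> already follows from \<open>Y\<close> being measurable
  at time 0.\<close>

definition cond_exp_given :: "'a measure \<Rightarrow> ('a \<Rightarrow> real) \<Rightarrow> ('a \<Rightarrow> real) \<Rightarrow> 'a \<Rightarrow> real" where
  "cond_exp_given M Z X = real_cond_exp M (vimage_algebra (space M) X borel) Z"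

definition weak_solution ::
  "('n::finite \<Rightarrow> real) \<Rightarrow> ('n \<Rightarrow> real) \<Rightarrow> real \<Rightarrow> 'a measure \<Rightarrow> (real \<Rightarrow> 'a measure) \<Rightarrow>
   (real \<Rightarrow> 'a \<Rightarrow> real) \<Rightarrow> ('a \<Rightarrow> 'n) \<Rightarrow> (real \<Rightarrow> 'a \<Rightarrow> real) \<Rightarrow> bool" where
  "weak_solution f \<alpha> T M F W Y X \<longleftrightarrow>
     filtered_prob_space M F \<and> brownian_motion M F T W \<and>
     Y \<in> measurable (F 0) (count_space UNIV) \<and>
     (\<forall>i. measure M {\<omega> \<in> space M. Y \<omega> = i} = \<alpha> i) \<and>
     prob_space.indep_set M
       {Y -` A \<inter> space M | A. A \<in> sets (count_space UNIV)}
       {(\<lambda>\<omega>. \<lambda>t\<in>{0..T}. W t \<omega>) -` B \<inter> space M | B. B \<in> sets (\<Pi>\<^sub>M t\<in>{0..T}. borel)} \<and>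
     continuous_adapted M F T X \<and> (AE \<omega> in M. X 0 \<omega> = 0) \<and>
     (\<exists>V. progressive F T V \<and>
        (\<forall>t\<in>{0..T}. AE \<omega> in M. V t \<omega> = cond_exp_given M (\<lambda>\<omega>. (f (Y \<omega>))\<^sup>2) (X t) \<omega>) \<and>
        has_ito_integral M F T W (\<lambda>t \<omega>. f (Y \<omega>) / sqrt (V t \<omega>)) X)"

end

theory Submission
  imports Defs
begin

text \<open>Write \<open>H\<^sub>t = f(Y) / sqrt(E[f\<^sup>2(Y) | X\<^sub>t])\<close>, so that \<open>E[H\<^sub>t\<^sup>2 | X\<^sub>t] = 1\<close>. For bounded
  \<open>g\<close> measurable at time 0, Ito's formula for the exponential gives
  \<open>E[g exp(iuX\<^sub>t)] = E[g] - u\<^sup>2/2 \<integral>\<^sub>0\<^sup>t E[g H\<^sub>s\<^sup>2 exp(iuX\<^sub>s)] ds\<close>.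
  It is an exact identity for simple integrands, because the increments of \<open>W\<close> are Gaussian and
  independent of the past, and it passes to the limit. With \<open>g = 1\<close> it becomes a linear integral
  equation for the characteristic function of \<open>X\<^sub>t\<close>, whence \<open>X\<^sub>t \<sim> N(0, t)\<close>.

  If \<open>X\<close> had the law of Brownian motion, its discrete quadratic variations would converge to \<open>T\<close> in
  mean square. Weighting them with \<open>f\<^sup>2(Y)\<close> and using the martingale property and the Ito isometry
  yields \<open>E \<integral>\<^sub>0\<^sup>T f\<^sup>2(Y) H\<^sub>s\<^sup>2 ds = T E[f\<^sup>2(Y)]\<close>, that is,
  \<open>E \<integral>\<^sub>0\<^sup>T (f\<^sup>2(Y) - V\<^sub>s)\<^sup>2 / V\<^sub>s ds = 0\<close> with \<open>V\<^sub>s = E[f\<^sup>2(Y) | X\<^sub>s]\<close>. Hence \<open>H = 1\<close> almost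
  everywhere, and the identity with \<open>g = f\<^sup>2(Y)\<close> shows that reweighting by \<open>f\<^sup>2(Y)\<close> does not change
  the law of \<open>X\<^sub>s\<close> up to normalisation. So \<open>V\<^sub>s\<close> is constant, and therefore so is \<open>f\<close>.\<close>

section \<open>Measure-theoretic preliminaries\<close>

text \<open>Only functionals of the path carry over. Squared increments along a grid are suitable
  because their centred sum is small in mean square, hence remains small after multiplication by any
  bounded g; when g is measurable at time 0, the martingale property still telescopes the weighted
  sum. For g = 1 this follows by conditioning on X_s, since exp(iuX_s) is a function of X_s. For g =
  f^2(Y) such conditioning does not help, and it is H^2 = 1 that closes the equation. The weight
  f^2(Y) is chosen because it produces a perfect square: f^4(Y)/V - 2 f^2(Y) + V = (f^2(Y) - V)^2/V,
  where f^4(Y)/V, f^2(Y) and V all have the same integral over time and space. Each V_t is pinned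
  down only up to a null set depending on t, so bounds are moved to the product of time and space by
  Fubini, and equations in time are required only almost everywhere.\<close>

abbreviation time_measure :: "real \<Rightarrow> real measure" where
  "time_measure T \<equiv> restrict_space lborel {0..T}"

lemma sets_time_measure [measurable_cong]:
  "sets (time_measure T) = sets (restrict_space borel {0..T})"
  by (simp add: sets_restrict_space)

lemma space_time_measure: "space (time_measure T) = {0..T}"
  by (simp add: space_restrict_space)

lemma finite_measure_time_measure: "finite_measure (time_measure T)"
  by (rule finite_measureI)
     (simp add: emeasure_restrict_space space_restrict_space emeasure_lborel_cbox_eq
       emeasure_lborel_Icc_eq)

lemma borel_measurable_time_measure:
  "(\<lambda>s. s) \<in> borel_measurable (time_measure T)"
  by (rule measurable_restrict_space1) simp

text \<open>Rounding time down to a grid of mesh 1/n turns X into a countable gluing of the maps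
  \<open>X t\<close>, which is jointly measurable; path continuity makes these approximations
  converge pointwise.\<close>

lemma borel_measurable_continuous_process:
  fixes X :: "real \<Rightarrow> 'a \<Rightarrow> real"
  assumes meas: "\<And>t. t \<in> {0..T} \<Longrightarrow> X t \<in> borel_measurable M"
    and cont: "\<And>\<omega>. \<omega> \<in> space M \<Longrightarrow> continuous_on {0..T} (\<lambda>t. X t \<omega>)"
  shows "(\<lambda>(s, \<omega>). X s \<omega>) \<in> borel_measurable (time_measure T \<Otimes>\<^sub>M M)"
proof -
  \<comment> \<open>The clamp to \<open>{0..T}\<close> matters for the gluing over all integers
    below, since the hypotheses on X cover only such times.\<close>
  define g where "g n s = max 0 (min T (of_int \<lfloor>s * real n\<rfloor> / real n))" for n :: nat and s :: real
  have lim: "(\<lambda>n. X (g n s) \<omega>) \<longlonglongrightarrow> X s \<omega>" if "s \<in> {0..T}" "\<omega> \<in> space M" for s \<omega>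
  proof -
    have "(\<lambda>n. of_int \<lfloor>s * real n\<rfloor> / real n) \<longlonglongrightarrow> s"
    proof (rule tendsto_sandwich)
      show "\<forall>\<^sub>F n in sequentially. s - 1 / real n \<le> of_int \<lfloor>s * real n\<rfloor> / real n"
        using eventually_gt_at_top[of 0]
      proof eventually_elim
        case (elim n)
        have "s * real n - 1 \<le> of_int \<lfloor>s * real n\<rfloor>" by linarith
        from divide_right_mono[OF this, of "real n"] elim
        show ?case by (simp add: diff_divide_distrib)
      qed
      show "\<forall>\<^sub>F n in sequentially. of_int \<lfloor>s * real n\<rfloor> / real n \<le> s"
        using eventually_gt_at_top[of 0]
        by eventually_elim (simp add: field_simps)
      show "(\<lambda>n. s - 1 / real n) \<longlonglongrightarrow> s"
        by (rule tendsto_eq_intros lim_1_over_n refl | simp)+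
    qed simp
    then have "(\<lambda>n. g n s) \<longlonglongrightarrow> max 0 (min T s)"
      unfolding g_def by (intro tendsto_intros)
    moreover have "max 0 (min T s) = s" using that by auto
    ultimately have "(\<lambda>n. g n s) \<longlonglongrightarrow> s" by simp
    moreover have "g n s \<in> {0..T}" for n using that by (auto simp: g_def)
    ultimately show ?thesis
      using cont[OF that(2)] that(1) unfolding continuous_on_sequentially comp_def by auto
  qed
  note borel_measurable_time_measure [measurable]
  have "(\<lambda>x. X (g n (fst x)) (snd x)) \<in> borel_measurable (time_measure T \<Otimes>\<^sub>M M)" for n
  proof (cases "T \<ge> 0")
    case True
    have "(\<lambda>x. X (max 0 (min T (of_int \<lfloor>fst x * real n\<rfloor> / real n))) (snd x))
        \<in> borel_measurable (time_measure T \<Otimes>\<^sub>M M)"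
    proof (rule measurable_compose_countable'[where I=UNIV
          and f="\<lambda>i x. X (max 0 (min T (real_of_int i / real n))) (snd x)"])
      show "(\<lambda>x. X (max 0 (min T (real_of_int i / real n))) (snd x))
          \<in> borel_measurable (time_measure T \<Otimes>\<^sub>M M)" for i
        by (rule measurable_compose[OF measurable_snd meas]) (use True in auto)
      show "(\<lambda>x. \<lfloor>fst x * real n\<rfloor>) \<in> time_measure T \<Otimes>\<^sub>M M \<rightarrow>\<^sub>M count_space UNIV"
        by measurable
    qed simp
    then show ?thesis by (simp add: g_def)
  next
    case False
    then have "space (time_measure T \<Otimes>\<^sub>M M) = {}"
      by (simp add: space_pair_measure space_restrict_space)
    then show ?thesis by (simp add: measurable_def)
  qed
  moreover have "(\<lambda>n. X (g n (fst x)) (snd x)) \<longlonglongrightarrow> X (fst x) (snd x)"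
    if "x \<in> space (time_measure T \<Otimes>\<^sub>M M)" for x
    using that by (intro lim) (auto simp: space_pair_measure space_restrict_space)
  ultimately have "(\<lambda>x. X (fst x) (snd x)) \<in> borel_measurable (time_measure T \<Otimes>\<^sub>M M)"
    by (rule borel_measurable_LIMSEQ_metric)
  then show ?thesis by (simp add: case_prod_beta')
qed

text \<open>In place of Cauchy-Schwarz, |y| <= d + y^2/d for every d > 0: the first term integrates
  to d times the total mass, and the second tends to 0 for fixed d.\<close>

lemma (in finite_measure) nn_integral_abs_tendsto_0:
  fixes f :: "'b \<Rightarrow> 'a \<Rightarrow> real"
  assumes [measurable]: "\<And>m. f m \<in> borel_measurable M"
    and lim: "((\<lambda>m. \<integral>\<^sup>+x. ennreal ((f m x)\<^sup>2) \<partial>M) \<longlongrightarrow> 0) G"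
  shows "((\<lambda>m. \<integral>\<^sup>+x. ennreal \<bar>f m x\<bar> \<partial>M) \<longlongrightarrow> 0) G"
proof (rule order_tendstoI)
  fix e :: ennreal assume e: "0 < e"
  define c where "c = measure M (space M)"
  obtain d :: real where d: "d > 0" "ennreal (d * c) < e"
  proof (cases "e = \<infinity>")
    case True then show ?thesis using that[of 1] by (simp add: c_def)
  next
    case False
    then obtain r where r: "e = ennreal r" "r > 0"
      using e by (cases e) auto
    \<comment> \<open>Dividing by 1 + c gives a strict inequality and also covers total mass c =
      0.\<close>
    have "r / (1 + c) * c < r" using r by (simp add: c_def field_simps measure_nonneg add_pos_nonneg)
    then show ?thesis using that[of "r / (1 + c)"] r
      by (simp add: c_def ennreal_lessI add_pos_nonneg)
  qed
  have "((\<lambda>m. ennreal (d * c) + ennreal (1 / d) * (\<integral>\<^sup>+x. ennreal ((f m x)\<^sup>2) \<partial>M)) \<longlongrightarrow>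
      ennreal (d * c) + ennreal (1 / d) * 0) G"
    by (intro tendsto_intros ennreal_tendsto_cmult lim) auto
  then have "\<forall>\<^sub>F m in G. ennreal (d * c) + ennreal (1 / d) * (\<integral>\<^sup>+x. ennreal ((f m x)\<^sup>2) \<partial>M) < e"
    by (rule order_tendstoD) (use d in simp)
  then show "\<forall>\<^sub>F m in G. (\<integral>\<^sup>+x. ennreal \<bar>f m x\<bar> \<partial>M) < e"
  proof eventually_elim
    case (elim m)
    have "\<bar>y\<bar> \<le> d + 1 / d * y\<^sup>2" for y :: real
    proof (cases "\<bar>y\<bar> \<le> d")
      case False
      then have "\<bar>y\<bar> * d \<le> \<bar>y\<bar> * \<bar>y\<bar>" by (intro mult_left_mono) auto
      then have "\<bar>y\<bar> \<le> 1 / d * y\<^sup>2" using d by (simp add: field_simps power2_eq_square)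
      then show ?thesis using d by simp
    next
      case True
      moreover have "0 \<le> 1 / d * y\<^sup>2" using d by simp
      ultimately show ?thesis by linarith
    qed
    then have "ennreal \<bar>f m x\<bar> \<le> ennreal d + ennreal (1 / d) * ennreal ((f m x)\<^sup>2)" for x
      using d by (simp flip: ennreal_mult ennreal_plus add: ennreal_leI)
    then have "(\<integral>\<^sup>+x. ennreal \<bar>f m x\<bar> \<partial>M)
        \<le> (\<integral>\<^sup>+x. ennreal d + ennreal (1 / d) * ennreal ((f m x)\<^sup>2) \<partial>M)"
      by (intro nn_integral_mono)
    also have "\<dots> = ennreal (d * c) + ennreal (1 / d) * (\<integral>\<^sup>+x. ennreal ((f m x)\<^sup>2) \<partial>M)"
      using d by (simp add: nn_integral_add nn_integral_cmult emeasure_eq_measure c_def ennreal_mult)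
    finally show ?case using elim by (rule le_less_trans)
  qed
qed simp

lemma integral_iexp_normal_density:
  assumes "\<sigma> > 0"
  shows "(CLINT x|density lborel (normal_density 0 \<sigma>). iexp (c * x)) =
    complex_of_real (exp (- (c\<^sup>2 * \<sigma>\<^sup>2 / 2)))"
proof -
  have p: "prob_space std_normal_distribution"
    by (rule prob_space_normal_density) simp
  have d: "distributed std_normal_distribution lborel (\<lambda>x. x) (normal_density 0 1)"
    unfolding distributed_def by (simp add: distr_id2)
  have "distributed std_normal_distribution lborel (\<lambda>x. 0 + \<sigma> * x) (normal_density (0 + \<sigma> * 0) (\<bar>\<sigma>\<bar> * 1))"
    by (rule prob_space.normal_density_affine[OF p d]) (use assms in auto)
  then have "distr std_normal_distribution lborel (\<lambda>x. \<sigma> * x) = density lborel (normal_density 0 \<sigma>)"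
    using assms by (simp add: distributed_def)
  then have "(CLINT x|density lborel (normal_density 0 \<sigma>). iexp (c * x)) =
      (CLINT x|distr std_normal_distribution lborel (\<lambda>x. \<sigma> * x). iexp (c * x))" by simp
  also have "\<dots> = (CLINT x|std_normal_distribution. iexp (c * (\<sigma> * x)))"
    by (subst integral_distr) auto
  also have "\<dots> = char std_normal_distribution (c * \<sigma>)"
    by (simp add: char_def mult.assoc)
  also have "\<dots> = complex_of_real (exp (- (c\<^sup>2 * \<sigma>\<^sup>2 / 2)))"
    by (simp add: char_std_normal_distribution power_mult_distrib)
  finally show ?thesis .
qed

text \<open>The integrand is the derivative of -exp(-k(r-p)), also for k = 0. This turns the decay
  of a Gaussian characteristic function into a time integral. The half-open interval is that of the
  pieces of a simple process.\<close>

lemma integral_exp_decay: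
  fixes k :: real
  assumes "0 \<le> p" "p \<le> h" "h \<le> T"
  shows "(LINT r|time_measure T. indicator {p<..h} r * (k * exp (- (k * (r - p))))) =
    1 - exp (- (k * (h - p)))"
proof -
  have "(LINT r|time_measure T. indicator {p<..h} r * (k * exp (- (k * (r - p))))) =
     (LINT r:{0..T}|lborel. indicator {p<..h} r * (k * exp (- (k * (r - p)))))"
    by (simp add: integral_restrict_space set_lebesgue_integral_def)
  also have "\<dots> = (LINT r|lborel. indicator {p..h} r *\<^sub>R (k * exp (- (k * (r - p)))))"
    unfolding set_lebesgue_integral_def
  proof (rule integral_cong_AE)
    show "AE r in lborel. indicator {0..T} r *\<^sub>R (indicator {p<..h} r * (k * exp (- (k * (r - p))))) =
        indicator {p..h} r *\<^sub>R (k * exp (- (k * (r - p))))"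
      using AE_lborel_singleton[of p] by eventually_elim (use assms in \<open>auto simp: indicator_def\<close>)
  qed measurable
  also have "\<dots> = - exp (- (k * (h - p))) - (- exp (- (k * (p - p))))"
    by (rule integral_FTC_Icc)
       (use assms in \<open>auto intro!: derivative_eq_intros continuous_intros
         simp flip: has_real_derivative_iff_has_vector_derivative\<close>)
  finally show ?thesis by simp
qed

section \<open>Gaussian increments\<close>

locale brownian = prob_space M for M :: "'a measure" +
  fixes F :: "real \<Rightarrow> 'a measure" and T :: real and W :: "real \<Rightarrow> 'a \<Rightarrow> real"
  assumes T_nonneg: "0 \<le> T" and brownian_motion: "brownian_motion M F T W"
begin

lemma subalgebra_F: "subalgebra M (F t)"
  using brownian_motion by (auto simp: brownian_motion_def filtered_prob_space_def)

lemma space_F: "space (F t) = space M"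
  using subalgebra_F by (simp add: subalgebra_def)

lemma sets_F_mono: "s \<le> t \<Longrightarrow> sets (F s) \<subseteq> sets (F t)"
  using brownian_motion
  by (auto simp: brownian_motion_def filtered_prob_space_def dest: filtration.sets_F_mono)

lemma measurable_F_mono: "g \<in> measurable (F s) N \<Longrightarrow> s \<le> t \<Longrightarrow> g \<in> measurable (F t) N"
  using sets_F_mono[of s t] space_F by (auto simp: measurable_def)

lemma measurable_F_M: "g \<in> measurable (F s) N \<Longrightarrow> g \<in> measurable M N"
  by (rule measurable_from_subalg[OF subalgebra_F])

lemma W_measurable_F: "t \<in> {0..T} \<Longrightarrow> W t \<in> borel_measurable (F t)"
  using brownian_motion by (auto simp: brownian_motion_def continuous_adapted_def)

lemma W_measurable: "t \<in> {0..T} \<Longrightarrow> W t \<in> borel_measurable M"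
  by (rule measurable_F_M[OF W_measurable_F])

lemma W_joint_measurable: "(\<lambda>(s, \<omega>). W s \<omega>) \<in> borel_measurable (time_measure T \<Otimes>\<^sub>M M)"
  by (rule borel_measurable_continuous_process)
     (use brownian_motion W_measurable in \<open>auto simp: brownian_motion_def continuous_adapted_def\<close>)

lemma increment_distributed:
  assumes "s \<in> {0..T}" "t \<in> {s<..T}"
  shows "distributed M lborel (\<lambda>\<omega>. W t \<omega> - W s \<omega>) (normal_density 0 (sqrt (t - s)))"
  using brownian_motion assms unfolding brownian_motion_def by blast

lemma prob_increment:
  assumes "s \<in> {0..T}" "t \<in> {s<..T}" "A \<in> sets (F s)" "B \<in> sets borel"
  shows "prob (A \<inter> ((\<lambda>\<omega>. W t \<omega> - W s \<omega>) -` B \<inter> space M)) =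
    prob A * prob ((\<lambda>\<omega>. W t \<omega> - W s \<omega>) -` B \<inter> space M)"
proof -
  have "indep_set (sets (F s))
      {(\<lambda>\<omega>. W t \<omega> - W s \<omega>) -` B \<inter> space M | B. B \<in> sets borel}"
    using brownian_motion assms(1,2) unfolding brownian_motion_def by blast
  then show ?thesis unfolding indep_sets2_eq using assms(3,4) by blast
qed

text \<open>Independence of the increment from \<open>F s\<close> makes the joint law of omega and
  the increment a product measure, and Fubini integrates out the increment with the past held fixed.
  The first component is the identity seen as a map from M to \<open>F s\<close>, so that the
  integrand may depend on anything known at time s.\<close>

lemma integral_freeze:
  fixes \<Psi> :: "'a \<times> real \<Rightarrow> 'b::{banach, second_countable_topology}"
  assumes st: "s \<in> {0..T}" "t \<in> {s<..T}"
    and [measurable]: "\<Psi> \<in> borel_measurable (F s \<Otimes>\<^sub>M borel)"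
    and int: "integrable M (\<lambda>\<omega>. \<Psi> (\<omega>, W t \<omega> - W s \<omega>))"
  shows "(LINT \<omega>|M. \<Psi> (\<omega>, W t \<omega> - W s \<omega>)) =
    (LINT \<omega>|M. LINT x|density lborel (normal_density 0 (sqrt (t - s))). \<Psi> (\<omega>, x))"
proof -
  have [measurable]: "W t \<in> borel_measurable M" "W s \<in> borel_measurable M"
    using st by (auto intro: W_measurable)
  have id [measurable]: "(\<lambda>\<omega>. \<omega>) \<in> measurable M (F s)"
    by (rule measurable_F_M[of _ s]) simp
  let ?\<Delta> = "\<lambda>\<omega>. W t \<omega> - W s \<omega>"
  let ?N = "density lborel (normal_density 0 (sqrt (t - s)))"
  have N: "distr M borel ?\<Delta> = ?N"
    using increment_distributed[OF st] unfolding distributed_def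
    by (metis distr_cong sets_lborel)
  interpret N: prob_space ?N
    by (rule prob_space_normal_density) (use st in auto)
  interpret R: prob_space "distr M (F s) (\<lambda>\<omega>. \<omega>)"
    by (rule prob_space_distr) simp
  interpret P: pair_prob_space "distr M (F s) (\<lambda>\<omega>. \<omega>)" ?N ..
  \<comment> \<open>By \<open>prob_increment\<close> the two measures agree on rectangles, which
    determines a sigma-finite product.\<close>
  have prod: "distr M (F s) (\<lambda>\<omega>. \<omega>) \<Otimes>\<^sub>M ?N = distr M (F s \<Otimes>\<^sub>M borel) (\<lambda>\<omega>. (\<omega>, ?\<Delta> \<omega>))"
  proof (rule pair_measure_eqI)
    fix A B assume A: "A \<in> sets (distr M (F s) (\<lambda>\<omega>. \<omega>))" and "B \<in> sets ?N"
    then have AB [measurable]: "A \<in> sets (F s)" "B \<in> sets borel" by auto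
    have sub: "A \<subseteq> space M" using sets.sets_into_space[OF AB(1)] by (simp add: space_F)
    then have eq: "(\<lambda>\<omega>. (\<omega>, ?\<Delta> \<omega>)) -` (A \<times> B) \<inter> space M = A \<inter> (?\<Delta> -` B \<inter> space M)" by auto
    have "emeasure ?N B = emeasure M (?\<Delta> -` B \<inter> space M)"
      unfolding N[symmetric] by (subst emeasure_distr) auto
    then show "emeasure (distr M (F s) (\<lambda>\<omega>. \<omega>)) A * emeasure ?N B =
        emeasure (distr M (F s \<Otimes>\<^sub>M borel) (\<lambda>\<omega>. (\<omega>, ?\<Delta> \<omega>))) (A \<times> B)"
      using prob_increment[OF st AB]
      by (simp add: emeasure_distr eq Int_absorb2[OF sub] emeasure_eq_measure ennreal_mult)
  qed (auto intro: R.sigma_finite_measure_axioms N.sigma_finite_measure_axioms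
      cong: sets_pair_measure_cong)
  have "(LINT \<omega>|M. \<Psi> (\<omega>, ?\<Delta> \<omega>)) = integral\<^sup>L (distr M (F s \<Otimes>\<^sub>M borel) (\<lambda>\<omega>. (\<omega>, ?\<Delta> \<omega>))) \<Psi>"
    by (subst integral_distr) auto
  also have "\<dots> = (LINT \<omega>|distr M (F s) (\<lambda>\<omega>. \<omega>). LINT x|?N. \<Psi> (\<omega>, x))"
    unfolding prod[symmetric]
  proof (rule P.integral_fst'[symmetric])
    show "integrable (distr M (F s) (\<lambda>\<omega>. \<omega>) \<Otimes>\<^sub>M ?N) \<Psi>"
      unfolding prod by (subst integrable_distr_eq) (use int in auto)
  qed
  also have "\<dots> = (LINT \<omega>|M. LINT x|?N. \<Psi> (\<omega>, x))"
    by (rule integral_distr) measurable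
  finally show ?thesis .
qed

lemma increment_integrable:
  assumes "s \<in> {0..T}" "t \<in> {s..T}"
  shows "integrable M (\<lambda>\<omega>. W t \<omega> - W s \<omega>)"
proof (cases "s = t")
  case False
  then show ?thesis using assms
    integrable_normal_moment_nz_1[of "sqrt (t - s)" 0]
    distributed_integrable[OF increment_distributed[of s t], of "\<lambda>x. x"] by auto
qed simp

text \<open>With G frozen only the mean of a centred Gaussian remains; the bound on G gives the
  integrability that freezing requires.\<close>

lemma integral_increment_0:
  fixes G :: "'a \<Rightarrow> real"
  assumes "s \<in> {0..T}" "t \<in> {s..T}"
    and [measurable]: "G \<in> borel_measurable (F s)" and bnd: "\<And>\<omega>. \<omega> \<in> space M \<Longrightarrow> \<bar>G \<omega>\<bar> \<le> B"
  shows "(LINT \<omega>|M. G \<omega> * (W t \<omega> - W s \<omega>)) = 0"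
proof (cases "s = t")
  case False
  then have t: "t \<in> {s<..T}" using assms by auto
  have [measurable]: "G \<in> borel_measurable M" by (rule measurable_F_M[of _ s]) simp
  have int: "integrable M (\<lambda>\<omega>. G \<omega> * (W t \<omega> - W s \<omega>))"
  proof (rule Bochner_Integration.integrable_bound)
    show "integrable M (\<lambda>\<omega>. B * (W t \<omega> - W s \<omega>))"
      using increment_integrable[OF assms(1,2)] by simp
    have [measurable]: "W t \<in> borel_measurable M" "W s \<in> borel_measurable M"
      using assms by (auto intro: W_measurable)
    show "(\<lambda>\<omega>. G \<omega> * (W t \<omega> - W s \<omega>)) \<in> borel_measurable M" by measurable
    show "AE \<omega> in M. norm (G \<omega> * (W t \<omega> - W s \<omega>)) \<le> norm (B * (W t \<omega> - W s \<omega>))"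
      using bnd by (intro AE_I2) (fastforce simp: abs_mult intro!: mult_right_mono)
  qed
  have "(LINT x|density lborel (normal_density 0 (sqrt (t - s))). x) = 0"
    using integral_normal_moment_nz_1[of "sqrt (t-s)" 0] t
    by (subst integral_real_density) auto
  then show ?thesis
    using integral_freeze[OF assms(1) t, of "\<lambda>(\<omega>, x). G \<omega> * x"] int by simp
qed simp

sublocale time: finite_measure "time_measure T"
  by (rule finite_measure_time_measure)

sublocale time_prod: pair_sigma_finite "time_measure T" M ..

lemma finite_measure_prod: "finite_measure (time_measure T \<Otimes>\<^sub>M M)"
  by (rule finite_measure_pair_measure) unfold_locales

lemma exp_increment:
  fixes G :: "'a \<Rightarrow> complex" and \<xi> :: "'a \<Rightarrow> real"
  assumes p: "p \<in> {0..T}" and h: "h \<in> {p..T}"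
    and G [measurable]: "G \<in> borel_measurable (F p)" "\<And>\<omega>. \<omega> \<in> space M \<Longrightarrow> norm (G \<omega>) \<le> B"
    and \<xi> [measurable]: "\<xi> \<in> borel_measurable (F p)" "\<And>\<omega>. \<omega> \<in> space M \<Longrightarrow> \<bar>\<xi> \<omega>\<bar> \<le> C"
  shows "(CLINT \<omega>|M. G \<omega> * (iexp (u * (\<xi> \<omega> * (W h \<omega> - W p \<omega>))) - 1)) =
    - of_real (u\<^sup>2 / 2) * (CLINT x|time_measure T \<Otimes>\<^sub>M M.
        indicator {p<..h} (fst x) * of_real ((\<xi> (snd x))\<^sup>2) * G (snd x) *
          iexp (u * (\<xi> (snd x) * (W (fst x) (snd x) - W p (snd x)))))"
proof (cases "p = h")
  case False
  then have ph: "h \<in> {p<..T}" using h by auto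
  have p0: "0 \<le> p" "p \<le> h" "h \<le> T" using p h by auto
  have GM [measurable]: "G \<in> borel_measurable M" "\<xi> \<in> borel_measurable M"
    by (rule measurable_F_M, measurable)+
  have W [measurable]: "W h \<in> borel_measurable M" "W p \<in> borel_measurable M"
    using p ph by (auto intro: W_measurable)
  note W_joint_measurable[unfolded case_prod_beta', measurable]
  interpret P: finite_measure "time_measure T \<Otimes>\<^sub>M M" by (rule finite_measure_prod)
  define k where "k \<omega> = u\<^sup>2 * (\<xi> \<omega>)\<^sup>2 / 2" for \<omega>
  have k0: "k \<omega> \<ge> 0" for \<omega> by (simp add: k_def)
  have [measurable]: "k \<in> borel_measurable M" unfolding k_def by measurable
  have B0: "0 \<le> B" using G(2) not_empty norm_ge_zero order_trans by (metis ex_in_conv)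
  \<comment> \<open>Kept general in K and r: it serves for \<open>Q\<close> at the times inside the
    piece and for \<open>G\<close> at the endpoint \<open>h\<close>.\<close>
  have freeze: "(CLINT \<omega>|M. K \<omega> * iexp (u * (\<xi> \<omega> * (W r \<omega> - W p \<omega>)))) =
      (CLINT \<omega>|M. K \<omega> * of_real (exp (- (k \<omega> * (r - p)))))"
    if r: "r \<in> {p<..T}" and [measurable]: "K \<in> borel_measurable (F p)"
      and K: "\<And>\<omega>. \<omega> \<in> space M \<Longrightarrow> norm (K \<omega>) \<le> B'" for r K B'
  proof -
    have [measurable]: "W r \<in> borel_measurable M" using r p by (auto intro: W_measurable)
    have [measurable]: "K \<in> borel_measurable M" by (rule measurable_F_M[of _ p]) simp
    have int: "integrable M (\<lambda>\<omega>. K \<omega> * iexp (u * (\<xi> \<omega> * (W r \<omega> - W p \<omega>))))"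
      by (rule integrable_const_bound[where B=B']) (use K in \<open>auto simp: norm_mult\<close>)
    have "(CLINT \<omega>|M. K \<omega> * iexp (u * (\<xi> \<omega> * (W r \<omega> - W p \<omega>)))) =
        (CLINT \<omega>|M. CLINT x|density lborel (normal_density 0 (sqrt (r - p))). K \<omega> * iexp (u * (\<xi> \<omega> * x)))"
      using integral_freeze[OF p r, of "\<lambda>(\<omega>, x). K \<omega> * iexp (u * (\<xi> \<omega> * x))"] int by simp
    also have "\<dots> = (CLINT \<omega>|M. K \<omega> * of_real (exp (- (k \<omega> * (r - p)))))"
      using integral_iexp_normal_density[of "sqrt (r - p)" "u * \<xi> _"] r
      by (simp add: mult.assoc k_def power_mult_distrib)
    finally show ?thesis .
  qed
  note inner = integral_exp_decay[OF p0]
  note borel_measurable_time_measure [measurable]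
  define Q where "Q \<omega> = of_real ((\<xi> \<omega>)\<^sup>2) * G \<omega>" for \<omega>
  have [measurable]: "Q \<in> borel_measurable (F p)" unfolding Q_def by measurable
  have [measurable]: "Q \<in> borel_measurable M" by (rule measurable_F_M[of _ p]) simp
  have Qb: "norm (Q \<omega>) \<le> C\<^sup>2 * B" if "\<omega> \<in> space M" for \<omega>
    using G(2)[OF that] power_mono[OF \<xi>(2)[OF that], of 2] B0
    by (auto simp: Q_def norm_mult norm_power intro!: mult_mono)
  have "(CLINT x|time_measure T \<Otimes>\<^sub>M M. indicator {p<..h} (fst x) * of_real ((\<xi> (snd x))\<^sup>2) * G (snd x) *
          iexp (u * (\<xi> (snd x) * (W (fst x) (snd x) - W p (snd x))))) =
     (CLINT x|time_measure T \<Otimes>\<^sub>M M. indicator {p<..h} (fst x) * (Q (snd x) *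
          iexp (u * (\<xi> (snd x) * (W (fst x) (snd x) - W p (snd x))))))"
    by (simp add: Q_def mult.assoc)
  also have "\<dots> = (CLINT r|time_measure T. CLINT \<omega>|M. indicator {p<..h} r * (Q \<omega> *
          iexp (u * (\<xi> \<omega> * (W r \<omega> - W p \<omega>)))))"
  proof (subst time_prod.integral_fst'[symmetric])
    show "integrable (time_measure T \<Otimes>\<^sub>M M) (\<lambda>x. indicator {p<..h} (fst x) * (Q (snd x) *
          iexp (u * (\<xi> (snd x) * (W (fst x) (snd x) - W p (snd x))))))"
      by (rule P.integrable_const_bound[where B="C\<^sup>2 * B"])
         (use Qb B0 in \<open>auto simp: norm_mult indicator_def space_pair_measure intro!: AE_I2\<close>)
  qed simp
  also have "\<dots> = (CLINT r|time_measure T. CLINT \<omega>|M. indicator {p<..h} r * (Q \<omega> *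
          of_real (exp (- (k \<omega> * (r - p))))))"
  proof (rule Bochner_Integration.integral_cong[OF refl])
    fix r assume "r \<in> space (time_measure T)"
    show "(CLINT \<omega>|M. indicator {p<..h} r * (Q \<omega> * iexp (u * (\<xi> \<omega> * (W r \<omega> - W p \<omega>))))) =
      (CLINT \<omega>|M. indicator {p<..h} r * (Q \<omega> * of_real (exp (- (k \<omega> * (r - p))))))"
    proof (cases "r \<in> {p<..h}")
      case True
      then show ?thesis using freeze[of r Q "C\<^sup>2 * B"] Qb h by simp
    qed simp
  qed
  \<comment> \<open>The order of integration is swapped back because for fixed omega the time
    integral is elementary, by \<open>inner\<close>.\<close>
  also have "\<dots> = (CLINT \<omega>|M. CLINT r|time_measure T. indicator {p<..h} r * (Q \<omega> *
          of_real (exp (- (k \<omega> * (r - p))))))"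
  proof (rule time_prod.Fubini_integral[symmetric])
    have "norm (indicator {p<..h} r * (Q \<omega> * of_real (exp (- (k \<omega> * (r - p)))))) \<le> C\<^sup>2 * B"
      if "\<omega> \<in> space M" for r \<omega>
    proof (cases "r \<in> {p<..h}")
      case True
      then have "exp (- (k \<omega> * (r - p))) \<le> 1" using k0[of \<omega>] by simp
      then have "norm (Q \<omega>) * exp (- (k \<omega> * (r - p))) \<le> C\<^sup>2 * B * 1"
        using Qb[OF that] B0 by (intro mult_mono) auto
      then show ?thesis using True by (simp add: norm_mult flip: of_real_exp)
    qed (use B0 in simp)
    then show "integrable (time_measure T \<Otimes>\<^sub>M M)
       (\<lambda>(r, \<omega>). indicator {p<..h} r * (Q \<omega> * of_real (exp (- (k \<omega> * (r - p))))))"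
      by (intro P.integrable_const_bound[where B="C\<^sup>2 * B"])
         (auto simp: space_pair_measure intro!: AE_I2)
  qed
  finally have R: "(CLINT x|time_measure T \<Otimes>\<^sub>M M. indicator {p<..h} (fst x) * of_real ((\<xi> (snd x))\<^sup>2) * G (snd x) *
          iexp (u * (\<xi> (snd x) * (W (fst x) (snd x) - W p (snd x))))) = \<dots>" .
  have "- of_real (u\<^sup>2 / 2) * (CLINT r|time_measure T. indicator {p<..h} r * (Q \<omega> *
          of_real (exp (- (k \<omega> * (r - p)))))) = G \<omega> * (of_real (exp (- (k \<omega> * (h - p)))) - 1)" for \<omega>
  proof -
    have "- of_real (u\<^sup>2 / 2) * (CLINT r|time_measure T. indicator {p<..h} r * (Q \<omega> *
          of_real (exp (- (k \<omega> * (r - p)))))) =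
      (CLINT r|time_measure T. - G \<omega> * of_real (indicator {p<..h} r * (k \<omega> * exp (- (k \<omega> * (r - p))))))"
      unfolding integral_mult_right_zero[symmetric]
      by (intro Bochner_Integration.integral_cong refl)
         (simp add: Q_def k_def indicator_def)
    also have "\<dots> = - G \<omega> * of_real (1 - exp (- (k \<omega> * (h - p))))"
      by (simp only: integral_mult_right_zero integral_complex_of_real inner)
    finally show ?thesis by (simp add: algebra_simps)
  qed
  then have "- of_real (u\<^sup>2 / 2) * (CLINT \<omega>|M. CLINT r|time_measure T. indicator {p<..h} r * (Q \<omega> *
          of_real (exp (- (k \<omega> * (r - p)))))) = (CLINT \<omega>|M. G \<omega> * (of_real (exp (- (k \<omega> * (h - p)))) - 1))"
    by (simp only: flip: integral_mult_right_zero)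
  also have "\<dots> = (CLINT \<omega>|M. G \<omega> * of_real (exp (- (k \<omega> * (h - p))))) - (CLINT \<omega>|M. G \<omega>)"
  proof (subst Bochner_Integration.integral_diff[symmetric])
    have "exp (- (k \<omega> * (h - p))) \<le> 1" for \<omega> using k0[of \<omega>] ph by simp
    then have "norm (G \<omega>) * exp (- (k \<omega> * (h - p))) \<le> B * 1" if "\<omega> \<in> space M" for \<omega>
      using G(2)[OF that] B0 by (intro mult_mono) auto
    then show "integrable M (\<lambda>\<omega>. G \<omega> * of_real (exp (- (k \<omega> * (h - p)))))"
      by (intro integrable_const_bound[where B=B]) (auto simp: norm_mult intro!: AE_I2 simp flip: of_real_exp)
    show "integrable M G" by (rule integrable_const_bound[where B=B]) (use G in auto)
  qed (simp add: algebra_simps)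
  also have "\<dots> = (CLINT \<omega>|M. G \<omega> * iexp (u * (\<xi> \<omega> * (W h \<omega> - W p \<omega>)))) - (CLINT \<omega>|M. G \<omega>)"
    using freeze[OF ph G] by simp
  also have "\<dots> = (CLINT \<omega>|M. G \<omega> * (iexp (u * (\<xi> \<omega> * (W h \<omega> - W p \<omega>))) - 1))"
  proof (subst Bochner_Integration.integral_diff[symmetric])
    show "integrable M G" by (rule integrable_const_bound[where B=B]) (use G in auto)
    show "integrable M (\<lambda>\<omega>. G \<omega> * iexp (u * (\<xi> \<omega> * (W h \<omega> - W p \<omega>))))"
      by (rule integrable_const_bound[where B=B]) (use G in \<open>auto simp: norm_mult\<close>)
  qed (simp add: algebra_simps)
  finally show ?thesis unfolding R by simp
qed simp

end

section \<open>Simple integrands\<close>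

lemma simple_data_Suc: "simple_data M F T (Suc n) p \<xi> \<Longrightarrow> simple_data M F T n p \<xi>"
  by (simp add: simple_data_def)

lemma simple_data_mono:
  assumes "simple_data M F T n p \<xi>" "i \<le> j" "j \<le> n"
  shows "p i \<le> p j"
  using assms(2,3)
proof (induction j rule: dec_induct)
  case (step j)
  moreover have "p j \<le> p (Suc j)" using assms(1) step by (auto simp: simple_data_def)
  ultimately show ?case by simp
qed simp

lemma simple_data_coefficient:
  assumes "simple_data M F T n p \<xi>" "i < n"
  obtains C where "\<xi> i \<in> borel_measurable (F (p i))" "\<And>\<omega>. \<omega> \<in> space M \<Longrightarrow> \<bar>\<xi> i \<omega>\<bar> \<le> C"
  using assms unfolding simple_data_def by blast

lemma simple_data_bounded:
  assumes "simple_data M F T n p \<xi>"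
  obtains C where "\<And>s \<omega>. \<omega> \<in> space M \<Longrightarrow> \<bar>simple_process n p \<xi> s \<omega>\<bar> \<le> C" "C \<ge> 0"
proof -
  have "\<exists>C\<ge>0. \<forall>\<omega>\<in>space M. \<forall>s. \<bar>simple_process n p \<xi> s \<omega>\<bar> \<le> C"
    using assms
  proof (induction n)
    case (Suc n)
    obtain C where C: "C \<ge> 0" "\<And>\<omega> s. \<omega> \<in> space M \<Longrightarrow> \<bar>simple_process n p \<xi> s \<omega>\<bar> \<le> C"
      using Suc simple_data_Suc by blast
    obtain D where D: "\<And>\<omega>. \<omega> \<in> space M \<Longrightarrow> \<bar>\<xi> n \<omega>\<bar> \<le> D"
      using simple_data_coefficient[OF Suc.prems] by blast
    have "\<bar>simple_process (Suc n) p \<xi> s \<omega>\<bar> \<le> C + \<bar>D\<bar>" if "\<omega> \<in> space M" for s \<omega>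
    proof -
      have "\<bar>\<xi> n \<omega> * indicator {p n<..p (Suc n)} s\<bar> \<le> \<bar>D\<bar>"
        using D[OF that] by (auto simp: indicator_def)
      then show ?thesis using C(2)[OF that, of s] by (simp add: simple_process_def)
    qed
    then show ?case using C(1) by (intro exI[of _ "C + \<bar>D\<bar>"]) auto
  qed (auto simp: simple_process_def intro!: exI[of _ 0])
  then show thesis using that by blast
qed

lemma simple_process_after:
  assumes "simple_data M F T n p \<xi>" "p n < r"
  shows "simple_process n p \<xi> r \<omega> = 0"
  unfolding simple_process_def
proof (rule sum.neutral, safe)
  fix i assume "i < n"
  then have "p (Suc i) \<le> p n" using simple_data_mono[OF assms(1), of "Suc i" n] by simp
  then show "\<xi> i \<omega> * indicator {p i<..p (Suc i)} r = 0" using assms(2) by simp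
qed

lemma simple_ito_integral_after:
  assumes "simple_data M F T n p \<xi>" "p n \<le> r"
  shows "simple_ito_integral W n p \<xi> r \<omega> = simple_ito_integral W n p \<xi> (p n) \<omega>"
  unfolding simple_ito_integral_def
proof (rule sum.cong[OF refl])
  fix i assume "i \<in> {..<n}"
  then have "p (Suc i) \<le> p n" "p i \<le> p n"
    using simple_data_mono[OF assms(1), of _ n] by simp_all
  then show "\<xi> i \<omega> * (W (min r (p (Suc i))) \<omega> - W (min r (p i)) \<omega>) =
      \<xi> i \<omega> * (W (min (p n) (p (Suc i))) \<omega> - W (min (p n) (p i)) \<omega>)"
    using assms(2) by (simp add: min_absorb2)
qed

context brownian
begin

lemma simple_ito_integral_measurable:
  assumes sd: "simple_data M F T n p \<xi>" and t: "t \<in> {0..T}"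
  shows "simple_ito_integral W n p \<xi> t \<in> borel_measurable (F t)"
proof -
  have "(\<lambda>\<omega>. \<xi> i \<omega> * (W (min t (p (Suc i))) \<omega> - W (min t (p i)) \<omega>)) \<in> borel_measurable (F t)"
    if i: "i < n" for i
  proof (cases "t \<le> p i")
    case True
    moreover have "p i \<le> p (Suc i)" using sd i by (auto simp: simple_data_def)
    ultimately show ?thesis by (simp add: min_absorb1)
  next
    case False
    have *: "p i \<in> {0..T}" "p (Suc i) \<in> {0..T}" using sd i by (auto simp: simple_data_def)
    have [measurable]: "\<xi> i \<in> borel_measurable (F t)"
      by (rule measurable_F_mono[of _ "p i"]) (use sd i False in \<open>auto simp: simple_data_def\<close>)
    have [measurable]: "W (min t q) \<in> borel_measurable (F t)" if "q \<in> {0..T}" for q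
      by (rule measurable_F_mono[OF W_measurable_F]) (use that t in auto)
    show ?thesis using * by measurable
  qed
  then have "(\<lambda>\<omega>. simple_ito_integral W n p \<xi> t \<omega>) \<in> borel_measurable (F t)"
    unfolding simple_ito_integral_def by (intro borel_measurable_sum) auto
  then show ?thesis by simp
qed

lemma simple_process_joint_measurable:
  assumes sd: "simple_data M F T n p \<xi>"
  shows "(\<lambda>x. simple_process n p \<xi> (fst x) (snd x)) \<in> borel_measurable (time_measure T \<Otimes>\<^sub>M M)"
  unfolding simple_process_def
proof (rule borel_measurable_sum)
  fix i assume "i \<in> {..<n}"
  then have "\<xi> i \<in> borel_measurable (F (p i))" using sd by (auto simp: simple_data_def)
  note [measurable] = measurable_F_M[OF this] borel_measurable_time_measure
  show "(\<lambda>x. \<xi> i (snd x) * indicator {p i<..p (Suc i)} (fst x))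
      \<in> borel_measurable (time_measure T \<Otimes>\<^sub>M M)" by measurable
qed

lemma W_min_joint_measurable:
  assumes c: "c \<in> {0..T}"
  shows "(\<lambda>x. W (min (fst x) c) (snd x)) \<in> borel_measurable (time_measure T \<Otimes>\<^sub>M M)"
proof -
  note [measurable] = borel_measurable_time_measure
  have "(\<lambda>x. min (fst x) c) \<in> measurable (time_measure T \<Otimes>\<^sub>M M) (restrict_space borel {0..T})"
    by (rule measurable_restrict_space2) (use c in \<open>auto simp: space_pair_measure\<close>)
  then have [measurable]: "(\<lambda>x. min (fst x) c) \<in> measurable (time_measure T \<Otimes>\<^sub>M M) (time_measure T)"
    by (simp cong: measurable_cong_sets add: sets_time_measure)
  show ?thesis
    using measurable_compose[OF _ W_joint_measurable, of "\<lambda>x. (min (fst x) c, snd x)"] by simp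
qed

lemma simple_ito_integral_joint_measurable:
  assumes sd: "simple_data M F T n p \<xi>"
  shows "(\<lambda>x. simple_ito_integral W n p \<xi> (fst x) (snd x)) \<in> borel_measurable (time_measure T \<Otimes>\<^sub>M M)"
  unfolding simple_ito_integral_def
proof (rule borel_measurable_sum)
  fix i assume "i \<in> {..<n}"
  then have *: "p i \<in> {0..T}" "p (Suc i) \<in> {0..T}" "\<xi> i \<in> borel_measurable (F (p i))"
    using sd by (auto simp: simple_data_def)
  note [measurable] = measurable_F_M[OF *(3)] W_min_joint_measurable[OF *(1)] W_min_joint_measurable[OF *(2)]
  show "(\<lambda>x. \<xi> i (snd x) * (W (min (fst x) (p (Suc i))) (snd x) - W (min (fst x) (p i)) (snd x)))
      \<in> borel_measurable (time_measure T \<Otimes>\<^sub>M M)" by measurable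
qed

lemma simple_exp_integrable:
  assumes sd: "simple_data M F T n p \<xi>"
    and g: "g \<in> borel_measurable M" "\<And>\<omega>. \<omega> \<in> space M \<Longrightarrow> \<bar>g \<omega>\<bar> \<le> B"
  shows "integrable (time_measure T \<Otimes>\<^sub>M M) (\<lambda>x. complex_of_real (indicator {..t} (fst x) * g (snd x) *
      (simple_process n p \<xi> (fst x) (snd x))\<^sup>2) * iexp (u * simple_ito_integral W n p \<xi> (fst x) (snd x)))"
proof -
  interpret P: finite_measure "time_measure T \<Otimes>\<^sub>M M" by (rule finite_measure_prod)
  obtain C where C: "\<And>s \<omega>. \<omega> \<in> space M \<Longrightarrow> \<bar>simple_process n p \<xi> s \<omega>\<bar> \<le> C" "C \<ge> 0"
    using simple_data_bounded[OF sd] by blast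
  note [measurable] = g(1) borel_measurable_time_measure simple_process_joint_measurable[OF sd]
    simple_ito_integral_joint_measurable[OF sd]
  have B0: "0 \<le> B" using g(2) not_empty abs_ge_zero order_trans by (metis ex_in_conv)
  have "norm (complex_of_real (indicator {..t} (fst x) * g (snd x) *
      (simple_process n p \<xi> (fst x) (snd x))\<^sup>2) * iexp (u * simple_ito_integral W n p \<xi> (fst x) (snd x))) \<le> B * C\<^sup>2"
    if "snd x \<in> space M" for x
  proof -
    have "\<bar>g (snd x)\<bar> * \<bar>simple_process n p \<xi> (fst x) (snd x)\<bar>\<^sup>2 \<le> B * C\<^sup>2"
      using g(2)[OF that] C(1)[OF that] B0 by (intro mult_mono power_mono) auto
    then show ?thesis using B0 by (auto simp: norm_mult norm_power abs_mult indicator_def)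
  qed
  then show ?thesis
    by (intro P.integrable_const_bound[where B="B * C\<^sup>2"]) (auto simp: space_pair_measure intro!: AE_I2)
qed

text \<open>By induction on the number of pieces: the integrand vanishes and the integral is frozen after
  the last partition point, so a further piece only adds the contribution of \<open>exp_increment\<close>.\<close>

lemma integral_exp_simple_ito_integral:
  assumes sd: "simple_data M F T n p \<xi>" and t: "t \<in> {0..T}"
    and g: "g \<in> borel_measurable (F 0)" "\<And>\<omega>. \<omega> \<in> space M \<Longrightarrow> \<bar>g \<omega>\<bar> \<le> B"
  shows "(CLINT \<omega>|M. of_real (g \<omega>) * iexp (u * simple_ito_integral W n p \<xi> t \<omega>)) =
    of_real (LINT \<omega>|M. g \<omega>) - of_real (u\<^sup>2 / 2) * (CLINT x|time_measure T \<Otimes>\<^sub>M M.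
      of_real (indicator {..t} (fst x) * g (snd x) * (simple_process n p \<xi> (fst x) (snd x))\<^sup>2) *
      iexp (u * simple_ito_integral W n p \<xi> (fst x) (snd x)))"
  using sd t
proof (induction n arbitrary: t)
  case 0
  then show ?case by (simp add: simple_process_def simple_ito_integral_def)
next
  case (Suc n)
  note sd = simple_data_Suc[OF Suc.prems(1)]
  have p: "p n \<in> {0..T}" "p n \<le> p (Suc n)" "p (Suc n) \<le> T"
    using Suc.prems(1) by (auto simp: simple_data_def)
  obtain C where \<xi>: "\<xi> n \<in> borel_measurable (F (p n))" "\<And>\<omega>. \<omega> \<in> space M \<Longrightarrow> \<bar>\<xi> n \<omega>\<bar> \<le> C"
    using simple_data_coefficient[OF Suc.prems(1)] by blast
  let ?S = "\<lambda>n. simple_process n p \<xi>" and ?N = "\<lambda>n. simple_ito_integral W n p \<xi>"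
  let ?P = "time_measure T \<Otimes>\<^sub>M M"
  have S_Suc: "?S (Suc n) r \<omega> = ?S n r \<omega> + \<xi> n \<omega> * indicator {p n<..p (Suc n)} r" for r \<omega>
    by (simp add: simple_process_def)
  have N_Suc: "?N (Suc n) r \<omega> = ?N n r \<omega> + \<xi> n \<omega> * (W (min r (p (Suc n))) \<omega> - W (min r (p n)) \<omega>)" for r \<omega>
    by (simp add: simple_ito_integral_def)
  have before: "?S (Suc n) r \<omega> = ?S n r \<omega>" "?N (Suc n) r \<omega> = ?N n r \<omega>" if "r \<le> p n" for r \<omega>
    using that p by (simp_all add: S_Suc N_Suc min_absorb1)
  show ?case
  proof (cases "t \<le> p n")
    case True
    have eq: "of_real (indicator {..t} (fst x) * g (snd x) * (?S (Suc n) (fst x) (snd x))\<^sup>2) *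
        iexp (u * ?N (Suc n) (fst x) (snd x)) =
      of_real (indicator {..t} (fst x) * g (snd x) * (?S n (fst x) (snd x))\<^sup>2) *
        iexp (u * ?N n (fst x) (snd x))" for x
      using before[of "fst x"] True by (cases "fst x \<le> t") simp_all
    show ?thesis unfolding before(2)[OF True] eq by (rule Suc.IH[OF sd Suc.prems(2)])
  next
    case False
    \<comment> \<open>Up to time t the last piece has been active exactly on
      \<open>{p n<..h}\<close>.\<close>
    define h where "h = min t (p (Suc n))"
    have h: "h \<in> {p n..T}" using False p Suc.prems(2) by (auto simp: h_def)
    \<comment> \<open>The factor already known at time \<open>p n\<close>: g times the exponential
      of the integral of the first n pieces, of modulus at most B.\<close>
    define G where "G \<omega> = of_real (g \<omega>) * iexp (u * ?N n (p n) \<omega>)" for \<omega>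
    note [measurable] = g(1) measurable_F_mono[OF g(1), of "p n"] simple_ito_integral_measurable[OF sd p(1)]
    have G: "G \<in> borel_measurable (F (p n))" "\<And>\<omega>. \<omega> \<in> space M \<Longrightarrow> norm (G \<omega>) \<le> B"
      using p(1) g(2) unfolding G_def by (auto simp: norm_mult)
    note GM [measurable] = measurable_F_M[OF G(1)] measurable_F_M[OF \<xi>(1)]
    note [measurable] = measurable_F_M[OF g(1)] W_measurable
    note [measurable] = borel_measurable_time_measure simple_process_joint_measurable[OF sd] simple_process_joint_measurable[OF Suc.prems(1)]
      simple_ito_integral_joint_measurable[OF sd] simple_ito_integral_joint_measurable[OF Suc.prems(1)]
    have Nt: "?N (Suc n) t \<omega> = ?N n (p n) \<omega> + \<xi> n \<omega> * (W h \<omega> - W (p n) \<omega>)" for \<omega>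
      using False simple_ito_integral_after[OF sd, of t W \<omega>]
      by (simp add: N_Suc h_def min_absorb2)
    have "(CLINT \<omega>|M. of_real (g \<omega>) * iexp (u * ?N (Suc n) t \<omega>)) =
      (CLINT \<omega>|M. of_real (g \<omega>) * iexp (u * ?N n t \<omega>) +
        G \<omega> * (iexp (u * (\<xi> n \<omega> * (W h \<omega> - W (p n) \<omega>))) - 1))"
      using False simple_ito_integral_after[OF sd, of t W]
      by (intro Bochner_Integration.integral_cong refl)
         (simp add: Nt G_def algebra_simps flip: exp_add)
    also have "\<dots> = (CLINT \<omega>|M. of_real (g \<omega>) * iexp (u * ?N n t \<omega>)) +
        (CLINT \<omega>|M. G \<omega> * (iexp (u * (\<xi> n \<omega> * (W h \<omega> - W (p n) \<omega>))) - 1))"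
    proof (rule Bochner_Integration.integral_add)
      note [measurable] = measurable_F_M[OF simple_ito_integral_measurable[OF sd Suc.prems(2)]]
      show "integrable M (\<lambda>\<omega>. of_real (g \<omega>) * iexp (u * ?N n t \<omega>))"
        by (rule integrable_const_bound[where B=B]) (use g(2) in \<open>auto simp: norm_mult\<close>)
      have e2: "norm (iexp r - 1) \<le> 2" for r :: real
        using norm_triangle_ineq4[of "iexp r" 1] by simp
      have "norm (G \<omega>) * norm (iexp (u * (\<xi> n \<omega> * (W h \<omega> - W (p n) \<omega>))) - 1) \<le> B * 2"
        if "\<omega> \<in> space M" for \<omega>
        by (rule mult_mono[OF G(2)[OF that] e2 order_trans[OF norm_ge_zero G(2)[OF that]] norm_ge_zero])
      moreover have [measurable]: "W h \<in> borel_measurable M" "W (p n) \<in> borel_measurable M"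
        using h p by (auto intro: W_measurable)
      ultimately show "integrable M (\<lambda>\<omega>. G \<omega> * (iexp (u * (\<xi> n \<omega> * (W h \<omega> - W (p n) \<omega>))) - 1))"
        by (intro integrable_const_bound[where B="B * 2"]) (auto simp: norm_mult)
    qed
    also have "\<dots> = of_real (LINT \<omega>|M. g \<omega>) - of_real (u\<^sup>2 / 2) * ((CLINT x|?P.
      of_real (indicator {..t} (fst x) * g (snd x) * (?S n (fst x) (snd x))\<^sup>2) *
      iexp (u * ?N n (fst x) (snd x))) +
       (CLINT x|?P. indicator {p n<..h} (fst x) * of_real ((\<xi> n (snd x))\<^sup>2) * G (snd x) *
          iexp (u * (\<xi> n (snd x) * (W (fst x) (snd x) - W (p n) (snd x))))))"
    proof -
      have "(CLINT \<omega>|M. G \<omega> * (iexp (u * (\<xi> n \<omega> * (W h \<omega> - W (p n) \<omega>))) - 1)) =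
        - of_real (u\<^sup>2 / 2) *
         (CLINT x|?P. indicator {p n<..h} (fst x) * of_real ((\<xi> n (snd x))\<^sup>2) * G (snd x) *
          iexp (u * (\<xi> n (snd x) * (W (fst x) (snd x) - W (p n) (snd x)))))"
        by (rule exp_increment[OF p(1) h G \<xi>])
      then show ?thesis
        unfolding Suc.IH[OF sd Suc.prems(2)] by (simp only: ring_distribs) simp
    qed
    \<comment> \<open>The contribution of the last piece is the difference of the integrands for n +
      1 and n pieces. They agree up to \<open>p n\<close>; on \<open>{p n<..h}\<close> the old one
      is 0 and the new exponential factors through \<open>G\<close>; beyond \<open>h\<close> the old
      one is 0, and either the time indicator or the new simple process vanishes.\<close>
    also have "(CLINT x|?P. indicator {p n<..h} (fst x) * of_real ((\<xi> n (snd x))\<^sup>2) * G (snd x) *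
          iexp (u * (\<xi> n (snd x) * (W (fst x) (snd x) - W (p n) (snd x))))) =
       (CLINT x|?P. of_real (indicator {..t} (fst x) * g (snd x) * (?S (Suc n) (fst x) (snd x))\<^sup>2) *
          iexp (u * ?N (Suc n) (fst x) (snd x)) -
        of_real (indicator {..t} (fst x) * g (snd x) * (?S n (fst x) (snd x))\<^sup>2) *
          iexp (u * ?N n (fst x) (snd x)))"
    proof (intro Bochner_Integration.integral_cong refl)
      fix x :: "real \<times> 'a"
      obtain r \<omega> where x: "x = (r, \<omega>)" by (cases x)
      consider "r \<le> p n" | "p n < r" "r \<le> h" | "p n < r" "h < r" by linarith
      then show "indicator {p n<..h} (fst x) * of_real ((\<xi> n (snd x))\<^sup>2) * G (snd x) *
          iexp (u * (\<xi> n (snd x) * (W (fst x) (snd x) - W (p n) (snd x)))) =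
          of_real (indicator {..t} (fst x) * g (snd x) * (?S (Suc n) (fst x) (snd x))\<^sup>2) *
          iexp (u * ?N (Suc n) (fst x) (snd x)) -
        of_real (indicator {..t} (fst x) * g (snd x) * (?S n (fst x) (snd x))\<^sup>2) *
          iexp (u * ?N n (fst x) (snd x))"
      proof cases
        case 1
        then show ?thesis by (simp add: x before)
      next
        case 2
        then have "?S n r \<omega> = 0" "?S (Suc n) r \<omega> = \<xi> n \<omega>" "r \<le> t" "r \<le> p (Suc n)"
          using simple_process_after[OF sd] by (auto simp: S_Suc h_def)
        moreover have "?N (Suc n) r \<omega> = ?N n (p n) \<omega> + \<xi> n \<omega> * (W r \<omega> - W (p n) \<omega>)"
          using 2 simple_ito_integral_after[OF sd, of r W \<omega>]
          by (simp add: N_Suc h_def min_absorb2)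
        ultimately show ?thesis using 2
          by (simp add: x G_def ring_distribs exp_add mult_ac)
      next
        case 3
        then have "?S n r \<omega> = 0" "t < r \<or> ?S (Suc n) r \<omega> = 0"
          using simple_process_after[OF sd] by (auto simp: S_Suc h_def)
        then show ?thesis using 3 by (auto simp: x)
      qed
    qed
    also have "\<dots> = (CLINT x|?P. of_real (indicator {..t} (fst x) * g (snd x) * (?S (Suc n) (fst x) (snd x))\<^sup>2) *
          iexp (u * ?N (Suc n) (fst x) (snd x))) -
        (CLINT x|?P. of_real (indicator {..t} (fst x) * g (snd x) * (?S n (fst x) (snd x))\<^sup>2) *
          iexp (u * ?N n (fst x) (snd x)))"
      by (rule Bochner_Integration.integral_diff[OF
            simple_exp_integrable[OF Suc.prems(1) measurable_F_M[OF g(1)] g(2)]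
            simple_exp_integrable[OF sd measurable_F_M[OF g(1)] g(2)]])
    finally show ?thesis by simp
  qed
qed

lemma simple_ito_integral_integrable:
  assumes sd: "simple_data M F T n p \<xi>" and t: "t \<in> {0..T}"
  shows "integrable M (simple_ito_integral W n p \<xi> t)"
proof -
  have "integrable M (\<lambda>\<omega>. simple_ito_integral W n p \<xi> t \<omega>)"
    unfolding simple_ito_integral_def
  proof (rule Bochner_Integration.integrable_sum)
    fix i assume "i \<in> {..<n}"
    then obtain C where *: "p i \<in> {0..T}" "p (Suc i) \<in> {0..T}" "p i \<le> p (Suc i)"
      "\<xi> i \<in> borel_measurable (F (p i))" "\<And>\<omega>. \<omega> \<in> space M \<Longrightarrow> \<bar>\<xi> i \<omega>\<bar> \<le> C"
      using sd simple_data_coefficient[OF sd, of i] by (auto simp: simple_data_def)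
    note [measurable] = measurable_F_M[OF *(4)]
    have m: "min t (p i) \<in> {0..T}" "min t (p (Suc i)) \<in> {0..T}" using * t by auto
    note [measurable] = m[THEN W_measurable]
    show "integrable M (\<lambda>\<omega>. \<xi> i \<omega> * (W (min t (p (Suc i))) \<omega> - W (min t (p i)) \<omega>))"
    proof (rule Bochner_Integration.integrable_bound)
      show "integrable M (\<lambda>\<omega>. C * (W (min t (p (Suc i))) \<omega> - W (min t (p i)) \<omega>))"
        using * t by (intro integrable_mult_right increment_integrable) auto
      show "AE \<omega> in M. norm (\<xi> i \<omega> * (W (min t (p (Suc i))) \<omega> - W (min t (p i)) \<omega>))
          \<le> norm (C * (W (min t (p (Suc i))) \<omega> - W (min t (p i)) \<omega>))"
        using *(5) by (intro AE_I2) (fastforce simp: abs_mult intro!: mult_right_mono)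
    qed measurable
  qed
  then show ?thesis by simp
qed

text \<open>The part of the i-th increment that falls between s and t is again an increment of W,
  starting at a time when both G and the i-th coefficient are known, so
  \<open>integral_increment_0\<close> removes each summand.\<close>

lemma simple_ito_integral_martingale:
  fixes G :: "'a \<Rightarrow> real"
  assumes sd: "simple_data M F T n p \<xi>" and st: "s \<in> {0..T}" "t \<in> {s..T}"
    and G: "G \<in> borel_measurable (F s)" "\<And>\<omega>. \<omega> \<in> space M \<Longrightarrow> \<bar>G \<omega>\<bar> \<le> B"
  shows "(LINT \<omega>|M. G \<omega> * (simple_ito_integral W n p \<xi> t \<omega> - simple_ito_integral W n p \<xi> s \<omega>)) = 0"
proof -
  have *: "integrable M (\<lambda>\<omega>. G \<omega> * (\<xi> i \<omega> * ((W (min t (p (Suc i))) \<omega> - W (min t (p i)) \<omega>)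
      - (W (min s (p (Suc i))) \<omega> - W (min s (p i)) \<omega>)))) \<and>
    (LINT \<omega>|M. G \<omega> * (\<xi> i \<omega> * ((W (min t (p (Suc i))) \<omega> - W (min t (p i)) \<omega>)
      - (W (min s (p (Suc i))) \<omega> - W (min s (p i)) \<omega>)))) = 0" if i: "i < n" for i
  proof -
    obtain C where *: "p i \<in> {0..T}" "p (Suc i) \<in> {0..T}" "p i \<le> p (Suc i)"
      "\<xi> i \<in> borel_measurable (F (p i))" "\<And>\<omega>. \<omega> \<in> space M \<Longrightarrow> \<bar>\<xi> i \<omega>\<bar> \<le> C"
      using sd i simple_data_coefficient[OF sd i] by (auto simp: simple_data_def)
    define a where "a = max s (p i)"
    \<comment> \<open>The outer \<open>max\<close> collapses the interval to \<open>b = a\<close>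
      when the piece ends before s or starts after t.\<close>
    define b where "b = max a (min t (p (Suc i)))"
    have ab: "a \<in> {0..T}" "b \<in> {a..T}" using * st by (auto simp: a_def b_def)
    then have b: "b \<in> {0..T}" by auto
    have eq: "(W (min t (p (Suc i))) \<omega> - W (min t (p i)) \<omega>)
      - (W (min s (p (Suc i))) \<omega> - W (min s (p i)) \<omega>) = W b \<omega> - W a \<omega>" for \<omega>
      using *(3) st by (auto simp: a_def b_def min_def max_def)
    have [measurable]: "G \<in> borel_measurable (F a)" "\<xi> i \<in> borel_measurable (F a)"
      using measurable_F_mono[OF G(1), of a] measurable_F_mono[OF *(4), of a] by (auto simp: a_def)
    have bd: "\<bar>G \<omega> * \<xi> i \<omega>\<bar> \<le> B * C" if "\<omega> \<in> space M" for \<omega>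
      using G(2)[OF that] *(5)[OF that] by (auto simp: abs_mult intro!: mult_mono order_trans[OF abs_ge_zero G(2)[OF that]])
    have GX [measurable]: "(\<lambda>\<omega>. G \<omega> * \<xi> i \<omega>) \<in> borel_measurable M"
      by (rule measurable_F_M[of _ a]) measurable
    note [measurable] = W_measurable[OF ab(1)] W_measurable[OF b]
    have "integrable M (\<lambda>\<omega>. (G \<omega> * \<xi> i \<omega>) * (W b \<omega> - W a \<omega>))"
    proof (rule Bochner_Integration.integrable_bound)
      show "integrable M (\<lambda>\<omega>. (B * C) * (W b \<omega> - W a \<omega>))"
        using ab by (intro integrable_mult_right increment_integrable) auto
      show "AE \<omega> in M. norm ((G \<omega> * \<xi> i \<omega>) * (W b \<omega> - W a \<omega>)) \<le> norm ((B * C) * (W b \<omega> - W a \<omega>))"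
      proof (rule AE_I2)
        fix \<omega> assume "\<omega> \<in> space M"
        then have "\<bar>G \<omega> * \<xi> i \<omega>\<bar> * \<bar>W b \<omega> - W a \<omega>\<bar> \<le> \<bar>B * C\<bar> * \<bar>W b \<omega> - W a \<omega>\<bar>"
          by (intro mult_right_mono order_trans[OF bd abs_ge_self]) auto
        then show "norm ((G \<omega> * \<xi> i \<omega>) * (W b \<omega> - W a \<omega>)) \<le> norm ((B * C) * (W b \<omega> - W a \<omega>))"
          by (simp only: real_norm_def abs_mult)
      qed
    qed measurable
    then show ?thesis
      using integral_increment_0[OF ab, of "\<lambda>\<omega>. G \<omega> * \<xi> i \<omega>" "B * C"] bd
      by (simp add: eq mult.assoc)
  qed
  have "G \<omega> * (simple_ito_integral W n p \<xi> t \<omega> - simple_ito_integral W n p \<xi> s \<omega>) =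
    (\<Sum>i<n. G \<omega> * (\<xi> i \<omega> * ((W (min t (p (Suc i))) \<omega> - W (min t (p i)) \<omega>)
      - (W (min s (p (Suc i))) \<omega> - W (min s (p i)) \<omega>))))" for \<omega>
    unfolding simple_ito_integral_def
    by (simp add: sum_distrib_left right_diff_distrib flip: sum_subtractf)
  then have "(LINT \<omega>|M. G \<omega> * (simple_ito_integral W n p \<xi> t \<omega> - simple_ito_integral W n p \<xi> s \<omega>)) =
    (\<Sum>i<n. LINT \<omega>|M. G \<omega> * (\<xi> i \<omega> * ((W (min t (p (Suc i))) \<omega> - W (min t (p i)) \<omega>)
      - (W (min s (p (Suc i))) \<omega> - W (min s (p i)) \<omega>))))"
    using * by (simp add: Bochner_Integration.integral_sum)
  also have "\<dots> = 0" using * by simp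
  finally show ?thesis .
qed

end

section \<open>Integrands bounded almost everywhere\<close>

text \<open>A unimodular factor is taken out. Thanks to this bound, L1 convergence of stochastic
  integrals suffices for convergence of their exponentials.\<close>

lemma norm_iexp_diff_le: "norm (iexp (u * a) - iexp (u * b)) \<le> \<bar>u\<bar> * \<bar>a - b\<bar>" for u a b :: real
proof -
  have "iexp (u * a) - iexp (u * b) = iexp (u * b) * (iexp (u * (a - b)) - 1)"
    by (simp add: algebra_simps flip: exp_add)
  then have "norm (iexp (u * a) - iexp (u * b)) = norm (iexp (u * (a - b)) - 1)"
    by (simp add: norm_mult)
  also have "\<dots> \<le> \<bar>u * (a - b)\<bar>"
    using iexp_approx1[of "u * (a - b)" 0] by simp
  finally show ?thesis by (simp add: abs_mult)
qed

text \<open>Continuity makes the integral differentiable in its upper limit, so \<phi>' = -k \<phi>,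
  and with the integrating factor exp(kt) the product \<phi>(t) exp(kt) has derivative 0. Its value
  at time 0 is c.\<close>

lemma integral_equation_exp:
  fixes \<phi> :: "real \<Rightarrow> complex" and k :: real
  assumes cont: "continuous_on {0..T} \<phi>"
    and eq: "\<And>t. t \<in> {0..T} \<Longrightarrow> \<phi> t = c - of_real k * (CLINT r|time_measure T. indicator {..t} r * \<phi> r)"
    and t: "t \<in> {0..T}"
  shows "\<phi> t = c * of_real (exp (- (k * t)))"
proof -
  have eq': "\<phi> t = c - of_real k * integral {0..t} \<phi>" if t: "t \<in> {0..T}" for t
  proof -
    have "(CLINT r|time_measure T. indicator {..t} r * \<phi> r) = (CLINT r:{0..t}|lborel. \<phi> r)"
      unfolding set_lebesgue_integral_def
      using t by (subst integral_restrict_space) (auto intro!: Bochner_Integration.integral_cong simp: indicator_def)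
    also have "\<dots> = integral {0..t} \<phi>"
      using continuous_on_subset[OF cont, of "{0..t}"] t
      by (intro set_borel_integral_eq_integral borel_integrable_atLeastAtMost') auto
    finally show ?thesis using eq[OF t] by simp
  qed
  have "((\<lambda>t. \<phi> t * of_real (exp (k * t))) has_vector_derivative 0) (at s within {0..T})"
    if s: "s \<in> {0..T}" for s
  proof -
    have "((\<lambda>t. integral {0..t} \<phi>) has_vector_derivative \<phi> s) (at s within {0..T})"
      by (rule integral_has_vector_derivative[OF cont s])
    then have "((\<lambda>t. c - of_real k * integral {0..t} \<phi>) has_vector_derivative (0 - of_real k * \<phi> s)) (at s within {0..T})"
      by (intro has_vector_derivative_diff has_vector_derivative_mult_right has_vector_derivative_const)
    from has_vector_derivative_transform[OF s eq' this]
    have 1: "(\<phi> has_vector_derivative (- of_real k * \<phi> s)) (at s within {0..T})"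
      by simp
    have "((\<lambda>t. exp (k * t)) has_field_derivative (k * exp (k * s))) (at s within {0..T})"
      by (auto intro!: derivative_eq_intros)
    then have 2: "((\<lambda>t. complex_of_real (exp (k * t))) has_vector_derivative of_real (k * exp (k * s))) (at s within {0..T})"
      by (rule has_vector_derivative_of_real)
    show ?thesis
      using has_vector_derivative_mult[OF 1 2] by (simp add: algebra_simps)
  qed
  then obtain d where "\<And>t. t \<in> {0..T} \<Longrightarrow> \<phi> t * of_real (exp (k * t)) = d"
    using has_vector_derivative_zero_constant[of "{0..T}" "\<lambda>t. \<phi> t * of_real (exp (k * t))"] by auto
  moreover have "\<phi> 0 = c" "0 \<in> {0..T}" using eq'[of 0] t by auto
  ultimately have "\<phi> t * of_real (exp (k * t)) = c" using t by force
  then have "\<phi> t * of_real (exp (k * t) * exp (- (k * t))) = c * of_real (exp (- (k * t)))"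
    by (simp add: mult.assoc[symmetric])
  then show ?thesis by (simp flip: exp_add)
qed

section \<open>Passage from simple integrands to bounded ones\<close>

context brownian
begin

lemma progressive_joint_measurable:
  assumes "progressive F T H"
  shows "(\<lambda>x. H (fst x) (snd x)) \<in> borel_measurable (time_measure T \<Otimes>\<^sub>M M)"
proof -
  have H: "(\<lambda>(s, \<omega>). H s \<omega>) \<in> borel_measurable (restrict_space borel {0..T} \<Otimes>\<^sub>M F T)"
    using assms T_nonneg by (auto simp: progressive_def)
  have [measurable]: "(\<lambda>\<omega>. \<omega>) \<in> measurable M (F T)" by (rule measurable_F_M[of _ T]) simp
  have fst: "fst \<in> measurable (time_measure T \<Otimes>\<^sub>M M) (restrict_space borel {0..T})"
    by (simp cong: measurable_cong_sets flip: sets_time_measure)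
  have snd: "snd \<in> measurable (time_measure T \<Otimes>\<^sub>M M) (F T)"
    using measurable_compose[OF measurable_snd, of "\<lambda>\<omega>. \<omega>"] by simp
  show ?thesis
    using measurable_compose[OF measurable_Pair[OF fst snd] H] by simp
qed

lemma nn_integral_time_prod:
  fixes f :: "real \<times> 'a \<Rightarrow> ennreal"
  assumes "f \<in> borel_measurable (time_measure T \<Otimes>\<^sub>M M)"
  shows "(\<integral>\<^sup>+\<omega>. (\<integral>\<^sup>+s\<in>{0..T}. f (s, \<omega>) \<partial>lborel) \<partial>M) = (\<integral>\<^sup>+x. f x \<partial>(time_measure T \<Otimes>\<^sub>M M))"
  using time_prod.nn_integral_snd[OF assms] by (simp add: nn_integral_restrict_space)

end

text \<open>The bound k on the integrand supplies the dominating constants in the limits below;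
  \<open>has_ito_integral\<close> itself provides only square integrability.\<close>

locale bounded_ito_integral = brownian +
  fixes H X :: "real \<Rightarrow> 'a \<Rightarrow> real" and k :: real
  assumes ito: "has_ito_integral M F T W H X"
    and H_bound: "AE x in time_measure T \<Otimes>\<^sub>M M. \<bar>H (fst x) (snd x)\<bar> \<le> k"
begin

lemma X_measurable_F: "t \<in> {0..T} \<Longrightarrow> X t \<in> borel_measurable (F t)"
  using ito by (auto simp: has_ito_integral_def continuous_adapted_def)

lemma X_measurable: "t \<in> {0..T} \<Longrightarrow> X t \<in> borel_measurable M"
  by (rule measurable_F_M[OF X_measurable_F])

lemma X_continuous: "\<omega> \<in> space M \<Longrightarrow> continuous_on {0..T} (\<lambda>t. X t \<omega>)"
  using ito by (auto simp: has_ito_integral_def continuous_adapted_def)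

lemma X_joint_measurable: "(\<lambda>x. X (fst x) (snd x)) \<in> borel_measurable (time_measure T \<Otimes>\<^sub>M M)"
  using borel_measurable_continuous_process[OF X_measurable X_continuous]
  by (simp add: case_prod_beta')

lemma H_joint_measurable: "(\<lambda>x. H (fst x) (snd x)) \<in> borel_measurable (time_measure T \<Otimes>\<^sub>M M)"
  using ito by (intro progressive_joint_measurable) (simp add: has_ito_integral_def)

text \<open>Mean-square convergence of the simple integrals is weakened to L1, which is all that the
  martingale property and the Lipschitz exponentials use; the iterated integral of the definition is
  moved to the product measure.\<close>

lemma approximation:
  obtains n p \<xi> where "\<And>m. simple_data M F T (n m) (p m) (\<xi> m)"
    "(\<lambda>m. \<integral>\<^sup>+x. ennreal ((simple_process (n m) (p m) (\<xi> m) (fst x) (snd x) - H (fst x) (snd x))\<^sup>2)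
        \<partial>(time_measure T \<Otimes>\<^sub>M M)) \<longlonglongrightarrow> 0"
    "\<And>t. t \<in> {0..T} \<Longrightarrow> (\<lambda>m. \<integral>\<^sup>+\<omega>. ennreal
        \<bar>simple_ito_integral W (n m) (p m) (\<xi> m) t \<omega> - X t \<omega>\<bar> \<partial>M) \<longlonglongrightarrow> 0"
proof -
  obtain n p \<xi> where sd: "\<And>m. simple_data M F T (n m) (p m) (\<xi> m)" and
    S: "(\<lambda>m. \<integral>\<^sup>+\<omega>. (\<integral>\<^sup>+s\<in>{0..T}.
            ennreal ((simple_process (n m) (p m) (\<xi> m) s \<omega> - H s \<omega>)\<^sup>2) \<partial>lborel) \<partial>M)
          \<longlonglongrightarrow> 0" and
    N: "\<And>t. t \<in> {0..T} \<Longrightarrow>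
          (\<lambda>m. \<integral>\<^sup>+\<omega>. ennreal ((simple_ito_integral W (n m) (p m) (\<xi> m) t \<omega> - X t \<omega>)\<^sup>2) \<partial>M)
            \<longlonglongrightarrow> 0"
    using ito unfolding has_ito_integral_def by blast
  note [measurable] = simple_process_joint_measurable[OF sd] H_joint_measurable
  have "(\<lambda>m. \<integral>\<^sup>+x. ennreal ((simple_process (n m) (p m) (\<xi> m) (fst x) (snd x) - H (fst x) (snd x))\<^sup>2)
        \<partial>(time_measure T \<Otimes>\<^sub>M M)) \<longlonglongrightarrow> 0"
    using S by (subst nn_integral_time_prod[symmetric]) auto
  moreover have "(\<lambda>m. \<integral>\<^sup>+\<omega>. ennreal
        \<bar>simple_ito_integral W (n m) (p m) (\<xi> m) t \<omega> - X t \<omega>\<bar> \<partial>M) \<longlonglongrightarrow> 0" if t: "t \<in> {0..T}" for t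
  proof (rule nn_integral_abs_tendsto_0[OF _ N[OF t]])
    note [measurable] = measurable_F_M[OF simple_ito_integral_measurable[OF sd t]] X_measurable[OF t]
    show "(\<lambda>\<omega>. simple_ito_integral W (n m) (p m) (\<xi> m) t \<omega> - X t \<omega>) \<in> borel_measurable M" for m
      by measurable
  qed
  ultimately show thesis using that sd by blast
qed

text \<open>Simple integrals are integrable, and some simple integral lies at finite L1 distance
  from \<open>X t\<close>.\<close>

lemma X_integrable:
  assumes t: "t \<in> {0..T}"
  shows "integrable M (X t)"
proof -
  obtain n p \<xi> where sd: "\<And>m. simple_data M F T (n m) (p m) (\<xi> m)" and
    N: "(\<lambda>m. \<integral>\<^sup>+\<omega>. ennreal
        \<bar>simple_ito_integral W (n m) (p m) (\<xi> m) t \<omega> - X t \<omega>\<bar> \<partial>M) \<longlonglongrightarrow> 0"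
    by (rule approximation) (use t in blast)
  note [measurable] = measurable_F_M[OF simple_ito_integral_measurable[OF sd t]] X_measurable[OF t]
  have "\<forall>\<^sub>F m in sequentially. (\<integral>\<^sup>+\<omega>. ennreal
        \<bar>simple_ito_integral W (n m) (p m) (\<xi> m) t \<omega> - X t \<omega>\<bar> \<partial>M) < 1"
    using order_tendstoD(2)[OF N] by simp
  then obtain m where "(\<integral>\<^sup>+\<omega>. ennreal
        \<bar>simple_ito_integral W (n m) (p m) (\<xi> m) t \<omega> - X t \<omega>\<bar> \<partial>M) < 1"
    by (auto simp: eventually_sequentially)
  then have "integrable M (\<lambda>\<omega>. simple_ito_integral W (n m) (p m) (\<xi> m) t \<omega> - X t \<omega>)"
    by (intro integrableI_bounded) (auto intro: less_trans)
  from Bochner_Integration.integrable_diff[OF simple_ito_integral_integrable[OF sd t, of m] this]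
  show ?thesis by simp
qed

text \<open>Integrals over a set of \<open>F s\<close> are continuous under L1 convergence, so they
  inherit equality at s and t from the simple integrals, and these integrals characterise the
  conditional expectation.\<close>

lemma martingale_X: "martingale_on M F T X"
  unfolding martingale_on_def
proof (intro conjI ballI)
  fix s t assume st: "s \<in> {0..T}" "t \<in> {s..T}"
  then have t: "t \<in> {0..T}" by auto
  interpret S: finite_measure_subalgebra M "F s"
    by unfold_locales (rule subalgebra_F)
  obtain n p \<xi> where sd: "\<And>m. simple_data M F T (n m) (p m) (\<xi> m)" and
    N: "\<And>t. t \<in> {0..T} \<Longrightarrow> (\<lambda>m. \<integral>\<^sup>+\<omega>. ennreal
        \<bar>simple_ito_integral W (n m) (p m) (\<xi> m) t \<omega> - X t \<omega>\<bar> \<partial>M) \<longlonglongrightarrow> 0"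
    by (rule approximation) blast
  note meas = measurable_F_M[OF simple_ito_integral_measurable[OF sd]] X_measurable
  have lim: "(\<lambda>m. LINT \<omega>|M. indicator A \<omega> * simple_ito_integral W (n m) (p m) (\<xi> m) r \<omega>)
      \<longlonglongrightarrow> (LINT \<omega>|M. indicator A \<omega> * X r \<omega>)" if r: "r \<in> {0..T}" and [measurable]: "A \<in> sets M" for r A
  proof (rule tendsto_L1_int)
    note [measurable] = meas[OF r]
    show "(\<lambda>m. \<integral>\<^sup>+\<omega>. ennreal (norm (indicator A \<omega> * simple_ito_integral W (n m) (p m) (\<xi> m) r \<omega> -
        indicator A \<omega> * X r \<omega>)) \<partial>M) \<longlonglongrightarrow> 0"
    proof (rule tendsto_sandwich[OF _ _ tendsto_const N[OF r]])
      show "\<forall>\<^sub>F m in sequentially. (\<integral>\<^sup>+\<omega>. ennreal (norm (indicator A \<omega> * simple_ito_integral W (n m) (p m) (\<xi> m) r \<omega> -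
        indicator A \<omega> * X r \<omega>)) \<partial>M) \<le> (\<integral>\<^sup>+\<omega>. ennreal
        \<bar>simple_ito_integral W (n m) (p m) (\<xi> m) r \<omega> - X r \<omega>\<bar> \<partial>M)"
        by (intro always_eventually allI nn_integral_mono) (auto simp: indicator_def)
    qed simp
  qed (use that X_integrable simple_ito_integral_integrable[OF sd] in \<open>auto intro: integrable_real_mult_indicator simp: mult.commute[of "indicator A _"]\<close>)
  have "(LINT \<omega>:A|M. X t \<omega>) = (LINT \<omega>:A|M. X s \<omega>)" if A: "A \<in> sets (F s)" for A
  proof -
    have AM [measurable]: "A \<in> sets M" using A subalgebra_F by (auto simp: subalgebra_def)
    have "(LINT \<omega>|M. indicator A \<omega> * simple_ito_integral W (n m) (p m) (\<xi> m) t \<omega>) =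
      (LINT \<omega>|M. indicator A \<omega> * simple_ito_integral W (n m) (p m) (\<xi> m) s \<omega>)" for m
    proof -
      have *: "integrable M (\<lambda>\<omega>. indicator A \<omega> * simple_ito_integral W (n m) (p m) (\<xi> m) r \<omega>)" if "r \<in> {0..T}" for r
        using integrable_real_mult_indicator[OF AM simple_ito_integral_integrable[OF sd that]]
        by (simp add: mult.commute)
      have "(LINT \<omega>|M. indicator A \<omega> * (simple_ito_integral W (n m) (p m) (\<xi> m) t \<omega> -
          simple_ito_integral W (n m) (p m) (\<xi> m) s \<omega>)) = 0"
        by (rule simple_ito_integral_martingale[OF sd st, where B=1]) (use A in \<open>auto simp: indicator_def\<close>)
      then show ?thesis
        using Bochner_Integration.integral_diff[OF *[OF t] *[OF st(1)]] by (simp add: right_diff_distrib)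
    qed
    then have "(LINT \<omega>|M. indicator A \<omega> * X t \<omega>) = (LINT \<omega>|M. indicator A \<omega> * X s \<omega>)"
      using lim[OF t AM] lim[OF st(1) AM] LIMSEQ_unique by simp
    then show ?thesis by (simp add: set_lebesgue_integral_def)
  qed
  then show "AE \<omega> in M. real_cond_exp M (F s) (X t) \<omega> = X s \<omega>"
    using st t by (intro S.real_cond_exp_charact X_integrable X_measurable_F)
qed (auto intro: X_measurable_F X_integrable)

lemma exp_X_integrable:
  assumes g [measurable]: "g \<in> borel_measurable M" "\<And>\<omega>. \<omega> \<in> space M \<Longrightarrow> \<bar>g \<omega>\<bar> \<le> B"
  shows "integrable (time_measure T \<Otimes>\<^sub>M M) (\<lambda>x. complex_of_real (indicator {..t} (fst x) * g (snd x) *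
      (H (fst x) (snd x))\<^sup>2) * iexp (u * X (fst x) (snd x)))"
proof -
  interpret P: finite_measure "time_measure T \<Otimes>\<^sub>M M" by (rule finite_measure_prod)
  note [measurable] = X_joint_measurable H_joint_measurable borel_measurable_time_measure
  have B0: "0 \<le> B" using g(2) not_empty abs_ge_zero order_trans by (metis ex_in_conv)
  show ?thesis
  proof (rule P.integrable_const_bound[where B="B * k\<^sup>2"])
    show "AE x in time_measure T \<Otimes>\<^sub>M M. norm (complex_of_real (indicator {..t} (fst x) * g (snd x) *
      (H (fst x) (snd x))\<^sup>2) * iexp (u * X (fst x) (snd x))) \<le> B * k\<^sup>2"
      using H_bound AE_space
    proof eventually_elim
      case (elim x)
      then have "\<bar>g (snd x)\<bar> \<le> B" using g(2)[of "snd x"] by (auto simp: space_pair_measure)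
      then have "\<bar>g (snd x)\<bar> * \<bar>H (fst x) (snd x)\<bar>\<^sup>2 \<le> B * k\<^sup>2"
        using elim B0 by (intro mult_mono power_mono) auto
      then show ?case using B0 by (auto simp: norm_mult norm_power abs_mult indicator_def)
    qed
  qed measurable
qed

text \<open>Both sides of the identity for simple integrands converge. On the left the exponential
  is Lipschitz. On the right the error splits into the one of the squared integrand, controlled by
  the L2 and L1 distances to H, and the one of the exponential, weighted by the bounded H^2.\<close>

lemma integral_exp_X:
  assumes t: "t \<in> {0..T}"
    and g: "g \<in> borel_measurable (F 0)" "\<And>\<omega>. \<omega> \<in> space M \<Longrightarrow> \<bar>g \<omega>\<bar> \<le> B"
  shows "(CLINT \<omega>|M. of_real (g \<omega>) * iexp (u * X t \<omega>)) =
    of_real (LINT \<omega>|M. g \<omega>) - of_real (u\<^sup>2 / 2) * (CLINT x|time_measure T \<Otimes>\<^sub>M M.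
      of_real (indicator {..t} (fst x) * g (snd x) * (H (fst x) (snd x))\<^sup>2) *
      iexp (u * X (fst x) (snd x)))"
proof -
  interpret P: finite_measure "time_measure T \<Otimes>\<^sub>M M" by (rule finite_measure_prod)
  let ?P = "time_measure T \<Otimes>\<^sub>M M"
  obtain n p \<xi> where sd: "\<And>m. simple_data M F T (n m) (p m) (\<xi> m)" and
    S: "(\<lambda>m. \<integral>\<^sup>+x. ennreal ((simple_process (n m) (p m) (\<xi> m) (fst x) (snd x) - H (fst x) (snd x))\<^sup>2)
        \<partial>?P) \<longlonglongrightarrow> 0" and
    N: "\<And>t. t \<in> {0..T} \<Longrightarrow> (\<lambda>m. \<integral>\<^sup>+\<omega>. ennreal
        \<bar>simple_ito_integral W (n m) (p m) (\<xi> m) t \<omega> - X t \<omega>\<bar> \<partial>M) \<longlonglongrightarrow> 0"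
    by (rule approximation) blast
  define S where "S m x = simple_process (n m) (p m) (\<xi> m) (fst x) (snd x)" for m x
  define N where "N m r \<omega> = simple_ito_integral W (n m) (p m) (\<xi> m) r \<omega>" for m r \<omega>
  define h where "h x = H (fst x) (snd x)" for x
  have N_meas: "N m r \<in> borel_measurable M" if "r \<in> {0..T}" for m r
    using measurable_F_M[OF simple_ito_integral_measurable[OF sd that]] by (simp add: N_def[abs_def])
  have N_lim: "(\<lambda>m. \<integral>\<^sup>+\<omega>. ennreal (\<bar>u\<bar> * \<bar>N m r \<omega> - X r \<omega>\<bar>) \<partial>M) \<longlonglongrightarrow> 0" if r: "r \<in> {0..T}" for r
  proof -
    note [measurable] = N_meas[OF r] X_measurable[OF r]
    have "(\<lambda>m. ennreal \<bar>u\<bar> * (\<integral>\<^sup>+\<omega>. ennreal \<bar>N m r \<omega> - X r \<omega>\<bar> \<partial>M)) \<longlonglongrightarrow> ennreal \<bar>u\<bar> * 0"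
      unfolding N_def by (intro ennreal_tendsto_cmult N[OF r]) simp
    then show ?thesis by (simp add: ennreal_mult nn_integral_cmult)
  qed
  note gM [measurable] = measurable_F_M[OF g(1)]
  have [measurable]: "S m \<in> borel_measurable ?P" "(\<lambda>x. N m (fst x) (snd x)) \<in> borel_measurable ?P"
    "h \<in> borel_measurable ?P" for m
    unfolding S_def[abs_def] N_def h_def[abs_def]
    using simple_process_joint_measurable[OF sd] simple_ito_integral_joint_measurable[OF sd]
      H_joint_measurable by auto
  note [measurable] = X_joint_measurable borel_measurable_time_measure
  have hb: "AE x in ?P. \<bar>h x\<bar> \<le> k" using H_bound by (simp add: h_def)
  have B0: "0 \<le> B" using g(2) not_empty abs_ge_zero order_trans by (metis ex_in_conv)
  have 1: "(\<lambda>m. CLINT \<omega>|M. of_real (g \<omega>) * iexp (u * N m t \<omega>)) \<longlonglongrightarrow>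
      (CLINT \<omega>|M. of_real (g \<omega>) * iexp (u * X t \<omega>))"
  proof (rule tendsto_L1_int)
    note [measurable] = N_meas[OF t] X_measurable[OF t]
    show "integrable M (\<lambda>\<omega>. of_real (g \<omega>) * iexp (u * N m t \<omega>))" for m
      by (rule integrable_const_bound[where B=B]) (use g in \<open>auto simp: norm_mult\<close>)
    show "integrable M (\<lambda>\<omega>. of_real (g \<omega>) * iexp (u * X t \<omega>))"
      by (rule integrable_const_bound[where B=B]) (use g in \<open>auto simp: norm_mult\<close>)
    have "(\<lambda>m. ennreal B * (\<integral>\<^sup>+\<omega>. ennreal (\<bar>u\<bar> * \<bar>N m t \<omega> - X t \<omega>\<bar>) \<partial>M)) \<longlonglongrightarrow> ennreal B * 0"
      by (intro ennreal_tendsto_cmult N_lim t) simp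
    then have lim: "(\<lambda>m. ennreal B * (\<integral>\<^sup>+\<omega>. ennreal (\<bar>u\<bar> * \<bar>N m t \<omega> - X t \<omega>\<bar>) \<partial>M)) \<longlonglongrightarrow> 0" by simp
    show "(\<lambda>m. \<integral>\<^sup>+\<omega>. ennreal (norm (of_real (g \<omega>) * iexp (u * N m t \<omega>) - of_real (g \<omega>) * iexp (u * X t \<omega>))) \<partial>M) \<longlonglongrightarrow> 0"
    proof (rule tendsto_sandwich[OF _ _ tendsto_const lim])
      have "norm (of_real (g \<omega>) * iexp (u * N m t \<omega>) - of_real (g \<omega>) * iexp (u * X t \<omega>)) \<le>
          B * (\<bar>u\<bar> * \<bar>N m t \<omega> - X t \<omega>\<bar>)" if "\<omega> \<in> space M" for m \<omega>
      proof -
        have "norm (of_real (g \<omega>) * iexp (u * N m t \<omega>) - of_real (g \<omega>) * iexp (u * X t \<omega>)) =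
          \<bar>g \<omega>\<bar> * norm (iexp (u * N m t \<omega>) - iexp (u * X t \<omega>))"
          by (simp only: norm_mult norm_of_real flip: right_diff_distrib)
        also have "\<dots> \<le> B * (\<bar>u\<bar> * \<bar>N m t \<omega> - X t \<omega>\<bar>)"
          by (rule mult_mono[OF g(2)[OF that] norm_iexp_diff_le B0 norm_ge_zero])
        finally show ?thesis .
      qed
      then have "(\<integral>\<^sup>+\<omega>. ennreal (norm (of_real (g \<omega>) * iexp (u * N m t \<omega>) - of_real (g \<omega>) * iexp (u * X t \<omega>))) \<partial>M)
        \<le> (\<integral>\<^sup>+\<omega>. ennreal B * ennreal (\<bar>u\<bar> * \<bar>N m t \<omega> - X t \<omega>\<bar>) \<partial>M)" for m
        using B0 by (intro nn_integral_mono) (simp add: ennreal_leI flip: ennreal_mult)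
      then show "\<forall>\<^sub>F m in sequentially.
         (\<integral>\<^sup>+\<omega>. ennreal (norm (of_real (g \<omega>) * iexp (u * N m t \<omega>) - of_real (g \<omega>) * iexp (u * X t \<omega>))) \<partial>M)
        \<le> ennreal B * (\<integral>\<^sup>+\<omega>. ennreal (\<bar>u\<bar> * \<bar>N m t \<omega> - X t \<omega>\<bar>) \<partial>M)"
        by (simp add: nn_integral_cmult)
    qed simp
  qed
  \<comment> \<open>For each fixed time the mean of this distance tends to 0 by the Lipschitz bound;
    being at most 2, it also does so after integration over time, by dominated convergence.\<close>
  define J where "J m x = ennreal (norm (iexp (u * N m (fst x) (snd x)) - iexp (u * X (fst x) (snd x))))" for m x
  have [measurable]: "J m \<in> borel_measurable ?P" for m unfolding J_def[abs_def] by measurable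
  have J: "(\<lambda>m. \<integral>\<^sup>+x. J m x \<partial>?P) \<longlonglongrightarrow> 0"
  proof -
    have "(\<lambda>m. \<integral>\<^sup>+r. (\<integral>\<^sup>+\<omega>. J m (r, \<omega>) \<partial>M) \<partial>time_measure T) \<longlonglongrightarrow> (\<integral>\<^sup>+r. 0 \<partial>time_measure T)"
    proof (rule nn_integral_dominated_convergence[where w="\<lambda>_. 2"])
      show "AE r in time_measure T. (\<integral>\<^sup>+\<omega>. J m (r, \<omega>) \<partial>M) \<le> 2" for m
      proof (rule AE_I2)
        fix r
        have "J m (r, \<omega>) \<le> ennreal 2" for \<omega>
          unfolding J_def using norm_triangle_ineq4[of "iexp (u * N m r \<omega>)" "iexp (u * X r \<omega>)"]
          by (intro ennreal_leI) simp
        then have "(\<integral>\<^sup>+\<omega>. J m (r, \<omega>) \<partial>M) \<le> (\<integral>\<^sup>+\<omega>. ennreal 2 \<partial>M)" by (intro nn_integral_mono)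
        then show "(\<integral>\<^sup>+\<omega>. J m (r, \<omega>) \<partial>M) \<le> 2" by (simp add: emeasure_space_1)
      qed
      show "AE r in time_measure T. (\<lambda>m. \<integral>\<^sup>+\<omega>. J m (r, \<omega>) \<partial>M) \<longlonglongrightarrow> 0"
      proof (rule AE_I2)
        fix r assume "r \<in> space (time_measure T)"
        then have r: "r \<in> {0..T}" by (simp add: space_time_measure)
        show "(\<lambda>m. \<integral>\<^sup>+\<omega>. J m (r, \<omega>) \<partial>M) \<longlonglongrightarrow> 0"
        proof (rule tendsto_sandwich[OF _ _ tendsto_const N_lim[OF r]])
          show "\<forall>\<^sub>F m in sequentially. (\<integral>\<^sup>+\<omega>. J m (r, \<omega>) \<partial>M) \<le>
              (\<integral>\<^sup>+\<omega>. ennreal (\<bar>u\<bar> * \<bar>N m r \<omega> - X r \<omega>\<bar>) \<partial>M)"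
            unfolding J_def fst_conv snd_conv
            by (intro always_eventually allI nn_integral_mono ennreal_leI norm_iexp_diff_le)
        qed simp
      qed
      show "(\<integral>\<^sup>+r. 2 \<partial>time_measure T) < \<infinity>"
        using time.emeasure_finite by (simp add: ennreal_mult_eq_top_iff less_top[symmetric])
    qed (auto intro!: borel_measurable_nn_integral)
    then show ?thesis by (simp add: nn_integral_fst)
  qed
  have L1: "(\<lambda>m. \<integral>\<^sup>+x. ennreal \<bar>S m x - h x\<bar> \<partial>?P) \<longlonglongrightarrow> 0"
    by (rule P.nn_integral_abs_tendsto_0[OF _ S[folded S_def h_def]]) measurable
  have Sm: "(\<lambda>m. CLINT x|?P. of_real (indicator {..t} (fst x) * g (snd x) * (S m x)\<^sup>2) * iexp (u * N m (fst x) (snd x)))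
     \<longlonglongrightarrow> (CLINT x|?P. of_real (indicator {..t} (fst x) * g (snd x) * (h x)\<^sup>2) * iexp (u * X (fst x) (snd x)))"
  proof (rule tendsto_L1_int)
    show "integrable ?P (\<lambda>x. of_real (indicator {..t} (fst x) * g (snd x) * (S m x)\<^sup>2) * iexp (u * N m (fst x) (snd x)))" for m
      using simple_exp_integrable[OF sd gM g(2)] by (simp add: S_def N_def)
    show "integrable ?P (\<lambda>x. of_real (indicator {..t} (fst x) * g (snd x) * (h x)\<^sup>2) * iexp (u * X (fst x) (snd x)))"
      using exp_X_integrable[OF gM g(2)] by (simp add: h_def)
    have "(\<lambda>m. ennreal B * (\<integral>\<^sup>+x. ennreal ((S m x - h x)\<^sup>2) \<partial>?P) + ennreal (B * (2 * k)) * (\<integral>\<^sup>+x. ennreal \<bar>S m x - h x\<bar> \<partial>?P)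
      + ennreal (B * k\<^sup>2) * (\<integral>\<^sup>+x. J m x \<partial>?P)) \<longlonglongrightarrow> ennreal B * 0 + ennreal (B * (2 * k)) * 0 + ennreal (B * k\<^sup>2) * 0"
      by (intro tendsto_add ennreal_tendsto_cmult L1 J S[folded S_def h_def]) auto
    then have lim: "(\<lambda>m. ennreal B * (\<integral>\<^sup>+x. ennreal ((S m x - h x)\<^sup>2) \<partial>?P) + ennreal (B * (2 * k)) * (\<integral>\<^sup>+x. ennreal \<bar>S m x - h x\<bar> \<partial>?P)
      + ennreal (B * k\<^sup>2) * (\<integral>\<^sup>+x. J m x \<partial>?P)) \<longlonglongrightarrow> 0" by simp
    show "(\<lambda>m. \<integral>\<^sup>+x. ennreal (norm (of_real (indicator {..t} (fst x) * g (snd x) * (S m x)\<^sup>2) * iexp (u * N m (fst x) (snd x)) -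
        of_real (indicator {..t} (fst x) * g (snd x) * (h x)\<^sup>2) * iexp (u * X (fst x) (snd x)))) \<partial>?P) \<longlonglongrightarrow> 0"
    proof (rule tendsto_sandwich[OF _ _ tendsto_const lim])
      have "(\<integral>\<^sup>+x. ennreal (norm (of_real (indicator {..t} (fst x) * g (snd x) * (S m x)\<^sup>2) * iexp (u * N m (fst x) (snd x)) -
        of_real (indicator {..t} (fst x) * g (snd x) * (h x)\<^sup>2) * iexp (u * X (fst x) (snd x)))) \<partial>?P) \<le>
        (\<integral>\<^sup>+x. ennreal B * ennreal ((S m x - h x)\<^sup>2) + ennreal (B * (2 * k)) * ennreal \<bar>S m x - h x\<bar>
          + ennreal (B * k\<^sup>2) * J m x \<partial>?P)" for m
      proof (rule nn_integral_mono_AE)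
        show "AE x in ?P. ennreal (norm (of_real (indicator {..t} (fst x) * g (snd x) * (S m x)\<^sup>2) * iexp (u * N m (fst x) (snd x)) -
        of_real (indicator {..t} (fst x) * g (snd x) * (h x)\<^sup>2) * iexp (u * X (fst x) (snd x)))) \<le>
          ennreal B * ennreal ((S m x - h x)\<^sup>2) + ennreal (B * (2 * k)) * ennreal \<bar>S m x - h x\<bar>
          + ennreal (B * k\<^sup>2) * J m x"
          using hb AE_space
        proof eventually_elim
          case (elim x)
          define e where "e = iexp (u * N m (fst x) (snd x))"
          define e' where "e' = iexp (u * X (fst x) (snd x))"
          define c where "c = indicator {..t} (fst x) * g (snd x)"
          have k0: "0 \<le> k" using elim by auto
          have c: "\<bar>c\<bar> \<le> B" using elim g(2)[of "snd x"] B0 by (auto simp: space_pair_measure c_def indicator_def)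
          \<comment> \<open>The bounds of the simple processes may grow with m, while
            \<open>h\<close> is bounded by k; hence the expansion around \<open>h\<close>, whose
            terms involve only \<open>S m x - h x\<close> and k.\<close>
          have "(S m x)\<^sup>2 - (h x)\<^sup>2 = (S m x - h x)\<^sup>2 + 2 * h x * (S m x - h x)"
            by (simp add: power2_eq_square algebra_simps)
          then have "\<bar>(S m x)\<^sup>2 - (h x)\<^sup>2\<bar> \<le> (S m x - h x)\<^sup>2 + \<bar>2 * h x * (S m x - h x)\<bar>"
            using abs_triangle_ineq[of "(S m x - h x)\<^sup>2" "2 * h x * (S m x - h x)"] by simp
          also have "\<bar>2 * h x * (S m x - h x)\<bar> \<le> 2 * k * \<bar>S m x - h x\<bar>"
            using elim by (auto simp: abs_mult intro!: mult_right_mono)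
          finally have SS: "\<bar>(S m x)\<^sup>2 - (h x)\<^sup>2\<bar> \<le> (S m x - h x)\<^sup>2 + 2 * k * \<bar>S m x - h x\<bar>" by simp
          have "norm (of_real (c * (S m x)\<^sup>2) * e - of_real (c * (h x)\<^sup>2) * e') =
             norm (of_real c * (of_real ((S m x)\<^sup>2 - (h x)\<^sup>2) * e + of_real ((h x)\<^sup>2) * (e - e')))"
            by (simp add: algebra_simps)
          also have "\<dots> \<le> \<bar>c\<bar> * (\<bar>(S m x)\<^sup>2 - (h x)\<^sup>2\<bar> * norm e + \<bar>h x\<bar>\<^sup>2 * norm (e - e'))"
            unfolding norm_mult norm_of_real
            by (intro mult_left_mono order_trans[OF norm_triangle_ineq])
               (simp_all only: norm_mult norm_of_real abs_ge_zero power_abs order_refl)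
          also have "\<dots> \<le> B * (((S m x - h x)\<^sup>2 + 2 * k * \<bar>S m x - h x\<bar>) + k\<^sup>2 * norm (e - e'))"
          proof (intro mult_mono add_mono c B0)
            show "\<bar>(S m x)\<^sup>2 - (h x)\<^sup>2\<bar> * cmod e \<le> (S m x - h x)\<^sup>2 + 2 * k * \<bar>S m x - h x\<bar>"
              using SS by (simp add: e_def)
            show "\<bar>h x\<bar>\<^sup>2 \<le> k\<^sup>2" using elim by (intro power_mono) auto
          qed auto
          finally have "norm (of_real (c * (S m x)\<^sup>2) * e - of_real (c * (h x)\<^sup>2) * e') \<le>
            B * (S m x - h x)\<^sup>2 + B * (2 * k) * \<bar>S m x - h x\<bar> + B * k\<^sup>2 * norm (e - e')"
            by (simp add: algebra_simps)
          then have "ennreal (norm (of_real (c * (S m x)\<^sup>2) * e - of_real (c * (h x)\<^sup>2) * e')) \<le>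
            ennreal (B * (S m x - h x)\<^sup>2 + B * (2 * k) * \<bar>S m x - h x\<bar> + B * k\<^sup>2 * norm (e - e'))"
            by (rule ennreal_leI)
          also have "\<dots> = ennreal B * ennreal ((S m x - h x)\<^sup>2) + ennreal (B * (2 * k)) * ennreal \<bar>S m x - h x\<bar>
          + ennreal (B * k\<^sup>2) * J m x"
            using B0 k0 by (simp add: J_def e_def e'_def ennreal_plus ennreal_mult)
          finally show ?case by (simp only: c_def e_def e'_def)
        qed
      qed
      then show "\<forall>\<^sub>F m in sequentially. (\<integral>\<^sup>+x. ennreal (norm (of_real (indicator {..t} (fst x) * g (snd x) * (S m x)\<^sup>2) * iexp (u * N m (fst x) (snd x)) -
        of_real (indicator {..t} (fst x) * g (snd x) * (h x)\<^sup>2) * iexp (u * X (fst x) (snd x)))) \<partial>?P) \<le>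
        ennreal B * (\<integral>\<^sup>+x. ennreal ((S m x - h x)\<^sup>2) \<partial>?P) + ennreal (B * (2 * k)) * (\<integral>\<^sup>+x. ennreal \<bar>S m x - h x\<bar> \<partial>?P)
      + ennreal (B * k\<^sup>2) * (\<integral>\<^sup>+x. J m x \<partial>?P)"
        by (simp add: nn_integral_add nn_integral_cmult)
    qed simp
  qed
  have "(\<lambda>m. CLINT \<omega>|M. of_real (g \<omega>) * iexp (u * N m t \<omega>)) \<longlonglongrightarrow> of_real (LINT \<omega>|M. g \<omega>) - of_real (u\<^sup>2 / 2) *
     (CLINT x|?P. of_real (indicator {..t} (fst x) * g (snd x) * (h x)\<^sup>2) * iexp (u * X (fst x) (snd x)))"
  proof -
    have "(CLINT \<omega>|M. of_real (g \<omega>) * iexp (u * N m t \<omega>)) = of_real (LINT \<omega>|M. g \<omega>) - of_real (u\<^sup>2 / 2) *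
     (CLINT x|?P. of_real (indicator {..t} (fst x) * g (snd x) * (S m x)\<^sup>2) * iexp (u * N m (fst x) (snd x)))" for m
      unfolding S_def N_def by (rule integral_exp_simple_ito_integral[OF sd t g])
    then show ?thesis by (simp only:) (intro tendsto_intros Sm)
  qed
  with 1 show ?thesis unfolding h_def by (rule LIMSEQ_unique)
qed

end

section \<open>Laws and second moments recovered from characteristic functions\<close>

lemma (in prob_space) distributed_normal_of_char:
  assumes [measurable]: "Z \<in> borel_measurable M" and t: "0 < t"
    and char: "\<And>u. (CLINT \<omega>|M. iexp (u * Z \<omega>)) = complex_of_real (exp (- (u\<^sup>2 / 2 * t)))"
  shows "distributed M lborel Z (normal_density 0 (sqrt t))"
proof -
  have N: "prob_space (density lborel (normal_density 0 (sqrt t)))"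
    by (rule prob_space_normal_density) (use t in simp)
  have "distr M borel Z = density lborel (normal_density 0 (sqrt t))"
  proof (rule Levy_uniqueness)
    show "real_distribution (distr M borel Z)" by (rule real_distribution_distr) simp
    show "real_distribution (density lborel (normal_density 0 (sqrt t)))"
      using N by (simp add: real_distribution_def real_distribution_axioms_def)
    show "char (distr M borel Z) = char (density lborel (normal_density 0 (sqrt t)))"
    proof
      fix u
      have "char (distr M borel Z) u = (CLINT \<omega>|M. iexp (u * Z \<omega>))"
        unfolding char_def by (rule integral_distr) measurable
      also have "\<dots> = char (density lborel (normal_density 0 (sqrt t))) u"
        unfolding char char_def using integral_iexp_normal_density[of "sqrt t" u] t by simp
      finally show "char (distr M borel Z) u = char (density lborel (normal_density 0 (sqrt t))) u" .
    qed
  qed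
  then show ?thesis unfolding distributed_def
    by (auto cong: distr_cong)
qed

text \<open>With u = 1/(n+1) and v = ux/2, the half-angle formula turns the quotient into x^2 (sin v
  / v)^2, and sin v / v tends to 1 as the difference quotient of sin at 0.\<close>

lemma tendsto_one_minus_cos_scaled:
  fixes x :: real
  shows "(\<lambda>n. 2 * (1 - cos (inverse (real (Suc n)) * x)) / (inverse (real (Suc n)))\<^sup>2) \<longlonglongrightarrow> x\<^sup>2"
proof (cases "x = 0")
  case False
  have "((\<lambda>h. sin h / h) \<longlongrightarrow> (1::real)) (at 0)"
    using DERIV_sin[of "0::real"] by (simp add: DERIV_def)
  moreover have "filterlim (\<lambda>n. inverse (real (Suc n)) * x / 2) (at 0) sequentially"
    unfolding filterlim_at
    using tendsto_mult_right[OF LIMSEQ_inverse_real_of_nat, of "x / 2"] False by (simp add: mult_ac)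
  ultimately have "(\<lambda>n. sin (inverse (real (Suc n)) * x / 2) / (inverse (real (Suc n)) * x / 2)) \<longlonglongrightarrow> 1"
    by (rule filterlim_compose)
  then have "(\<lambda>n. x\<^sup>2 * (sin (inverse (real (Suc n)) * x / 2) / (inverse (real (Suc n)) * x / 2))\<^sup>2) \<longlonglongrightarrow> x\<^sup>2 * 1\<^sup>2"
    by (intro tendsto_intros)
  moreover have "2 * (1 - cos (u * x)) / u\<^sup>2 = x\<^sup>2 * (sin (u * x / 2) / (u * x / 2))\<^sup>2" if "u \<noteq> 0" for u
    using cos_double_sin[of "u * x / 2"] False that by (simp add: power2_eq_square field_simps)
  ultimately show ?thesis by simp
qed simp

context bounded_ito_integral
begin

lemma continuous_on_integral_exp_X:
  assumes [measurable]: "g \<in> borel_measurable M" and g: "\<And>\<omega>. \<omega> \<in> space M \<Longrightarrow> \<bar>g \<omega>\<bar> \<le> B"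
  shows "continuous_on {0..T} (\<lambda>t. CLINT \<omega>|M. of_real (g \<omega>) * iexp (u * X t \<omega>))"
proof (rule continuous_on_sequentiallyI)
  fix s :: "nat \<Rightarrow> real" and t assume s: "\<forall>n. s n \<in> {0..T}" "t \<in> {0..T}" "s \<longlonglongrightarrow> t"
  note [measurable] = X_measurable[OF s(2)] X_measurable[OF s(1)[rule_format]]
  show "(\<lambda>n. CLINT \<omega>|M. of_real (g \<omega>) * iexp (u * X (s n) \<omega>)) \<longlonglongrightarrow>
      (CLINT \<omega>|M. of_real (g \<omega>) * iexp (u * X t \<omega>))"
  proof (rule integral_dominated_convergence[where w="\<lambda>_. B"])
    show "AE \<omega> in M. (\<lambda>n. of_real (g \<omega>) * iexp (u * X (s n) \<omega>)) \<longlonglongrightarrow> of_real (g \<omega>) * iexp (u * X t \<omega>)"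
    proof (rule AE_I2)
      fix \<omega> assume "\<omega> \<in> space M"
      then have "(\<lambda>n. X (s n) \<omega>) \<longlonglongrightarrow> X t \<omega>"
        using X_continuous s unfolding continuous_on_sequentially comp_def by blast
      then show "(\<lambda>n. of_real (g \<omega>) * iexp (u * X (s n) \<omega>)) \<longlonglongrightarrow> of_real (g \<omega>) * iexp (u * X t \<omega>)"
        by (intro tendsto_intros)
    qed
    show "AE \<omega> in M. norm (of_real (g \<omega>) * iexp (u * X (s n) \<omega>)) \<le> B" for n
      using g by (auto simp: norm_mult)
  qed auto
qed

text \<open>Assumption \<open>H\<close> closes the identity \<open>integral_exp_X\<close>: with g
  H^2 replaced by g it reads \<phi>(t) = E[g] - u^2/2 times the integral of \<phi> up to t. Almost
  every time is enough, and for g = f^2(Y) only an almost-everywhere statement will be at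
  hand.\<close>

lemma integral_exp_X_eq:
  assumes t: "t \<in> {0..T}"
    and g: "g \<in> borel_measurable (F 0)" "\<And>\<omega>. \<omega> \<in> space M \<Longrightarrow> \<bar>g \<omega>\<bar> \<le> B"
    and H: "AE r in time_measure T. (CLINT \<omega>|M. of_real (g \<omega> * (H r \<omega>)\<^sup>2) * iexp (u * X r \<omega>)) =
      (CLINT \<omega>|M. of_real (g \<omega>) * iexp (u * X r \<omega>))"
  shows "(CLINT \<omega>|M. of_real (g \<omega>) * iexp (u * X t \<omega>)) =
    of_real (LINT \<omega>|M. g \<omega>) * of_real (exp (- (u\<^sup>2 / 2 * t)))"
proof (rule integral_equation_exp[OF _ _ t])
  note gM [measurable] = measurable_F_M[OF g(1)]
  note [measurable] = X_joint_measurable H_joint_measurable borel_measurable_time_measure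
  show "continuous_on {0..T} (\<lambda>t. CLINT \<omega>|M. of_real (g \<omega>) * iexp (u * X t \<omega>))"
    by (rule continuous_on_integral_exp_X[OF gM g(2)])
  fix t assume t: "t \<in> {0..T}"
  have "(CLINT x|time_measure T \<Otimes>\<^sub>M M.
      of_real (indicator {..t} (fst x) * g (snd x) * (H (fst x) (snd x))\<^sup>2) *
      iexp (u * X (fst x) (snd x))) = (CLINT r|time_measure T. CLINT \<omega>|M.
      of_real (indicator {..t} r * g \<omega> * (H r \<omega>)\<^sup>2) * iexp (u * X r \<omega>))"
    using time_prod.integral_fst'[OF exp_X_integrable[OF gM g(2), of t u]] by simp
  also have "\<dots> = (CLINT r|time_measure T. indicator {..t} r * (CLINT \<omega>|M. of_real (g \<omega>) * iexp (u * X r \<omega>)))"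
  proof (rule integral_cong_AE)
    show "AE r in time_measure T. (CLINT \<omega>|M. of_real (indicator {..t} r * g \<omega> * (H r \<omega>)\<^sup>2) * iexp (u * X r \<omega>)) =
        indicator {..t} r * (CLINT \<omega>|M. of_real (g \<omega>) * iexp (u * X r \<omega>))"
      using H
    proof eventually_elim
      case (elim r)
      then show ?case by (cases "r \<le> t") simp_all
    qed
  qed measurable
  finally show "(CLINT \<omega>|M. of_real (g \<omega>) * iexp (u * X t \<omega>)) = of_real (LINT \<omega>|M. g \<omega>) -
      of_real (u\<^sup>2 / 2) * (CLINT r|time_measure T. indicator {..t} r * (CLINT \<omega>|M. of_real (g \<omega>) * iexp (u * X r \<omega>)))"
    using integral_exp_X[OF t g, of u] by simp
qed

text \<open>Multiply the real part of \<open>integral_exp_X\<close> by \<open>2/u\<^sup>2\<close> and let \<open>u\<close> tend to 0.\<close>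

lemma ito_isometry:
  assumes g: "g \<in> borel_measurable (F 0)" "\<And>\<omega>. \<omega> \<in> space M \<Longrightarrow> \<bar>g \<omega>\<bar> \<le> B"
    and X2: "integrable M (\<lambda>\<omega>. (X T \<omega>)\<^sup>2)"
  shows "(LINT \<omega>|M. g \<omega> * (X T \<omega>)\<^sup>2) =
    (LINT x|(time_measure T \<Otimes>\<^sub>M M). g (snd x) * (H (fst x) (snd x))\<^sup>2)"
proof (rule LIMSEQ_unique)
  interpret P: finite_measure "time_measure T \<Otimes>\<^sub>M M" by (rule finite_measure_prod)
  define u where "u n = inverse (real (Suc n))" for n
  have u: "u n \<noteq> 0" for n by (simp add: u_def)
  have T: "T \<in> {0..T}" using T_nonneg by simp
  note gM [measurable] = measurable_F_M[OF g(1)]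
  note [measurable] = X_joint_measurable H_joint_measurable borel_measurable_time_measure X_measurable[OF T]
  have B0: "0 \<le> B" using g(2) not_empty abs_ge_zero order_trans by (metis ex_in_conv)
  \<comment> \<open>The real part of \<open>integral_exp_X\<close> at time T, rearranged; the time
    indicator is 1 on the whole of \<open>time_measure T\<close>.\<close>
  have eq: "(LINT \<omega>|M. g \<omega> * (2 * (1 - cos (u n * X T \<omega>)) / (u n)\<^sup>2)) =
    (LINT x|(time_measure T \<Otimes>\<^sub>M M). g (snd x) * (H (fst x) (snd x))\<^sup>2 * cos (u n * X (fst x) (snd x)))" for n
  proof -
    have int: "integrable M (\<lambda>\<omega>. of_real (g \<omega>) * iexp (u n * X T \<omega>))"
      by (rule integrable_const_bound[where B=B]) (use g(2) in \<open>auto simp: norm_mult\<close>)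
    have intc: "integrable M (\<lambda>\<omega>. g \<omega> * cos (u n * X T \<omega>))"
      using integrable_Re[OF int] by (simp add: Re_exp)
    have intg: "integrable M g" by (rule integrable_const_bound[where B=B]) (use g(2) in auto)
    have "(LINT \<omega>|M. g \<omega> * cos (u n * X T \<omega>)) = Re (CLINT \<omega>|M. of_real (g \<omega>) * iexp (u n * X T \<omega>))"
      unfolding integral_Re[OF int, symmetric] by (simp add: Re_exp)
    also have "\<dots> = (LINT \<omega>|M. g \<omega>) - (u n)\<^sup>2 / 2 * Re (CLINT x|time_measure T \<Otimes>\<^sub>M M.
      of_real (indicator {..T} (fst x) * g (snd x) * (H (fst x) (snd x))\<^sup>2) *
      iexp (u n * X (fst x) (snd x)))"
      by (subst integral_exp_X[OF T g]) simp_all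
    also have "Re (CLINT x|time_measure T \<Otimes>\<^sub>M M.
      of_real (indicator {..T} (fst x) * g (snd x) * (H (fst x) (snd x))\<^sup>2) *
      iexp (u n * X (fst x) (snd x))) =
      (LINT x|(time_measure T \<Otimes>\<^sub>M M). g (snd x) * (H (fst x) (snd x))\<^sup>2 * cos (u n * X (fst x) (snd x)))"
    proof (subst integral_Re[symmetric])
      show "integrable (time_measure T \<Otimes>\<^sub>M M) (\<lambda>x. complex_of_real (indicator {..T} (fst x) * g (snd x) *
          (H (fst x) (snd x))\<^sup>2) * iexp (u n * X (fst x) (snd x)))"
        by (rule exp_X_integrable[OF gM g(2)])
    qed (auto simp: Re_exp space_pair_measure intro!: Bochner_Integration.integral_cong)
    finally have diff: "(LINT \<omega>|M. g \<omega>) - (LINT \<omega>|M. g \<omega> * cos (u n * X T \<omega>)) =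
      (u n)\<^sup>2 / 2 * (LINT x|(time_measure T \<Otimes>\<^sub>M M). g (snd x) * (H (fst x) (snd x))\<^sup>2 * cos (u n * X (fst x) (snd x)))"
      by simp
    have "(LINT \<omega>|M. g \<omega> * (2 * (1 - cos (u n * X T \<omega>)) / (u n)\<^sup>2)) =
      (LINT \<omega>|M. 2 / (u n)\<^sup>2 * (g \<omega> - g \<omega> * cos (u n * X T \<omega>)))"
      by (intro Bochner_Integration.integral_cong refl) (simp add: field_simps u)
    also have "\<dots> = 2 / (u n)\<^sup>2 * ((LINT \<omega>|M. g \<omega>) - (LINT \<omega>|M. g \<omega> * cos (u n * X T \<omega>)))"
      using intc intg by simp
    finally show ?thesis
      unfolding diff using u[of n] by simp
  qed
  show "(\<lambda>n. LINT \<omega>|M. g \<omega> * (2 * (1 - cos (u n * X T \<omega>)) / (u n)\<^sup>2)) \<longlonglongrightarrow>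
      (LINT \<omega>|M. g \<omega> * (X T \<omega>)\<^sup>2)"
  \<comment> \<open>The dominating function comes from 1 - cos y <= y^2/2, and its integrability is
    assumption \<open>X2\<close>.\<close>
  proof (rule integral_dominated_convergence[where w="\<lambda>\<omega>. B * (X T \<omega>)\<^sup>2"])
    show "AE \<omega> in M. (\<lambda>n. g \<omega> * (2 * (1 - cos (u n * X T \<omega>)) / (u n)\<^sup>2)) \<longlonglongrightarrow> g \<omega> * (X T \<omega>)\<^sup>2"
      unfolding u_def by (intro AE_I2 tendsto_intros tendsto_one_minus_cos_scaled)
    show "AE \<omega> in M. norm (g \<omega> * (2 * (1 - cos (u n * X T \<omega>)) / (u n)\<^sup>2)) \<le> B * (X T \<omega>)\<^sup>2" for n
    proof (rule AE_I2)
      fix \<omega> assume \<omega>: "\<omega> \<in> space M"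
      have "1 - cos y \<le> y\<^sup>2 / 2" for y :: real
      proof -
        have "(sin (y / 2))\<^sup>2 \<le> (y / 2)\<^sup>2"
          using abs_sin_x_le_abs_x[of "y / 2"] abs_le_square_iff by blast
        then show ?thesis using cos_double_sin[of "y / 2"] by (simp add: power_divide)
      qed
      from this[of "u n * X T \<omega>"]
      have "2 * (1 - cos (u n * X T \<omega>)) / (u n)\<^sup>2 \<le> (X T \<omega>)\<^sup>2"
        using u[of n] by (simp add: field_simps power_mult_distrib)
      moreover have "0 \<le> 2 * (1 - cos (u n * X T \<omega>)) / (u n)\<^sup>2" by simp
      ultimately show "norm (g \<omega> * (2 * (1 - cos (u n * X T \<omega>)) / (u n)\<^sup>2)) \<le> B * (X T \<omega>)\<^sup>2"
        unfolding real_norm_def abs_mult[of "g \<omega>"]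
        by (intro mult_mono g(2)[OF \<omega>] B0) auto
    qed
  qed (use X2 in auto)
  show "(\<lambda>n. LINT \<omega>|M. g \<omega> * (2 * (1 - cos (u n * X T \<omega>)) / (u n)\<^sup>2)) \<longlonglongrightarrow>
    (LINT x|(time_measure T \<Otimes>\<^sub>M M). g (snd x) * (H (fst x) (snd x))\<^sup>2)"
    unfolding eq
  proof (rule integral_dominated_convergence[where w="\<lambda>_. B * k\<^sup>2"])
    show "AE x in time_measure T \<Otimes>\<^sub>M M. (\<lambda>n. g (snd x) * (H (fst x) (snd x))\<^sup>2 * cos (u n * X (fst x) (snd x)))
        \<longlonglongrightarrow> g (snd x) * (H (fst x) (snd x))\<^sup>2"
    proof (rule AE_I2)
      fix x
      have "(\<lambda>n. g (snd x) * (H (fst x) (snd x))\<^sup>2 * cos (u n * X (fst x) (snd x)))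
        \<longlonglongrightarrow> g (snd x) * (H (fst x) (snd x))\<^sup>2 * cos (0 * X (fst x) (snd x))"
        unfolding u_def by (intro tendsto_intros LIMSEQ_inverse_real_of_nat)
      then show "(\<lambda>n. g (snd x) * (H (fst x) (snd x))\<^sup>2 * cos (u n * X (fst x) (snd x)))
        \<longlonglongrightarrow> g (snd x) * (H (fst x) (snd x))\<^sup>2" by simp
    qed
    show "AE x in time_measure T \<Otimes>\<^sub>M M. norm (g (snd x) * (H (fst x) (snd x))\<^sup>2 * cos (u n * X (fst x) (snd x))) \<le> B * k\<^sup>2" for n
      using H_bound AE_space
    proof eventually_elim
      case (elim x)
      then have "\<bar>g (snd x)\<bar> \<le> B" using g(2)[of "snd x"] by (auto simp: space_pair_measure)
      then have "\<bar>g (snd x)\<bar> * \<bar>H (fst x) (snd x)\<bar>\<^sup>2 * \<bar>cos (u n * X (fst x) (snd x))\<bar> \<le> B * k\<^sup>2 * 1"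
        using elim B0 by (intro mult_mono power_mono) auto
      then show ?case by (simp add: abs_mult)
    qed
  qed (auto simp: P.emeasure_finite)
qed

end

section \<open>Quadratic variation\<close>

lemma integrable_mult_of_squares:
  fixes f g :: "'a \<Rightarrow> real"
  assumes [measurable]: "f \<in> borel_measurable M" "g \<in> borel_measurable M"
    and "integrable M (\<lambda>x. (f x)\<^sup>2)" "integrable M (\<lambda>x. (g x)\<^sup>2)"
  shows "integrable M (\<lambda>x. f x * g x)"
proof (rule Bochner_Integration.integrable_bound)
  show "integrable M (\<lambda>x. (f x)\<^sup>2 + (g x)\<^sup>2)" using assms by simp
  show "AE x in M. norm (f x * g x) \<le> norm ((f x)\<^sup>2 + (g x)\<^sup>2)"
  proof (rule AE_I2)
    fix x
    have "0 \<le> (\<bar>f x\<bar> - \<bar>g x\<bar>)\<^sup>2" by simp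
    then have "2 * (\<bar>f x\<bar> * \<bar>g x\<bar>) \<le> (f x)\<^sup>2 + (g x)\<^sup>2" by (simp add: power2_diff)
    moreover have "0 \<le> \<bar>f x\<bar> * \<bar>g x\<bar>" by simp
    ultimately show "norm (f x * g x) \<le> norm ((f x)\<^sup>2 + (g x)\<^sup>2)"
      unfolding real_norm_def abs_mult by linarith
  qed
qed measurable

text \<open>Quadratic variation along the uniform grid of n steps, centred term by term with the
  Brownian mean T/n, so that for Brownian motion the summands are orthogonal. As a function of the
  path alone, its moments are determined by \<open>process_law\<close>.\<close>

definition quadratic_variation_error :: "real \<Rightarrow> nat \<Rightarrow> (real \<Rightarrow> real) \<Rightarrow> real" where
  "quadratic_variation_error T n x =
     (\<Sum>i<n. (x (real (Suc i) * T / real n) - x (real i * T / real n))\<^sup>2 - T / real n)"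

lemma grid_in_interval: "0 \<le> T \<Longrightarrow> i \<le> n \<Longrightarrow> real i * T / real n \<in> {0..T}"
  using mult_right_mono[of "real i" "real n" T] by (cases "n = 0") (auto simp: field_simps)

text \<open>The grid times lie in \<open>{0..T}\<close>, where the restriction used in
  \<open>process_law\<close> changes nothing.\<close>

lemma quadratic_variation_error_restrict:
  assumes "0 \<le> T"
  shows "quadratic_variation_error T n (\<lambda>t\<in>{0..T}. x t) = quadratic_variation_error T n x"
  unfolding quadratic_variation_error_def
proof (rule sum.cong[OF refl])
  fix i assume "i \<in> {..<n}"
  then have "real i * T / real n \<in> {0..T}" "real (Suc i) * T / real n \<in> {0..T}"
    using assms grid_in_interval[of T i n] grid_in_interval[of T "Suc i" n] by simp_all
  then show "((\<lambda>t\<in>{0..T}. x t) (real (Suc i) * T / real n) - (\<lambda>t\<in>{0..T}. x t) (real i * T / real n))\<^sup>2 - T / real n =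
      (x (real (Suc i) * T / real n) - x (real i * T / real n))\<^sup>2 - T / real n" by simp
qed

lemma quadratic_variation_error_measurable:
  assumes "0 \<le> T"
  shows "quadratic_variation_error T n \<in> borel_measurable (\<Pi>\<^sub>M t\<in>{0..T}. borel)"
proof -
  have "(\<lambda>x. (x (real (Suc i) * T / real n) - x (real i * T / real n))\<^sup>2 - T / real n)
      \<in> borel_measurable (\<Pi>\<^sub>M t\<in>{0..T}. borel)" if "i < n" for i
  proof -
    have "real i * T / real n \<in> {0..T}" "real (Suc i) * T / real n \<in> {0..T}"
      using that assms grid_in_interval[of T i n] grid_in_interval[of T "Suc i" n] by simp_all
    note [measurable] = this[THEN measurable_component_singleton[where M="\<lambda>_. borel :: real measure"]]
    show ?thesis by measurable
  qed
  then have "(\<lambda>x. quadratic_variation_error T n x) \<in> borel_measurable (\<Pi>\<^sub>M t\<in>{0..T}. borel)"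
    unfolding quadratic_variation_error_def by (intro borel_measurable_sum) auto
  then show ?thesis by simp
qed

section \<open>Quadratic variation of Brownian motion and its transfer through the law\<close>

context brownian
begin

text \<open>With \<sigma>^2 = t - s, the Gaussian moments \<sigma>^2 and 3 \<sigma>^4 give 3
  \<sigma>^4 - 2 \<sigma>^4 + \<sigma>^4 = 2 \<sigma>^4. The third fact is stated under the density
  because that is the inner integral left by \<open>integral_freeze\<close>.\<close>

lemma increment_moment:
  assumes st: "s \<in> {0..T}" "t \<in> {s<..T}"
  shows "integrable M (\<lambda>\<omega>. ((W t \<omega> - W s \<omega>)\<^sup>2 - (t - s))\<^sup>2)" (is ?int)
    and "(LINT \<omega>|M. ((W t \<omega> - W s \<omega>)\<^sup>2 - (t - s))\<^sup>2) = 2 * (t - s)\<^sup>2" (is ?eq)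
    and "(LINT x|density lborel (normal_density 0 (sqrt (t - s))). x\<^sup>2 - (t - s)) = 0" (is ?zero)
proof -
  define \<sigma> where "\<sigma> = sqrt (t - s)"
  have \<sigma>: "\<sigma> > 0" "\<sigma>\<^sup>2 = t - s" using st by (simp_all add: \<sigma>_def)
  note D = increment_distributed[OF st, folded \<sigma>_def]
  have 0: "has_bochner_integral lborel (\<lambda>x. normal_density 0 \<sigma> x) 1"
    using normal_moment_even[OF \<sigma>(1), of 0 0] by simp
  have 2: "has_bochner_integral lborel (\<lambda>x. normal_density 0 \<sigma> x * x\<^sup>2) (\<sigma>\<^sup>2)"
    using normal_moment_even[OF \<sigma>(1), of 0 1] by (simp add: fact_numeral power2_eq_square)
  have 4: "has_bochner_integral lborel (\<lambda>x. normal_density 0 \<sigma> x * x ^ 4) (3 * \<sigma> ^ 4)"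
    using normal_moment_even[OF \<sigma>(1), of 0 2] by (simp add: fact_numeral field_simps)
  have "has_bochner_integral lborel (\<lambda>x. normal_density 0 \<sigma> x * x ^ 4 - 2 * \<sigma>\<^sup>2 * (normal_density 0 \<sigma> x * x\<^sup>2) + \<sigma>^4 * normal_density 0 \<sigma> x)
     (3 * \<sigma> ^ 4 - 2 * \<sigma>\<^sup>2 * \<sigma>\<^sup>2 + \<sigma>^4 * 1)"
    by (intro has_bochner_integral_add has_bochner_integral_diff has_bochner_integral_mult_right 0 2 4)
  moreover have "(\<lambda>x. normal_density 0 \<sigma> x * x ^ 4 - 2 * \<sigma>\<^sup>2 * (normal_density 0 \<sigma> x * x\<^sup>2) + \<sigma>^4 * normal_density 0 \<sigma> x) =
     (\<lambda>x. normal_density 0 \<sigma> x * (x\<^sup>2 - (t - s))\<^sup>2)"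
    unfolding \<sigma>(2)[symmetric] by (simp add: fun_eq_iff power2_diff algebra_simps flip: power_mult)
  moreover have "3 * \<sigma> ^ 4 - 2 * \<sigma>\<^sup>2 * \<sigma>\<^sup>2 + \<sigma>^4 * 1 = 2 * (t - s)\<^sup>2"
    unfolding \<sigma>(2)[symmetric] by (simp add: power2_eq_square power4_eq_xxxx)
  ultimately have *: "has_bochner_integral lborel (\<lambda>x. normal_density 0 \<sigma> x * (x\<^sup>2 - (t - s))\<^sup>2) (2 * (t - s)\<^sup>2)"
    by simp
  show ?int
    using distributed_integrable[OF D, of "\<lambda>x. (x\<^sup>2 - (t - s))\<^sup>2"] has_bochner_integral_integrable *
    by (auto simp: has_bochner_integral_iff)
  show ?eq
    using distributed_integral[OF D, of "\<lambda>x. (x\<^sup>2 - (t - s))\<^sup>2"] * by (auto simp: has_bochner_integral_iff)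
  have "has_bochner_integral lborel (\<lambda>x. normal_density 0 \<sigma> x * x\<^sup>2 - \<sigma>\<^sup>2 * normal_density 0 \<sigma> x) (\<sigma>\<^sup>2 - \<sigma>\<^sup>2 * 1)"
    by (intro has_bochner_integral_diff has_bochner_integral_mult_right 0 2)
  moreover have "(\<lambda>x. normal_density 0 \<sigma> x * x\<^sup>2 - \<sigma>\<^sup>2 * normal_density 0 \<sigma> x) = (\<lambda>x. normal_density 0 \<sigma> x * (x\<^sup>2 - (t - s)))"
    by (simp add: \<sigma>(2) fun_eq_iff algebra_simps)
  ultimately have "(LINT x|lborel. normal_density 0 \<sigma> x * (x\<^sup>2 - (t - s))) = 0"
    by (simp add: has_bochner_integral_iff)
  then show ?zero
    unfolding \<sigma>_def[symmetric] by (subst integral_real_density) auto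
qed

text \<open>The centred squared increments are orthogonal: the sum of the earlier ones is known when
  the next increment starts, and freezing leaves a mean of 0. So n second moments of size 2(T/n)^2
  add up.\<close>

lemma quadratic_variation_error_moment:
  assumes T: "0 < T" and n: "0 < n"
  shows "integrable M (\<lambda>\<omega>. (quadratic_variation_error T n (\<lambda>t. W t \<omega>))\<^sup>2)"
    and "(LINT \<omega>|M. (quadratic_variation_error T n (\<lambda>t. W t \<omega>))\<^sup>2) = 2 * T\<^sup>2 / n"
proof -
  let ?t = "\<lambda>i. real i * T / real n"
  define D where "D i \<omega> = (W (?t (Suc i)) \<omega> - W (?t i) \<omega>)\<^sup>2 - T / real n" for i \<omega>
  have step: "?t (Suc i) - ?t i = T / real n" for i by (simp add: ring_distribs add_divide_distrib)
  have t: "?t i \<in> {0..T}" if "i \<le> n" for i using T that by (intro grid_in_interval) auto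
  have t': "?t (Suc i) \<in> {?t i<..T}" if "i < n" for i
    using t[of "Suc i"] that step[of i] T n by (auto simp del: of_nat_Suc simp: divide_strict_right_mono)
  have W_F: "W (?t i) \<in> borel_measurable (F (?t j))" if "i \<le> j" "j \<le> n" for i j
    by (rule measurable_F_mono[OF W_measurable_F[OF t]])
       (use that T in \<open>auto intro!: divide_right_mono mult_right_mono\<close>)
  have D_F: "D i \<in> borel_measurable (F (?t j))" if "i < j" "j \<le> n" for i j
  proof -
    have [measurable]: "W (?t i) \<in> borel_measurable (F (?t j))" "W (?t (Suc i)) \<in> borel_measurable (F (?t j))"
      using W_F[of i j] W_F[of "Suc i" j] that by auto
    show ?thesis unfolding D_def[abs_def] by measurable
  qed
  have D2: "integrable M (\<lambda>\<omega>. (D i \<omega>)\<^sup>2)" "(LINT \<omega>|M. (D i \<omega>)\<^sup>2) = 2 * (T / n)\<^sup>2" if "i < n" for i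
    using increment_moment(1,2)[OF t t', of i] that unfolding D_def step by simp_all
  have DM: "D i \<in> borel_measurable M" if "i < n" for i
    using measurable_F_M[OF D_F[of i "Suc i"]] that by simp
  have "integrable M (\<lambda>\<omega>. (\<Sum>i<m. D i \<omega>)\<^sup>2) \<and> (LINT \<omega>|M. (\<Sum>i<m. D i \<omega>)\<^sup>2) = m * (2 * (T / n)\<^sup>2)"
    if "m \<le> n" for m
    using that
  proof (induction m)
    case (Suc m)
    then have m: "m < n" by simp
    define G where "G \<omega> = (\<Sum>i<m. D i \<omega>)" for \<omega>
    have G [measurable]: "G \<in> borel_measurable (F (?t m))"
      unfolding G_def[abs_def] using m by (intro borel_measurable_sum D_F) auto
    have GM [measurable]: "G \<in> borel_measurable M" by (rule measurable_F_M[OF G])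
    have [measurable]: "D m \<in> borel_measurable M" by (rule DM[OF m])
    have G2: "integrable M (\<lambda>\<omega>. (G \<omega>)\<^sup>2)" "(LINT \<omega>|M. (G \<omega>)\<^sup>2) = m * (2 * (T / n)\<^sup>2)"
      using Suc by (simp_all add: G_def)
    have GD: "integrable M (\<lambda>\<omega>. G \<omega> * D m \<omega>)"
      by (rule integrable_mult_of_squares[OF _ _ G2(1) D2(1)[OF m]]) measurable
    have "(LINT \<omega>|M. G \<omega> * D m \<omega>) =
      (LINT \<omega>|M. LINT x|density lborel (normal_density 0 (sqrt (?t (Suc m) - ?t m))). G \<omega> * (x\<^sup>2 - T / n))"
      using integral_freeze[OF t[OF less_imp_le[OF m]] t'[OF m], of "\<lambda>(\<omega>, x). G \<omega> * (x\<^sup>2 - T / n)"] GD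
      by (simp add: D_def)
    also have "\<dots> = 0"
      using increment_moment(3)[OF t[OF less_imp_le[OF m]] t'[OF m]] unfolding step by simp
    finally have "(LINT \<omega>|M. G \<omega> * D m \<omega>) = 0" .
    moreover have "(\<lambda>\<omega>. (\<Sum>i<Suc m. D i \<omega>)\<^sup>2) = (\<lambda>\<omega>. (G \<omega>)\<^sup>2 + (D m \<omega>)\<^sup>2 + 2 * (G \<omega> * D m \<omega>))"
      by (simp add: G_def power2_sum mult.assoc)
    ultimately show ?case using G2 GD D2[OF m] by (simp add: ring_distribs)
  qed simp
  from this[of n]
  have "integrable M (\<lambda>\<omega>. (\<Sum>i<n. D i \<omega>)\<^sup>2)" "(LINT \<omega>|M. (\<Sum>i<n. D i \<omega>)\<^sup>2) = n * (2 * (T / n)\<^sup>2)" by auto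
  then show "integrable M (\<lambda>\<omega>. (quadratic_variation_error T n (\<lambda>t. W t \<omega>))\<^sup>2)"
    "(LINT \<omega>|M. (quadratic_variation_error T n (\<lambda>t. W t \<omega>))\<^sup>2) = 2 * T\<^sup>2 / n"
    unfolding quadratic_variation_error_def D_def using n
    by (simp_all add: power2_eq_square field_simps)
qed

text \<open>Expanding the square, the cross term E[g X_s X_t] equals E[g X_s^2], since
  \<open>g\<close> and \<open>X s\<close> are known at time s. The weight must be known there for
  every s of a grid, which is why g is taken measurable at time 0.\<close>

lemma integral_martingale_increment_square:
  assumes mart: "martingale_on M F T X" and st: "s \<in> {0..T}" "t \<in> {s..T}"
    and sq: "\<And>r. r \<in> {0..T} \<Longrightarrow> integrable M (\<lambda>\<omega>. (X r \<omega>)\<^sup>2)"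
    and g: "g \<in> borel_measurable (F 0)" "\<And>\<omega>. \<omega> \<in> space M \<Longrightarrow> \<bar>g \<omega>\<bar> \<le> B"
  shows "integrable M (\<lambda>\<omega>. g \<omega> * (X t \<omega> - X s \<omega>)\<^sup>2)"
    and "(LINT \<omega>|M. g \<omega> * (X t \<omega> - X s \<omega>)\<^sup>2) = (LINT \<omega>|M. g \<omega> * (X t \<omega>)\<^sup>2) - (LINT \<omega>|M. g \<omega> * (X s \<omega>)\<^sup>2)"
proof -
  have t: "t \<in> {0..T}" using st by auto
  interpret S: finite_measure_subalgebra M "F s"
    by unfold_locales (rule subalgebra_F)
  have XF: "X r \<in> borel_measurable (F r)" if "r \<in> {0..T}" for r
    using mart that by (auto simp: martingale_on_def)
  have gs [measurable]: "g \<in> borel_measurable (F s)" using measurable_F_mono[OF g(1)] st by auto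
  note XF[OF st(1), measurable]
  note [measurable] = measurable_F_M[OF XF[OF t]] measurable_F_M[OF XF[OF st(1)]] measurable_F_M[OF g(1)]
  have bounded_mult: "integrable M (\<lambda>\<omega>. g \<omega> * Z \<omega>)" if Z: "integrable M Z" for Z :: "'a \<Rightarrow> real"
  proof (rule Bochner_Integration.integrable_bound)
    show "integrable M (\<lambda>\<omega>. B * Z \<omega>)" using Z by simp
    have [measurable]: "Z \<in> borel_measurable M" using Z by simp
    show "(\<lambda>\<omega>. g \<omega> * Z \<omega>) \<in> borel_measurable M" by measurable
    show "AE \<omega> in M. norm (g \<omega> * Z \<omega>) \<le> norm (B * Z \<omega>)"
      using g(2) by (intro AE_I2) (fastforce simp: abs_mult intro!: mult_right_mono)
  qed
  have prod: "integrable M (\<lambda>\<omega>. g \<omega> * (X s \<omega> * X t \<omega>))"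
    by (intro bounded_mult integrable_mult_of_squares sq t st) measurable
  note sqs = bounded_mult[OF sq[OF t]] bounded_mult[OF sq[OF st(1)]]
  have prod': "integrable M (\<lambda>\<omega>. (g \<omega> * X s \<omega>) * X t \<omega>)" using prod by (simp add: mult.assoc)
  have "(LINT \<omega>|M. (g \<omega> * X s \<omega>) * X t \<omega>) = (LINT \<omega>|M. (g \<omega> * X s \<omega>) * real_cond_exp M (F s) (X t) \<omega>)"
    by (rule S.real_cond_exp_intg(2)[OF prod', symmetric]) measurable
  also have "\<dots> = (LINT \<omega>|M. g \<omega> * (X s \<omega>)\<^sup>2)"
  proof (rule integral_cong_AE)
    have "AE \<omega> in M. real_cond_exp M (F s) (X t) \<omega> = X s \<omega>"
      using mart st by (auto simp: martingale_on_def)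
    then show "AE \<omega> in M. (g \<omega> * X s \<omega>) * real_cond_exp M (F s) (X t) \<omega> = g \<omega> * (X s \<omega>)\<^sup>2"
      by eventually_elim (simp add: power2_eq_square)
  qed measurable
  finally have cross: "(LINT \<omega>|M. g \<omega> * (X s \<omega> * X t \<omega>)) = (LINT \<omega>|M. g \<omega> * (X s \<omega>)\<^sup>2)"
    by (simp add: mult.assoc)
  have eq: "(\<lambda>\<omega>. g \<omega> * (X t \<omega> - X s \<omega>)\<^sup>2) =
      (\<lambda>\<omega>. g \<omega> * (X t \<omega>)\<^sup>2 - 2 * (g \<omega> * (X s \<omega> * X t \<omega>)) + g \<omega> * (X s \<omega>)\<^sup>2)"
    by (simp add: power2_diff algebra_simps)
  show "integrable M (\<lambda>\<omega>. g \<omega> * (X t \<omega> - X s \<omega>)\<^sup>2)"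
    unfolding eq using sqs prod by simp
  show "(LINT \<omega>|M. g \<omega> * (X t \<omega> - X s \<omega>)\<^sup>2) = (LINT \<omega>|M. g \<omega> * (X t \<omega>)\<^sup>2) - (LINT \<omega>|M. g \<omega> * (X s \<omega>)\<^sup>2)"
    unfolding eq using sqs prod cross by simp
qed

text \<open>The mean of g times the quadratic variation error of X is exactly E[g X_T^2] - T E[g]
  for every number of grid steps, while the law forces the error to 0 in mean square.\<close>

lemma integral_square_of_brownian_law:
  fixes N :: "(real \<Rightarrow> real) measure"
  assumes T: "0 < T" and mart: "martingale_on M F T X"
    and sq: "\<And>r. r \<in> {0..T} \<Longrightarrow> integrable M (\<lambda>\<omega>. (X r \<omega>)\<^sup>2)"
    and X0: "AE \<omega> in M. X 0 \<omega> = 0"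
    and g: "g \<in> borel_measurable (F 0)" "\<And>\<omega>. \<omega> \<in> space M \<Longrightarrow> \<bar>g \<omega>\<bar> \<le> B"
    and bm: "brownian_motion N G T Z" and law: "process_law M T X = process_law N T Z"
  shows "(LINT \<omega>|M. g \<omega> * (X T \<omega>)\<^sup>2) = T * (LINT \<omega>|M. g \<omega>)"
proof -
  interpret N: prob_space N
    using bm by (simp add: brownian_motion_def filtered_prob_space_def)
  interpret Z: brownian N G T Z
    by unfold_locales (use T bm in auto)
  let ?Q = "quadratic_variation_error T"
  let ?PM = "\<Pi>\<^sub>M t\<in>{0..T}. borel :: real measure"
  have XM: "X r \<in> borel_measurable M" if "r \<in> {0..T}" for r
    using mart that measurable_F_M by (auto simp: martingale_on_def)
  note gM [measurable] = measurable_F_M[OF g(1)]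
  have B0: "0 \<le> B" using g(2) not_empty abs_ge_zero order_trans by (metis ex_in_conv)
  have [measurable]: "(\<lambda>\<omega>. \<lambda>t\<in>{0..T}. X t \<omega>) \<in> measurable M ?PM"
    by (rule measurable_restrict) (rule XM)
  have [measurable]: "(\<lambda>\<omega>. \<lambda>t\<in>{0..T}. Z t \<omega>) \<in> measurable N ?PM"
    by (rule measurable_restrict) (rule Z.W_measurable)
  define q where "q n \<omega> = ?Q n (\<lambda>t. X t \<omega>)" for n \<omega>
  \<comment> \<open>The error factors through the restricted path, so its second moment on M is
    computed on N through the common law.\<close>
  have q: "q n \<in> borel_measurable M" "integrable M (\<lambda>\<omega>. (q n \<omega>)\<^sup>2)" "(LINT \<omega>|M. (q n \<omega>)\<^sup>2) = 2 * T\<^sup>2 / n"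
    if n: "0 < n" for n
  proof -
    note [measurable] = quadratic_variation_error_measurable[OF less_imp_le[OF T], of n]
    note restr = quadratic_variation_error_restrict[OF less_imp_le[OF T]]
    have "(\<lambda>\<omega>. ?Q n (\<lambda>t\<in>{0..T}. X t \<omega>)) \<in> borel_measurable M" by measurable
    then show "q n \<in> borel_measurable M" by (simp add: restr q_def[abs_def])
    note momZ = Z.quadratic_variation_error_moment[OF T n]
    have "integrable (process_law N T Z) (\<lambda>x. (?Q n x)\<^sup>2)"
      unfolding process_law_def by (subst integrable_distr_eq) (use momZ(1) in \<open>auto simp: restr\<close>)
    then have "integrable (process_law M T X) (\<lambda>x. (?Q n x)\<^sup>2)" by (simp add: law)
    then show "integrable M (\<lambda>\<omega>. (q n \<omega>)\<^sup>2)"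
      unfolding process_law_def by (subst (asm) integrable_distr_eq) (auto simp: restr q_def)
    have "(LINT x|process_law N T Z. (?Q n x)\<^sup>2) = 2 * T\<^sup>2 / n"
      unfolding process_law_def by (subst integral_distr) (use momZ(2) in \<open>auto simp: restr\<close>)
    then have "(LINT x|process_law M T X. (?Q n x)\<^sup>2) = 2 * T\<^sup>2 / n" by (simp add: law)
    then show "(LINT \<omega>|M. (q n \<omega>)\<^sup>2) = 2 * T\<^sup>2 / n"
      unfolding process_law_def by (subst (asm) integral_distr) (auto simp: restr q_def)
  qed
  have intg: "integrable M g" by (rule integrable_const_bound[where B=B]) (use g in auto)
  \<comment> \<open>The value of E[g q_n], the same for all n > 0 because the weighted squared
    increments telescope; hence n may be sent to infinity in an estimate of c.\<close>
  define c where "c = (LINT \<omega>|M. g \<omega> * (X T \<omega>)\<^sup>2) - T * (LINT \<omega>|M. g \<omega>)"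
  have gq: "integrable M (\<lambda>\<omega>. g \<omega> * q n \<omega>) \<and> (LINT \<omega>|M. g \<omega> * q n \<omega>) = c" if n: "0 < n" for n
  proof -
    let ?t = "\<lambda>i. real i * T / real n"
    have t: "?t i \<in> {0..T}" if "i \<le> n" for i using T that by (intro grid_in_interval) auto
    have t': "?t (Suc i) \<in> {?t i..T}" if "i < n" for i
      using t[of "Suc i"] that T n by (auto simp del: of_nat_Suc intro!: divide_right_mono mult_right_mono)
    note sqi = integral_martingale_increment_square[OF mart t t' sq g]
    have *: "integrable M (\<lambda>\<omega>. g \<omega> * (X (?t (Suc i)) \<omega> - X (?t i) \<omega>)\<^sup>2)" if "i < n" for i
      by (rule sqi) (use that in auto)
    have eq: "g \<omega> * q n \<omega> = (\<Sum>i<n. g \<omega> * (X (?t (Suc i)) \<omega> - X (?t i) \<omega>)\<^sup>2 - T / n * g \<omega>)" for \<omega>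
      unfolding q_def quadratic_variation_error_def sum_distrib_left
      by (intro sum.cong refl) (simp add: algebra_simps)
    have X0sq: "(LINT \<omega>|M. g \<omega> * (X 0 \<omega>)\<^sup>2) = 0"
    proof -
      have "AE \<omega> in M. g \<omega> * (X 0 \<omega>)\<^sup>2 = 0" using X0 by eventually_elim simp
      then show ?thesis by (rule integral_eq_zero_AE)
    qed
    have "(LINT \<omega>|M. g \<omega> * q n \<omega>) = (\<Sum>i<n. (LINT \<omega>|M. g \<omega> * (X (?t (Suc i)) \<omega> - X (?t i) \<omega>)\<^sup>2) - T / n * (LINT \<omega>|M. g \<omega>))"
      unfolding eq using * intg by (subst Bochner_Integration.integral_sum) auto
    also have "\<dots> = (\<Sum>i<n. (LINT \<omega>|M. g \<omega> * (X (?t (Suc i)) \<omega>)\<^sup>2) - (LINT \<omega>|M. g \<omega> * (X (?t i) \<omega>)\<^sup>2) - T / n * (LINT \<omega>|M. g \<omega>))"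
      using sqi(2) by (intro sum.cong refl) auto
    also have "\<dots> = (LINT \<omega>|M. g \<omega> * (X (?t n) \<omega>)\<^sup>2) - (LINT \<omega>|M. g \<omega> * (X (?t 0) \<omega>)\<^sup>2) - n * (T / n * (LINT \<omega>|M. g \<omega>))"
      using sum_lessThan_telescope[of "\<lambda>i. LINT \<omega>|M. g \<omega> * (X (?t i) \<omega>)\<^sup>2" n]
      by (simp only: sum_subtractf sum_constant card_lessThan)
    also have "\<dots> = c" using n by (simp add: c_def X0sq)
    finally show ?thesis using * intg unfolding eq by auto
  qed
  have "c\<^sup>2 \<le> B\<^sup>2 * (2 * T\<^sup>2) / real n" if n: "0 < n" for n
  proof -
    note [measurable] = q(1)[OF n]
    have le: "(g \<omega> * q n \<omega>)\<^sup>2 \<le> B\<^sup>2 * (q n \<omega>)\<^sup>2" if "\<omega> \<in> space M" for \<omega>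
      using power_mono[OF g(2)[OF that], of 2] by (simp add: power_mult_distrib mult_right_mono)
    have int2: "integrable M (\<lambda>\<omega>. (g \<omega> * q n \<omega>)\<^sup>2)"
      by (rule Bochner_Integration.integrable_bound[where f="\<lambda>\<omega>. B\<^sup>2 * (q n \<omega>)\<^sup>2"])
         (use q(2)[OF n] le in auto)
    \<comment> \<open>Nonnegative variance serves as Cauchy-Schwarz: the squared mean c^2 is at most
      the second moment of g q_n, which is of order 1/n.\<close>
    have "0 \<le> variance (\<lambda>\<omega>. g \<omega> * q n \<omega>)" by (rule variance_positive)
    also have "variance (\<lambda>\<omega>. g \<omega> * q n \<omega>) = (LINT \<omega>|M. (g \<omega> * q n \<omega>)\<^sup>2) - c\<^sup>2"
      using variance_eq[of "\<lambda>\<omega>. g \<omega> * q n \<omega>"] gq[OF n] int2 by simp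
    finally have "c\<^sup>2 \<le> (LINT \<omega>|M. (g \<omega> * q n \<omega>)\<^sup>2)" by simp
    also have "\<dots> \<le> (LINT \<omega>|M. B\<^sup>2 * (q n \<omega>)\<^sup>2)"
      using int2 q(2)[OF n] le by (intro integral_mono) auto
    also have "\<dots> = B\<^sup>2 * (2 * T\<^sup>2) / n" using q(3)[OF n] by simp
    finally show ?thesis .
  qed
  then have "\<forall>\<^sub>F n in sequentially. c\<^sup>2 \<le> B\<^sup>2 * (2 * T\<^sup>2) / real n"
    by (intro eventually_sequentiallyI[of 1]) auto
  moreover have "(\<lambda>n. B\<^sup>2 * (2 * T\<^sup>2) / real n) \<longlonglongrightarrow> 0"
    by (rule lim_const_over_n)
  ultimately have "c\<^sup>2 \<le> 0"
    by (intro tendsto_lowerbound[of _ 0 sequentially]) auto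
  then show ?thesis by (simp add: c_def)
qed

end

section \<open>The calibrated equation\<close>

locale calibrated_solution = brownian M F T W
  for M :: "'a measure" and F :: "real \<Rightarrow> 'a measure" and T :: real and W :: "real \<Rightarrow> 'a \<Rightarrow> real" +
  fixes f :: "'n::finite \<Rightarrow> real" and Y :: "'a \<Rightarrow> 'n" and X V :: "real \<Rightarrow> 'a \<Rightarrow> real"
  assumes T_pos: "0 < T" and f_pos: "\<And>i. 0 < f i"
    and Y_measurable: "Y \<in> measurable (F 0) (count_space UNIV)"
    and X_0: "AE \<omega> in M. X 0 \<omega> = 0"
    and V_progressive: "progressive F T V"
    and V_cond_exp: "\<And>t. t \<in> {0..T} \<Longrightarrow>
      AE \<omega> in M. V t \<omega> = cond_exp_given M (\<lambda>\<omega>. (f (Y \<omega>))\<^sup>2) (X t) \<omega>"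
    and X_ito: "has_ito_integral M F T W (\<lambda>t \<omega>. f (Y \<omega>) / sqrt (V t \<omega>)) X"
begin

section \<open>Bounds on the conditional expectation and on the integrand\<close>

definition lam :: "'a \<Rightarrow> real" where "lam \<omega> = (f (Y \<omega>))\<^sup>2"
definition lmin :: real where "lmin = Min (range (\<lambda>i. (f i)\<^sup>2))"
definition lmax :: real where "lmax = Max (range (\<lambda>i. (f i)\<^sup>2))"

text \<open>Where \<open>V\<close> is not positive, which happens only on null sets, \<open>H\<close> takes junk values; this is why
  bounds on \<open>H\<close> hold only almost everywhere.\<close>
definition H :: "real \<Rightarrow> 'a \<Rightarrow> real" where "H t \<omega> = f (Y \<omega>) / sqrt (V t \<omega>)"

lemma lmin_pos: "0 < lmin"
proof -
  have "f i \<noteq> 0" for i using f_pos[of i] by simp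
  then show ?thesis unfolding lmin_def by (subst Min_gr_iff) auto
qed

lemma lam_bounds: "lmin \<le> lam \<omega>" "lam \<omega> \<le> lmax"
  unfolding lmin_def lmax_def lam_def by auto

lemma lam_measurable_F: "lam \<in> borel_measurable (F 0)"
  unfolding lam_def[abs_def] by (rule measurable_compose[OF Y_measurable]) simp

lemma lam_measurable: "lam \<in> borel_measurable M"
  by (rule measurable_F_M[OF lam_measurable_F])

lemma lam_bounded: "\<bar>lam \<omega>\<bar> \<le> lmax"
  using lam_bounds[of \<omega>] lmin_pos by simp

lemma lam_integrable: "integrable M lam"
  by (rule integrable_const_bound[where B=lmax]) (use lam_bounded lam_measurable in auto)

lemma V_joint_measurable: "(\<lambda>x. V (fst x) (snd x)) \<in> borel_measurable (time_measure T \<Otimes>\<^sub>M M)"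
  by (rule progressive_joint_measurable[OF V_progressive])

lemma X_meas: "t \<in> {0..T} \<Longrightarrow> X t \<in> borel_measurable M"
  using X_ito by (auto simp: has_ito_integral_def continuous_adapted_def intro!: measurable_F_M[of _ t])

abbreviation sigma_X :: "real \<Rightarrow> 'a measure" where
  "sigma_X t \<equiv> vimage_algebra (space M) (X t) borel"

lemma subalgebra_sigma_X: "t \<in> {0..T} \<Longrightarrow> subalgebra M (sigma_X t)"
  using X_meas[of t] unfolding subalgebra_def by (auto simp: sets_vimage_algebra2)

lemma finite_measure_subalgebra_sigma_X:
  "t \<in> {0..T} \<Longrightarrow> finite_measure_subalgebra M (sigma_X t)"
  by unfold_locales (rule subalgebra_sigma_X)

lemma V_eq: "t \<in> {0..T} \<Longrightarrow> AE \<omega> in M. V t \<omega> = real_cond_exp M (sigma_X t) lam \<omega>"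
  using V_cond_exp[of t] by (simp add: cond_exp_given_def lam_def[abs_def])

lemma V_measurable: "t \<in> {0..T} \<Longrightarrow> V t \<in> borel_measurable M"
  using measurable_compose[OF measurable_Pair1' V_joint_measurable, of t]
  by (simp add: space_time_measure)

lemma V_bounds:
  assumes t: "t \<in> {0..T}"
  shows "AE \<omega> in M. lmin \<le> V t \<omega> \<and> V t \<omega> \<le> lmax"
proof -
  interpret S: finite_measure_subalgebra M "sigma_X t"
    by (rule finite_measure_subalgebra_sigma_X[OF t])
  have "AE \<omega> in M. lmin \<le> real_cond_exp M (sigma_X t) lam \<omega>"
    by (rule S.real_cond_exp_ge_c[OF lam_integrable]) (simp add: lam_bounds)
  moreover have "AE \<omega> in M. real_cond_exp M (sigma_X t) lam \<omega> \<le> lmax"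
    by (rule S.real_cond_exp_le_c[OF lam_integrable]) (simp add: lam_bounds)
  ultimately show ?thesis using V_eq[OF t] by eventually_elim simp
qed

text \<open>The exceptional set in \<open>V_bounds\<close> depends on t; joint measurability of V
  lets Fubini gather these sets into one null set of the product.\<close>

lemma V_bounds_joint:
  "AE x in time_measure T \<Otimes>\<^sub>M M. lmin \<le> V (fst x) (snd x) \<and> V (fst x) (snd x) \<le> lmax"
proof (rule time_prod.AE_pair_measure)
  note [measurable] = V_joint_measurable
  show "{x \<in> space (time_measure T \<Otimes>\<^sub>M M). lmin \<le> V (fst x) (snd x) \<and> V (fst x) (snd x) \<le> lmax}
      \<in> sets (time_measure T \<Otimes>\<^sub>M M)" by measurable
  show "AE r in time_measure T. AE \<omega> in M. lmin \<le> V (fst (r, \<omega>)) (snd (r, \<omega>)) \<and> V (fst (r, \<omega>)) (snd (r, \<omega>)) \<le> lmax"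
  proof (rule AE_I2)
    fix r assume "r \<in> space (time_measure T)"
    then show "AE \<omega> in M. lmin \<le> V (fst (r, \<omega>)) (snd (r, \<omega>)) \<and> V (fst (r, \<omega>)) (snd (r, \<omega>)) \<le> lmax"
      using V_bounds[of r] by (simp add: space_time_measure)
  qed
qed

lemma H_square: "0 < V t \<omega> \<Longrightarrow> (H t \<omega>)\<^sup>2 = lam \<omega> / V t \<omega>"
  by (simp add: H_def lam_def power_divide)

lemma H_square_bound:
  assumes "lmin \<le> V t \<omega>"
  shows "(H t \<omega>)\<^sup>2 \<le> lmax / lmin"
  using assms lmin_pos lam_bounds[of \<omega>] by (subst H_square) (auto intro!: frac_le)

text \<open>Where V is at least \<open>lmin\<close>, H^2 = \<open>lam\<close> / V is at most
  \<open>lmax / lmin\<close>; hence the constant.\<close>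

sublocale bounded_ito_integral M F T W H X "sqrt (lmax / lmin)"
proof unfold_locales
  show "has_ito_integral M F T W H X" using X_ito by (simp add: H_def[abs_def])
  show "AE x in time_measure T \<Otimes>\<^sub>M M. \<bar>H (fst x) (snd x)\<bar> \<le> sqrt (lmax / lmin)"
    using V_bounds_joint by eventually_elim (auto intro!: real_le_rsqrt H_square_bound)
qed

lemma H_measurable: "t \<in> {0..T} \<Longrightarrow> H t \<in> borel_measurable M"
  using measurable_compose[OF measurable_Pair1' H_joint_measurable, of t]
  by (simp add: space_time_measure)

lemma H_square_le: "t \<in> {0..T} \<Longrightarrow> AE \<omega> in M. (H t \<omega>)\<^sup>2 \<le> lmax / lmin"
  using V_bounds[of t] by (auto elim!: eventually_mono intro: H_square_bound)

text \<open>This is E[H_t^2 | X_t] = 1 in tested form: H_t^2 is \<open>lam\<close> divided by its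
  conditional expectation given X_t, and w over that conditional expectation can be pulled out as a
  function of X_t.\<close>

lemma integral_H_square:
  assumes t: "t \<in> {0..T}"
    and w: "w \<in> borel_measurable (sigma_X t)" "\<And>\<omega>. \<bar>w \<omega>\<bar> \<le> B"
  shows "(LINT \<omega>|M. w \<omega> * (H t \<omega>)\<^sup>2) = (LINT \<omega>|M. w \<omega>)"
proof -
  interpret S: finite_measure_subalgebra M "sigma_X t"
    by (rule finite_measure_subalgebra_sigma_X[OF t])
  \<comment> \<open>\<open>V t\<close> is only almost surely equal to \<open>?E\<close>;
    \<open>?E\<close> itself is measurable for \<open>sigma_X t\<close>, as pulling out
    \<open>w / ?E\<close> requires.\<close>
  let ?E = "real_cond_exp M (sigma_X t) lam"
  note [measurable] = w(1) measurable_from_subalg[OF S.subalg w(1)] lam_measurable H_measurable[OF t]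
  have E: "AE \<omega> in M. ?E \<omega> = V t \<omega> \<and> 0 < ?E \<omega> \<and> (H t \<omega>)\<^sup>2 = lam \<omega> / ?E \<omega> \<and> (H t \<omega>)\<^sup>2 \<le> lmax / lmin"
    using V_eq[OF t] V_bounds[OF t] H_square_le[OF t]
    by eventually_elim (use lmin_pos H_square in auto)
  have B0: "0 \<le> B" using w(2) abs_ge_zero order_trans by blast
  have int: "integrable M (\<lambda>\<omega>. w \<omega> / ?E \<omega> * lam \<omega>)"
  proof (rule integrable_const_bound[where B="B * (lmax / lmin)"])
    show "AE \<omega> in M. norm (w \<omega> / ?E \<omega> * lam \<omega>) \<le> B * (lmax / lmin)"
      using E
    proof eventually_elim
      case (elim \<omega>)
      then have "w \<omega> / ?E \<omega> * lam \<omega> = w \<omega> * (H t \<omega>)\<^sup>2" by simp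
      moreover have "\<bar>w \<omega>\<bar> * (H t \<omega>)\<^sup>2 \<le> B * (lmax / lmin)"
        by (rule mult_mono[OF w(2) _ B0 zero_le_power2]) (use elim in blast)
      ultimately show ?case by (simp add: abs_mult)
    qed
  qed measurable
  have "(LINT \<omega>|M. w \<omega> * (H t \<omega>)\<^sup>2) = (LINT \<omega>|M. w \<omega> / ?E \<omega> * lam \<omega>)"
  proof (rule integral_cong_AE)
    show "AE \<omega> in M. w \<omega> * (H t \<omega>)\<^sup>2 = w \<omega> / ?E \<omega> * lam \<omega>"
      using E by eventually_elim simp
  qed measurable
  also have "\<dots> = (LINT \<omega>|M. w \<omega> / ?E \<omega> * ?E \<omega>)"
    by (rule S.real_cond_exp_intg(2)[OF int, symmetric]) measurable
  also have "\<dots> = (LINT \<omega>|M. w \<omega>)"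
  proof (rule integral_cong_AE)
    show "AE \<omega> in M. w \<omega> / ?E \<omega> * ?E \<omega> = w \<omega>"
      using E by eventually_elim simp
  qed measurable
  finally show ?thesis .
qed

text \<open>Cosine and sine of u X_t are bounded functions of X_t, so the real-valued
  \<open>integral_H_square\<close> handles the real and imaginary parts separately.\<close>

lemma integral_exp_H_square:
  assumes t: "t \<in> {0..T}"
  shows "(CLINT \<omega>|M. of_real ((H t \<omega>)\<^sup>2) * iexp (u * X t \<omega>)) = (CLINT \<omega>|M. iexp (u * X t \<omega>))"
proof -
  note [measurable] = X_meas[OF t] H_measurable[OF t] measurable_vimage_algebra1[of "X t" "space M" borel]
  have int: "integrable M (\<lambda>\<omega>. of_real ((H t \<omega>)\<^sup>2) * iexp (u * X t \<omega>))"
    by (rule integrable_const_bound[where B="lmax / lmin"])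
       (use H_square_le[OF t] in \<open>auto simp: norm_mult norm_power\<close>)
  have int': "integrable M (\<lambda>\<omega>. iexp (u * X t \<omega>))"
    by (rule integrable_const_bound[where B=1]) auto
  have cos: "(LINT \<omega>|M. cos (u * X t \<omega>) * (H t \<omega>)\<^sup>2) = (LINT \<omega>|M. cos (u * X t \<omega>))"
    by (rule integral_H_square[OF t, where B=1]) auto
  have sin: "(LINT \<omega>|M. sin (u * X t \<omega>) * (H t \<omega>)\<^sup>2) = (LINT \<omega>|M. sin (u * X t \<omega>))"
    by (rule integral_H_square[OF t, where B=1]) auto
  show ?thesis
  proof (rule complex_eqI)
    show "Re (CLINT \<omega>|M. of_real ((H t \<omega>)\<^sup>2) * iexp (u * X t \<omega>)) = Re (CLINT \<omega>|M. iexp (u * X t \<omega>))"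
      unfolding integral_Re[OF int, symmetric] integral_Re[OF int', symmetric]
      using cos by (simp add: Re_exp mult.commute)
    show "Im (CLINT \<omega>|M. of_real ((H t \<omega>)\<^sup>2) * iexp (u * X t \<omega>)) = Im (CLINT \<omega>|M. iexp (u * X t \<omega>))"
      unfolding integral_Im[OF int, symmetric] integral_Im[OF int', symmetric]
      using sin by (simp add: Im_exp mult.commute)
  qed
qed

section \<open>Gaussian marginals, from the closed equation with weight 1\<close>

lemma X_char:
  assumes t: "t \<in> {0..T}"
  shows "(CLINT \<omega>|M. iexp (u * X t \<omega>)) = of_real (exp (- (u\<^sup>2 / 2 * t)))"
proof -
  have "AE r in time_measure T. (CLINT \<omega>|M. of_real (1 * (H r \<omega>)\<^sup>2) * iexp (u * X r \<omega>)) =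
      (CLINT \<omega>|M. of_real 1 * iexp (u * X r \<omega>))"
  proof (rule AE_I2)
    fix r assume "r \<in> space (time_measure T)"
    then show "(CLINT \<omega>|M. of_real (1 * (H r \<omega>)\<^sup>2) * iexp (u * X r \<omega>)) = (CLINT \<omega>|M. of_real 1 * iexp (u * X r \<omega>))"
      using integral_exp_H_square[of r u] by (simp add: space_time_measure)
  qed
  from integral_exp_X_eq[OF t _ _ this, of 1] show ?thesis by (simp add: prob_space)
qed

lemma X_distributed: "t \<in> {0<..T} \<Longrightarrow> distributed M lborel (X t) (normal_density 0 (sqrt t))"
  using X_meas X_char by (intro distributed_normal_of_char) auto

lemma X_square_integrable:
  assumes t: "t \<in> {0..T}"
  shows "integrable M (\<lambda>\<omega>. (X t \<omega>)\<^sup>2)"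
proof (cases "t = 0")
  case True
  have "AE \<omega> in M. (X t \<omega>)\<^sup>2 = 0" using X_0 True by auto
  then show ?thesis using X_meas[OF t] by (subst integrable_cong_AE[where g="\<lambda>_. 0"]) auto
next
  case False
  then have t: "t \<in> {0<..T}" using assms by auto
  then show ?thesis
    using distributed_integrable[OF X_distributed[OF t], of "\<lambda>x. x\<^sup>2"]
      integrable_normal_moment[of "sqrt t" 0 2] by simp
qed

text \<open>The functions \<open>lam\<close>, V and \<open>lam\<close> H^2 all have integral T
  E[\<open>lam\<close>] over time and space: the second by the tower property, the third by the
  isometry and the Brownian law. Thus \<open>lam\<close> H^2 - 2 \<open>lam\<close> + V, which is
  (\<open>lam\<close> - V)^2 / V wherever V > 0, is nonnegative almost everywhere with integral
  0.\<close>

lemma AE_lam_eq_V: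
  assumes bm: "brownian_motion N G T Z" and law: "process_law M T X = process_law (N :: (real \<Rightarrow> real) measure) T Z"
  shows "AE x in time_measure T \<Otimes>\<^sub>M M. lam (snd x) = V (fst x) (snd x)"
proof -
  let ?P = "time_measure T \<Otimes>\<^sub>M M"
  interpret P: finite_measure ?P by (rule finite_measure_prod)
  note [measurable] = V_joint_measurable H_joint_measurable lam_measurable
  have time: "measure (time_measure T) {0..T} = T"
    using T_pos by (simp add: measure_restrict_space)
  have lam_int: "integrable ?P (\<lambda>x. lam (snd x))"
    by (rule P.integrable_const_bound[where B=lmax]) (auto simp: lam_bounded)
  have V_int: "integrable ?P (\<lambda>x. V (fst x) (snd x))"
  proof (rule P.integrable_const_bound[where B=lmax])
    show "AE x in ?P. norm (V (fst x) (snd x)) \<le> lmax"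
      using V_bounds_joint by eventually_elim (use lmin_pos in auto)
  qed measurable
  have lamH_int: "integrable ?P (\<lambda>x. lam (snd x) * (H (fst x) (snd x))\<^sup>2)"
  proof (rule P.integrable_const_bound[where B="lmax * (lmax / lmin)"])
    show "AE x in ?P. norm (lam (snd x) * (H (fst x) (snd x))\<^sup>2) \<le> lmax * (lmax / lmin)"
      using V_bounds_joint
    proof eventually_elim
      case (elim x)
      then have "\<bar>lam (snd x)\<bar> * (H (fst x) (snd x))\<^sup>2 \<le> lmax * (lmax / lmin)"
        using lam_bounded[of "snd x"] order_trans[OF abs_ge_zero lam_bounded]
        by (intro mult_mono H_square_bound) auto
      then show ?case by (simp add: abs_mult)
    qed
  qed measurable
  have 1: "(LINT x|?P. lam (snd x)) = T * (LINT \<omega>|M. lam \<omega>)"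
    using time_prod.integral_fst'[OF lam_int] time by (simp add: space_time_measure)
  have "(LINT x|?P. V (fst x) (snd x)) = (LINT r|time_measure T. LINT \<omega>|M. V r \<omega>)"
    using time_prod.integral_fst'[OF V_int] by simp
  also have "\<dots> = (LINT r|time_measure T. LINT \<omega>|M. lam \<omega>)"
  proof (rule Bochner_Integration.integral_cong[OF refl])
    fix r assume "r \<in> space (time_measure T)"
    then have r: "r \<in> {0..T}" by (simp add: space_time_measure)
    interpret S: finite_measure_subalgebra M "sigma_X r"
      by (rule finite_measure_subalgebra_sigma_X[OF r])
    have "(LINT \<omega>|M. V r \<omega>) = (LINT \<omega>|M. real_cond_exp M (sigma_X r) lam \<omega>)"
      by (rule integral_cong_AE[OF V_measurable[OF r] _ V_eq[OF r]]) simp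
    then show "(LINT \<omega>|M. V r \<omega>) = (LINT \<omega>|M. lam \<omega>)"
      using S.real_cond_exp_int(2)[OF lam_integrable] by simp
  qed
  also have "\<dots> = T * (LINT \<omega>|M. lam \<omega>)" using time by (simp add: space_time_measure)
  finally have 2: "(LINT x|?P. V (fst x) (snd x)) = T * (LINT \<omega>|M. lam \<omega>)" .
  have 3: "(LINT x|?P. lam (snd x) * (H (fst x) (snd x))\<^sup>2) = T * (LINT \<omega>|M. lam \<omega>)"
  proof -
    have "(LINT x|?P. lam (snd x) * (H (fst x) (snd x))\<^sup>2) = (LINT \<omega>|M. lam \<omega> * (X T \<omega>)\<^sup>2)"
      using T_pos by (intro ito_isometry[symmetric, OF lam_measurable_F lam_bounded] X_square_integrable) simp
    also have "\<dots> = T * (LINT \<omega>|M. lam \<omega>)"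
      by (rule integral_square_of_brownian_law[OF T_pos martingale_X X_square_integrable X_0
            lam_measurable_F lam_bounded bm law])
    finally show ?thesis .
  qed
  \<comment> \<open>Written with H rather than as a quotient, so that its integral is a sum of three
    known ones; the quotient form holds only almost everywhere.\<close>
  let ?d = "\<lambda>x. lam (snd x) * (H (fst x) (snd x))\<^sup>2 - 2 * lam (snd x) + V (fst x) (snd x)"
  have d: "AE x in ?P. ?d x = (lam (snd x) - V (fst x) (snd x))\<^sup>2 / V (fst x) (snd x) \<and> 0 < V (fst x) (snd x)"
    using V_bounds_joint
  proof eventually_elim
    case (elim x)
    then have pos: "0 < V (fst x) (snd x)" using lmin_pos by linarith
    then show ?case
      unfolding H_square[OF pos] by (simp add: power2_eq_square field_simps)
  qed
  have d_int: "integrable ?P ?d" using lamH_int lam_int V_int by simp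
  have "integral\<^sup>L ?P ?d = 0"
    using 1 2 3 lamH_int lam_int V_int by simp
  moreover have "AE x in ?P. 0 \<le> ?d x" using d by eventually_elim simp
  ultimately have "AE x in ?P. ?d x = 0"
    using integral_nonneg_eq_0_iff_AE[OF d_int] by simp
  with d show ?thesis by eventually_elim auto
qed

text \<open>Equality of \<open>lam\<close> and V makes H^2 = 1, so \<open>integral_exp_X_eq\<close>
  applies with weight \<open>lam\<close> and gives E[\<open>lam\<close> exp(iuX_t)] =
  E[\<open>lam\<close>] E[exp(iuX_t)]. Therefore E[\<open>lam\<close> | X_r] is constant, yet at a
  suitable time r it is also V_r = \<open>lam\<close>.\<close>

lemma lam_AE_const:
  assumes eq: "AE x in time_measure T \<Otimes>\<^sub>M M. lam (snd x) = V (fst x) (snd x)"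
  shows "AE \<omega> in M. lam \<omega> = (LINT \<omega>|M. lam \<omega>)"
proof -
  define c where "c = (LINT \<omega>|M. lam \<omega>)"
  have c: "0 < c"
  proof -
    have "lmin \<le> c" unfolding c_def
      by (rule integral_ge_const[OF lam_integrable]) (simp add: lam_bounds)
    then show ?thesis using lmin_pos by simp
  qed
  note [measurable] = lam_measurable
  have eq': "AE r in time_measure T. AE \<omega> in M. lam \<omega> = V r \<omega>"
    using time_prod.AE_pair[OF eq] by simp
  have char: "(CLINT \<omega>|M. of_real (lam \<omega>) * iexp (u * X t \<omega>)) = of_real c * (CLINT \<omega>|M. iexp (u * X t \<omega>))"
    if t: "t \<in> {0..T}" for t u
  proof -
    have "AE r in time_measure T. (CLINT \<omega>|M. of_real (lam \<omega> * (H r \<omega>)\<^sup>2) * iexp (u * X r \<omega>)) =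
      (CLINT \<omega>|M. of_real (lam \<omega>) * iexp (u * X r \<omega>))"
      using eq' AE_space
    proof eventually_elim
      case (elim r)
      then have r: "r \<in> {0..T}" by (simp add: space_time_measure)
      note [measurable] = X_meas[OF r] H_measurable[OF r]
      have "AE \<omega> in M. (H r \<omega>)\<^sup>2 = 1"
        using elim(1) V_bounds[OF r]
        by eventually_elim (use lmin_pos H_square[of r] in auto)
      then have "AE \<omega> in M. of_real (lam \<omega> * (H r \<omega>)\<^sup>2) * iexp (u * X r \<omega>) = of_real (lam \<omega>) * iexp (u * X r \<omega>)"
        by eventually_elim (simp del: of_real_power)
      then show ?case by (intro integral_cong_AE) measurable
    qed
    from integral_exp_X_eq[OF t lam_measurable_F lam_bounded this] X_char[OF t, of u]
    show ?thesis by (simp add: c_def)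
  qed
  \<comment> \<open>As T > 0 the time measure is not zero, so a property of almost every time holds
    at some time r.\<close>
  have "ae_filter (time_measure T) \<noteq> bot"
    using T_pos by (simp add: ae_filter_eq_bot_iff emeasure_restrict_space space_time_measure)
  then obtain r where r: "r \<in> {0..T}" "AE \<omega> in M. lam \<omega> = V r \<omega>"
    using eventually_happens'[OF _ eventually_conj[OF eq' AE_space]]
    by (auto simp: space_time_measure)
  interpret S: finite_measure_subalgebra M "sigma_X r"
    by (rule finite_measure_subalgebra_sigma_X[OF r(1)])
  note [measurable] = X_meas[OF r(1)]
  txt \<open>\<open>D\<close> is \<open>M\<close> reweighted by \<open>f\<^sup>2(Y)\<close>; by \<open>char\<close> it gives \<open>X\<^sub>r\<close> the same law as \<open>M\<close>.\<close>
  define D where "D = density M (\<lambda>\<omega>. ennreal (lam \<omega> / c))"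
  have lc: "0 \<le> lam \<omega> / c" for \<omega> using lam_bounds(1)[of \<omega>] lmin_pos c by simp
  have D: "prob_space D"
  proof (rule prob_spaceI)
    have "emeasure D (space D) = (\<integral>\<^sup>+\<omega>. ennreal (lam \<omega> / c) \<partial>M)"
      by (simp add: D_def emeasure_density nn_integral_set_ennreal cong: nn_integral_cong)
    also have "\<dots> = ennreal (LINT \<omega>|M. lam \<omega> / c)"
      by (rule nn_integral_eq_integral) (use lam_integrable lc in auto)
    finally show "emeasure D (space D) = 1" using c by (simp add: c_def[symmetric])
  qed
  have XD [measurable]: "X r \<in> borel_measurable D" by (simp add: D_def)
  have law: "distr D borel (X r) = distr M borel (X r)"
  proof (rule Levy_uniqueness)
    show "real_distribution (distr D borel (X r))"
      by (rule prob_space.real_distribution_distr[OF D]) simp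
    show "real_distribution (distr M borel (X r))" by (rule real_distribution_distr) simp
    show "char (distr D borel (X r)) = char (distr M borel (X r))"
    proof
      fix u
      have "char (distr D borel (X r)) u = (CLINT \<omega>|D. iexp (u * X r \<omega>))"
        unfolding char_def by (rule integral_distr) measurable
      also have "\<dots> = (CLINT \<omega>|M. (lam \<omega> / c) *\<^sub>R iexp (u * X r \<omega>))"
        unfolding D_def by (rule integral_density) (use lc in auto)
      also have "\<dots> = (CLINT \<omega>|M. of_real (inverse c) * (of_real (lam \<omega>) * iexp (u * X r \<omega>)))"
        by (simp add: scaleR_conv_of_real divide_inverse mult_ac)
      also have "\<dots> = of_real (inverse c) * (of_real c * (CLINT \<omega>|M. iexp (u * X r \<omega>)))"
        unfolding integral_mult_right_zero char[OF r(1)] ..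
      also have "\<dots> = (CLINT \<omega>|M. iexp (u * X r \<omega>))"
        using c by simp
      also have "\<dots> = char (distr M borel (X r)) u"
        unfolding char_def by (rule integral_distr[symmetric]) measurable
      finally show "char (distr D borel (X r)) u = char (distr M borel (X r)) u" .
    qed
  qed
  \<comment> \<open>Events of \<open>sigma_X r\<close> are equally likely under \<open>D\<close> and
    M; multiplied by c, this says that the constant c is a version of
    E[\<open>lam\<close> | X_r].\<close>
  have "(LINT \<omega>:A|M. lam \<omega>) = (LINT \<omega>:A|M. c)" if A: "A \<in> sets (sigma_X r)" for A
  proof -
    obtain B where B [measurable]: "B \<in> sets borel" and A_eq: "A = X r -` B \<inter> space M"
      using A by (auto simp: sets_vimage_algebra2)
    have AM [measurable]: "A \<in> sets M" unfolding A_eq by measurable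
    have AD: "A = X r -` B \<inter> space D" by (simp add: A_eq D_def)
    have "measure D A = measure M A"
      using law AD A_eq by (metis B XD \<open>X r \<in> borel_measurable M\<close> measure_distr)
    also have "measure D A = (LINT \<omega>|D. indicator A \<omega>)"
      by (simp add: D_def)
    also have "\<dots> = (LINT \<omega>|M. lam \<omega> / c * indicator A \<omega>)"
      unfolding D_def by (subst integral_density) (use lc in auto)
    finally have "(LINT \<omega>|M. lam \<omega> * indicator A \<omega>) = c * measure M A"
      using c by (simp add: field_simps)
    then show ?thesis
      unfolding set_lebesgue_integral_def by (simp add: mult.commute)
  qed
  then have "AE \<omega> in M. real_cond_exp M (sigma_X r) lam \<omega> = c"
    by (intro S.real_cond_exp_charact lam_integrable) auto
  then have "AE \<omega> in M. lam \<omega> = c"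
    using V_eq[OF r(1)] r(2) by eventually_elim simp
  then show ?thesis by (simp add: c_def)
qed

end

theorem proposition2p3:
  fixes f \<alpha> :: "'n::finite \<Rightarrow> real" and T :: real
    and M :: "'a measure" and F :: "real \<Rightarrow> 'a measure"
    and W X :: "real \<Rightarrow> 'a \<Rightarrow> real" and Y :: "'a \<Rightarrow> 'n"
  assumes "CARD('n) \<ge> 2"
    and "\<And>i. f i > 0"
    and "\<And>i. \<alpha> i > 0" and "(\<Sum>i\<in>UNIV. \<alpha> i) = 1"
    and "T > 0"
    and "condition_C (\<lambda>i. (f i)\<^sup>2)"
    and "\<not> f constant_on UNIV"
    and "weak_solution f \<alpha> T M F W Y X"
  shows "continuous_fake_brownian_motion M F T X"
proof -
  note f = \<open>\<And>i. f i > 0\<close>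
  note sol = \<open>weak_solution f \<alpha> T M F W Y X\<close>[unfolded weak_solution_def]
  obtain V where V: "progressive F T V"
    "\<forall>t\<in>{0..T}. AE \<omega> in M. V t \<omega> = cond_exp_given M (\<lambda>\<omega>. (f (Y \<omega>))\<^sup>2) (X t) \<omega>"
    "has_ito_integral M F T W (\<lambda>t \<omega>. f (Y \<omega>) / sqrt (V t \<omega>)) X"
    using sol by blast
  interpret prob_space M using sol by (simp add: filtered_prob_space_def)
  interpret calibrated_solution M F T W f Y X V
    by unfold_locales (use sol V f \<open>T > 0\<close> in auto)
  have "process_law M T X \<noteq> process_law N T Z"
    if bm: "brownian_motion N G T Z" for N :: "(real \<Rightarrow> real) measure" and G Z
  proof
    assume law: "process_law M T X = process_law N T Z"
    define c where "c = (LINT \<omega>|M. lam \<omega>)"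
    have const: "AE \<omega> in M. lam \<omega> = c"
      using lam_AE_const[OF AE_lam_eq_V[OF bm law]] by (simp add: c_def)
    have "f i = sqrt c" for i
    proof -
      note [measurable] = measurable_F_M[OF Y_measurable]
      have "{\<omega> \<in> space M. Y \<omega> = i} \<in> events" by measurable
      \<comment> \<open>Every value i has positive probability \<alpha> i, so no exceptional null
        set can hide it and the almost sure constancy of \<open>lam\<close> reaches all i.\<close>
      moreover have "prob {\<omega> \<in> space M. Y \<omega> = i} \<noteq> 0"
        using sol \<open>\<And>i. \<alpha> i > 0\<close>[of i] by simp
      ultimately have "\<not> (AE \<omega> in M. Y \<omega> \<noteq> i)"
        by (simp add: prob_eq_0)
      \<comment> \<open>Where Y = i, \<open>lam\<close> = c means f(i)^2 = c, and positivity of f(i)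
        selects the root sqrt c.\<close>
      moreover have "AE \<omega> in M. Y \<omega> \<noteq> i" if "f i \<noteq> sqrt c"
        using const
      proof eventually_elim
        case (elim \<omega>)
        then show ?case using that f[of i] by (auto simp: lam_def real_sqrt_unique)
      qed
      ultimately show ?thesis by blast
    qed
    then have "f constant_on UNIV" by (auto simp: constant_on_def)
    then show False using \<open>\<not> f constant_on UNIV\<close> by simp
  qed
  then show ?thesis
    unfolding continuous_fake_brownian_motion_def
    using sol martingale_X X_distributed by blast
qed

end
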